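(* Given an instance of the online replacement path problem (ORP) on an undirected graph $G=(V,E,\ell)$ with $n$ vertices, $m$ edges, nonnegative edge weights and destination $t$, the potential $y(v)$ of every vertex $v\in V$, together with corresponding optimal nominal paths (simple $v$-$t$ paths $P$ with $\mathrm{Val}(P)=y(v)$), can be computed in time $O(m\log n)$.
   Context: Paths are sets of edges; $\ell(A)=\sum_{e\in A}\ell(e)$; $P[a,b]$ is the subpath of $P$ between vertices $a,b$. For an edge $e$ and vertex $x$, $s^{-e}_x=d_{G-e}(x,t)$ is the shortest $x$-$t$ distance in $G$ with $e$ removed. For a vertex $v$ and a simple $v$-$t$ path $P$, its robust length is $\mathrm{Val}(P)=\max\{\ell(P),\max_{xx'\in P}\{\ell(P[v,x])+s^{-xx'}_x\}\}$, where for each edge $xx'\in P$ the vertex $x$ is the endpoint met first when traversing $P$ from $v$ to $t$; this is the worst-case arrival time when following $P$ and, upon finding the next edge $xx'$ failed at $x$, taking a shortest $x$-$t$ detour avoiding $xx'$ (at most one edge fails). The potential is $y(v)=\min\{\mathrm{Val}(P): P\text{ a simple } v\text{-}t\text{ path}\}$. ORP asks, for a source $s$, to compute $y(s)$ and an optimal nominal path. *)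

theory Defs
  imports Complex_Main "HOL-Library.Extended_Real"
begin

section \<open>Graphs, robust length and potential\<close>

text \<open>Undirected simple graphs: an edge is a two-element set of vertices. A path is given by its
  sequence of vertices (which, in a simple graph, determines and, together with its first vertex, is
  determined by its edge set); \<open>[v]\<close> is the trivial path from \<open>v\<close> to itself.\<close>

definition undirected_graph :: "'a set \<Rightarrow> 'a set set \<Rightarrow> bool" where
  "undirected_graph V E \<longleftrightarrow> finite V \<and> (\<forall>e\<in>E. e \<subseteq> V \<and> card e = 2)"

definition simple_paths :: "'a set set \<Rightarrow> 'a \<Rightarrow> 'a \<Rightarrow> 'a list set" where
  "simple_paths E x y =
     {p. p \<noteq> [] \<and> distinct p \<and> hd p = x \<and> last p = y \<and>
         (\<forall>i. Suc i < length p \<longrightarrow> {p ! i, p ! Suc i} \<in> E)}"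

definition path_edges :: "'a list \<Rightarrow> 'a set set" where
  "path_edges p = {{p ! i, p ! Suc i} |i. Suc i < length p}"

definition path_length :: "('a set \<Rightarrow> real) \<Rightarrow> 'a list \<Rightarrow> real" where
  "path_length l p = sum l (path_edges p)"

text \<open>Only finitely many simple paths exist in a finite graph, so the two infima below are minima,
  except that they are \<open>\<infinity>\<close> if there is no path at all.\<close>

definition distance :: "'a set set \<Rightarrow> ('a set \<Rightarrow> real) \<Rightarrow> 'a \<Rightarrow> 'a \<Rightarrow> ereal" where
  "distance E l x y = (INF p\<in>simple_paths E x y. ereal (path_length l p))"

definition replacement_distance ::
    "'a set set \<Rightarrow> ('a set \<Rightarrow> real) \<Rightarrow> 'a \<Rightarrow> 'a set \<Rightarrow> 'a \<Rightarrow> ereal" where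
  "replacement_distance E l t e x = distance (E - {e}) l x t"

text \<open>The subpath from the first vertex to the vertex at position \<open>i\<close> is \<open>take (Suc i) p\<close>.\<close>

definition Val :: "'a set set \<Rightarrow> ('a set \<Rightarrow> real) \<Rightarrow> 'a \<Rightarrow> 'a list \<Rightarrow> ereal" where
  "Val E l t p =
     Max (insert (ereal (path_length l p))
       {ereal (path_length l (take (Suc i) p)) +
          replacement_distance E l t {p ! i, p ! Suc i} (p ! i) |i. Suc i < length p})"

definition potential :: "'a set set \<Rightarrow> ('a set \<Rightarrow> real) \<Rightarrow> 'a \<Rightarrow> 'a \<Rightarrow> ereal" where
  "potential E l t v = (INF p\<in>simple_paths E v t. Val E l t p)"

section \<open>Machine model\<close>

text \<open>A random access machine with two kinds of memory, each consisting of named scalars and named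
  arrays: integer memory, and real memory for weights. Reals can only be copied, added, subtracted and
  compared; in particular, no integer can be extracted from a real. Every integer that is written must
  fit into a word, i.e. be at most the word bound \<open>W\<close>; otherwise the program has no execution. Every
  syntactic operation that is executed costs one time unit.\<close>

type_synonym vname = string

datatype iexp =
    IConst nat | IVar vname | IArr vname iexp
  | IPlus iexp iexp | IMinus iexp iexp | IHalf iexp

datatype rexp =
    RZero | RVar vname | RArr vname iexp | RPlus rexp rexp | RMinus rexp rexp

datatype bexp =
    ILess iexp iexp | RLess rexp rexp | BNot bexp | BAnd bexp bexp

datatype com =
    Skip
  | IAssign vname iexp
  | RAssign vname rexp
  | IStore vname iexp iexp
  | RStore vname iexp rexp
  | Seq com com
  | If bexp com com
  | While bexp com

record store =
  ivars :: "vname \<Rightarrow> nat"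
  rvars :: "vname \<Rightarrow> real"
  iarrs :: "vname \<Rightarrow> nat \<Rightarrow> nat"
  rarrs :: "vname \<Rightarrow> nat \<Rightarrow> real"

primrec ival :: "store \<Rightarrow> iexp \<Rightarrow> nat" where
  "ival s (IConst k) = k"
| "ival s (IVar x) = ivars s x"
| "ival s (IArr a i) = iarrs s a (ival s i)"
| "ival s (IPlus i j) = ival s i + ival s j"
| "ival s (IMinus i j) = ival s i - ival s j"
| "ival s (IHalf i) = ival s i div 2"

primrec rval :: "store \<Rightarrow> rexp \<Rightarrow> real" where
  "rval s RZero = 0"
| "rval s (RVar x) = rvars s x"
| "rval s (RArr a i) = rarrs s a (ival s i)"
| "rval s (RPlus p q) = rval s p + rval s q"
| "rval s (RMinus p q) = rval s p - rval s q"

primrec bval :: "store \<Rightarrow> bexp \<Rightarrow> bool" where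
  "bval s (ILess i j) \<longleftrightarrow> ival s i < ival s j"
| "bval s (RLess p q) \<longleftrightarrow> rval s p < rval s q"
| "bval s (BNot b) \<longleftrightarrow> \<not> bval s b"
| "bval s (BAnd b c) \<longleftrightarrow> bval s b \<and> bval s c"

primrec icost :: "iexp \<Rightarrow> nat" where
  "icost (IConst k) = 1"
| "icost (IVar x) = 1"
| "icost (IArr a i) = 1 + icost i"
| "icost (IPlus i j) = 1 + icost i + icost j"
| "icost (IMinus i j) = 1 + icost i + icost j"
| "icost (IHalf i) = 1 + icost i"

primrec rcost :: "rexp \<Rightarrow> nat" where
  "rcost RZero = 1"
| "rcost (RVar x) = 1"
| "rcost (RArr a i) = 1 + icost i"
| "rcost (RPlus p q) = 1 + rcost p + rcost q"
| "rcost (RMinus p q) = 1 + rcost p + rcost q"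

primrec bcost :: "bexp \<Rightarrow> nat" where
  "bcost (ILess i j) = 1 + icost i + icost j"
| "bcost (RLess p q) = 1 + rcost p + rcost q"
| "bcost (BNot b) = 1 + bcost b"
| "bcost (BAnd b c) = 1 + bcost b + bcost c"

text \<open>\<open>exec W c s T s'\<close>: started in \<open>s\<close>, the program \<open>c\<close> terminates in \<open>s'\<close> after exactly \<open>T\<close> time
  units, on a machine with word bound \<open>W\<close>. Bounding only the integers that are written suffices: an
  intermediate result of a fixed program exceeds \<open>W\<close> by at most a constant factor or summand.\<close>

inductive exec :: "nat \<Rightarrow> com \<Rightarrow> store \<Rightarrow> nat \<Rightarrow> store \<Rightarrow> bool" for W :: nat where
  Skip: "exec W Skip s 1 s"
| IAssign: "ival s i \<le> W \<Longrightarrow>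
    exec W (IAssign x i) s (1 + icost i) (s\<lparr>ivars := (ivars s)(x := ival s i)\<rparr>)"
| RAssign:
    "exec W (RAssign x p) s (1 + rcost p) (s\<lparr>rvars := (rvars s)(x := rval s p)\<rparr>)"
| IStore: "ival s i \<le> W \<Longrightarrow> ival s j \<le> W \<Longrightarrow>
    exec W (IStore a i j) s (1 + icost i + icost j)
      (s\<lparr>iarrs := (iarrs s)(a := (iarrs s a)(ival s i := ival s j))\<rparr>)"
| RStore: "ival s i \<le> W \<Longrightarrow>
    exec W (RStore a i p) s (1 + icost i + rcost p)
      (s\<lparr>rarrs := (rarrs s)(a := (rarrs s a)(ival s i := rval s p))\<rparr>)"
| Seq: "exec W c s T s' \<Longrightarrow> exec W d s' T' s'' \<Longrightarrow> exec W (Seq c d) s (1 + T + T') s''"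
| IfTrue: "bval s b \<Longrightarrow> exec W c s T s' \<Longrightarrow> exec W (If b c d) s (1 + bcost b + T) s'"
| IfFalse: "\<not> bval s b \<Longrightarrow> exec W d s T s' \<Longrightarrow> exec W (If b c d) s (1 + bcost b + T) s'"
| WhileFalse: "\<not> bval s b \<Longrightarrow> exec W (While b c) s (1 + bcost b) s"
| WhileTrue: "bval s b \<Longrightarrow> exec W c s T s' \<Longrightarrow> exec W (While b c) s' T' s'' \<Longrightarrow>
    exec W (While b c) s (1 + bcost b + T + T') s''"

lemma exec_deterministic:
  assumes "exec W c s T s'" "exec W c s U u'"
  shows "U = T \<and> u' = s'"
  using assms
proof (induction arbitrary: U u' rule: exec.induct)
  case (Skip s)
  then show ?case by cases auto
next
  case (IAssign s i x)
  from IAssign(2) show ?case by cases auto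
next
  case (RAssign x p s)
  then show ?case by cases auto
next
  case (IStore s i j a)
  from IStore(3) show ?case by cases auto
next
  case (RStore s i a p)
  from RStore(2) show ?case by cases auto
next
  case (Seq c s T s' d T' s'')
  from Seq.prems obtain V r V' where
    "exec W c s V r" "exec W d r V' u'" "U = 1 + V + V'" by cases auto
  with Seq.IH(1)[of V r] Seq.IH(2)[of V' u'] show ?case by simp
next
  case (IfTrue s b c T s' d)
  from IfTrue.prems show ?case
    by cases (simp_all add: IfTrue.hyps IfTrue.IH)
next
  case (IfFalse s b d T s' c)
  from IfFalse.prems show ?case
    by cases (simp_all add: IfFalse.hyps IfFalse.IH)
next
  case (WhileFalse s b c)
  from WhileFalse.prems show ?case by cases (simp_all add: WhileFalse.hyps)
next
  case step: (WhileTrue s b c T s' T' s'')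
  from step.prems show ?case
  proof cases
    case WhileFalse
    with step.hyps show ?thesis by simp
  next
    case (WhileTrue V r V')
    with step.IH(1)[of V r] step.IH(2)[of V' u'] show ?thesis by simp
  qed
qed

section \<open>Input and output conventions\<close>

text \<open>The input is \<open>n\<close>, \<open>m\<close>, \<open>t\<close> together with a list of the \<open>m\<close> edges (in arbitrary order and with
  arbitrarily ordered endpoints) and their weights. All other memory cells initially contain \<open>0\<close>.\<close>

definition edge_of :: "'a \<times> 'a \<Rightarrow> 'a set" where
  "edge_of uv = {fst uv, snd uv}"

definition edge_list :: "('a \<times> 'a) list \<Rightarrow> 'a set set \<Rightarrow> bool" where
  "edge_list es E \<longleftrightarrow> distinct (map edge_of es) \<and> set (map edge_of es) = E"

definition array_of :: "'b list \<Rightarrow> nat \<Rightarrow> 'b::zero" where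
  "array_of xs i = (if i < length xs then xs ! i else 0)"

definition input_store ::
    "nat \<Rightarrow> nat \<Rightarrow> (nat \<times> nat) list \<Rightarrow> (nat set \<Rightarrow> real) \<Rightarrow> store" where
  "input_store n t es l =
     \<lparr>ivars = (\<lambda>_. 0)(''n'' := n, ''m'' := length es, ''t'' := t),
      rvars = (\<lambda>_. 0),
      iarrs = (\<lambda>_ _. 0)(''src'' := array_of (map fst es), ''dst'' := array_of (map snd es)),
      rarrs = (\<lambda>_ _. 0)(''weight'' := array_of (map (\<lambda>uv. l (edge_of uv)) es))\<rparr>"

text \<open>The value \<open>\<infinity>\<close> is represented by a zero in the array \<open>finite\<close>.\<close>

definition output_value :: "store \<Rightarrow> nat \<Rightarrow> ereal" where
  "output_value s v = (if iarrs s ''finite'' v = 0 then \<infinity> else ereal (rarrs s ''value'' v))"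

text \<open>Since the vertex lists of \<open>n\<close> paths can have total length of order \<open>n\<^sup>2\<close>, the paths are returned as
  successor pointers towards \<open>t\<close>: \<open>Suc w\<close> points to \<open>w\<close>, and \<open>0\<close> is the null pointer. The path of \<open>v\<close>
  is obtained by following the pointers from \<open>v\<close> until the null pointer.\<close>

definition output_path :: "store \<Rightarrow> nat list \<Rightarrow> bool" where
  "output_path s p \<longleftrightarrow>
     (\<forall>i<length p. iarrs s ''next'' (p ! i) = (if Suc i < length p then Suc (p ! Suc i) else 0))"

definition correct_output ::
    "nat \<Rightarrow> nat set set \<Rightarrow> (nat set \<Rightarrow> real) \<Rightarrow> nat \<Rightarrow> store \<Rightarrow> bool" where
  "correct_output n E l t s \<longleftrightarrow>
     (\<forall>v<n. output_value s v = potential E l t v \<and>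
        (if simple_paths E v t = {} then iarrs s ''next'' v = 0
         else \<exists>p\<in>simple_paths E v t. Val E l t p = potential E l t v \<and> output_path s p))"

end

theory Submission
  imports Defs
begin

text \<open>Write \<open>r(v)\<close> for the length of a shortest path from \<open>v\<close> to \<open>t\<close> avoiding the edge from \<open>v\<close> to its
  parent in a shortest path tree. For every other edge at \<open>v\<close> the replacement distance is at most the
  distance of \<open>v\<close>, hence does not matter, and the potential \<open>y\<close> is the largest solution of \<open>y(t) = 0\<close> and
  \<open>y(v) = min (max (r(v)) (l(v, par v) + y(par v))) (min\<^sub>u (l(v, u) + y(u)))\<close>. Since no term is smaller
  than the \<open>y\<close>-value it contains, a variant of Dijkstra's algorithm computes \<open>y\<close>, and its successor
  pointers describe optimal simple paths.

  The number \<open>r(v)\<close> is the minimum of \<open>D(x) + l(x, y) + D(y) - D(v)\<close> over the non-tree edges \<open>xy\<close> with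
  exactly one endpoint in the subtree of \<open>v\<close>, where \<open>D\<close> is the distance to \<open>t\<close>. Processing the non-tree
  edges in the order of \<open>D(x) + l(x, y) + D(y)\<close>, each \<open>r(v)\<close> is determined by the first edge whose tree
  path contains the edge from \<open>v\<close> to its parent; edges that are already covered are skipped with a
  union-find structure.\<close>

section \<open>Paths, distances and robust length\<close>

text \<open>The time bound has no additive term in \<open>n\<close>, although \<open>n\<close> may
  exceed \<open>m\<close> by far, so no loop may run over all vertices. All arrays rely on the
  zero-filled initial memory instead: zero means absent from the queue, not settled, not covered, or
  null pointer. Logarithmic cost per operation suffices for both data structures: the priority queue
  is a tournament tree, and union-find uses ranks without path compression. Since
  \<open>m \<le> n * n\<close>, the logarithm of \<open>n + m\<close> is of order
  \<open>log n\<close>. Running times are amortised: a loop invariant owns a time budget, which is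
  also the termination measure. Optimality is proved by duality. A function that is at most
  \<open>0\<close> at \<open>t\<close> and satisfies an inequality for every arc is a lower bound
  for every path; hence the algorithm only has to deliver labels satisfying all inequalities and
  pointers attaining them. Edges of weight \<open>0\<close> cause ties, so acyclicity of pointers is
  measured by the rank of settlement and not by the distance.\<close>

lemma path_edges_single [simp]: "path_edges [v] = {}"
  by (simp add: path_edges_def)

lemma path_edges_Cons:
  assumes "p \<noteq> []"
  shows "path_edges (v # p) = insert {v, hd p} (path_edges p)"
proof -
  have "{i. Suc i < length (v # p)} = insert 0 (Suc ` {i. Suc i < length p})"
    using assms by (auto simp: image_iff gr0_conv_Suc) (metis not0_implies_Suc Suc_less_eq)
  then have "path_edges (v # p) =
      (\<lambda>i. {(v # p) ! i, (v # p) ! Suc i}) ` insert 0 (Suc ` {i. Suc i < length p})"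
    unfolding path_edges_def by (auto simp: setcompr_eq_image)
  also have "\<dots> = insert {v, hd p} (path_edges p)"
    using assms unfolding path_edges_def by (auto simp: setcompr_eq_image image_image hd_conv_nth)
  finally show ?thesis .
qed

lemma path_edges_subset_Pow: "path_edges p \<subseteq> Pow (set p)"
  by (auto simp: path_edges_def)

lemma finite_path_edges [simp]: "finite (path_edges p)"
  by (rule finite_subset[OF path_edges_subset_Pow]) simp

lemma path_length_Cons:
  assumes "p \<noteq> []" "v \<notin> set p"
  shows "path_length l (v # p) = l {v, hd p} + path_length l p"
proof -
  have "{v, hd p} \<notin> path_edges p"
    using assms path_edges_subset_Pow[of p] by auto
  then show ?thesis
    using assms by (simp add: path_length_def path_edges_Cons)
qed

lemma path_length_single [simp]: "path_length l [v] = 0"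
  by (simp add: path_length_def)

lemma simple_paths_nonempty: "[] \<notin> simple_paths E x y"
  by (simp add: simple_paths_def)

lemma simple_paths_single [simp]: "[v] \<in> simple_paths E x y \<longleftrightarrow> v = x \<and> v = y"
  by (simp add: simple_paths_def)

lemma simple_paths_hd: "p \<in> simple_paths E x y \<Longrightarrow> hd p = x"
  by (simp add: simple_paths_def)

lemma all_less_Suc_shift: "(\<forall>i. i < Suc k \<longrightarrow> Q i) \<longleftrightarrow> Q 0 \<and> (\<forall>i<k. Q (Suc i))"
  using less_Suc_eq_0_disj by auto

lemma simple_paths_Cons:
  assumes "p \<noteq> []"
  shows "v # p \<in> simple_paths E x y \<longleftrightarrow>
    v = x \<and> v \<notin> set p \<and> {v, hd p} \<in> E \<and> p \<in> simple_paths E (hd p) y"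
proof -
  obtain k where k: "length p = Suc k" using assms by (cases p) auto
  show ?thesis
    using assms by (auto simp: simple_paths_def k all_less_Suc_shift hd_conv_nth)
qed

lemma simple_paths_path_edges: "p \<in> simple_paths E x y \<Longrightarrow> path_edges p \<subseteq> E"
  by (auto simp: simple_paths_def path_edges_def)

lemma simple_paths_suffix:
  assumes "q @ x # r \<in> simple_paths E v y"
  shows "x # r \<in> simple_paths E x y" and "path_edges (x # r) \<subseteq> path_edges (q @ x # r)"
proof -
  have "x # r \<in> simple_paths E x y \<and> path_edges (x # r) \<subseteq> path_edges (q @ x # r)"
    using assms
  proof (induction q arbitrary: v)
    case Nil
    then show ?case using simple_paths_hd by fastforce
  next
    case (Cons a q)
    then have "q @ x # r \<in> simple_paths E (hd (q @ x # r)) y"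
      by (simp add: simple_paths_Cons)
    from Cons.IH[OF this] show ?case
      by (auto simp: path_edges_Cons)
  qed
  then show "x # r \<in> simple_paths E x y" "path_edges (x # r) \<subseteq> path_edges (q @ x # r)"
    by auto
qed

lemma simple_path_induct [consumes 1, case_names single Cons]:
  assumes "p \<in> simple_paths E x y"
    and "P y [y]"
    and "\<And>v p. \<lbrakk>p \<noteq> []; v \<notin> set p; {v, hd p} \<in> E; p \<in> simple_paths E (hd p) y; P (hd p) p\<rbrakk>
      \<Longrightarrow> P v (v # p)"
  shows "P x p"
  using assms(1)
proof (induction p arbitrary: x)
  case Nil
  then show ?case by (simp add: simple_paths_nonempty)
next
  case (Cons v p)
  show ?case
  proof (cases "p = []")
    case True
    with Cons.prems have "v = x" "x = y" by auto
    with True assms(2) show ?thesis by simp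
  next
    case False
    with Cons.prems have "v = x" "v \<notin> set p" "{v, hd p} \<in> E" "p \<in> simple_paths E (hd p) y"
      by (auto simp: simple_paths_Cons)
    with Cons.IH assms(3)[of p v] False show ?thesis by simp
  qed
qed

text \<open>Weak duality for shortest paths, by summing the edge inequalities from the end of the
  path. Suitable choices of \<open>f\<close> yield lower bounds for replacement distances and show
  that certain vertices have no path to \<open>t\<close>.\<close>

lemma subsolution_le_path_length:
  assumes "p \<in> simple_paths E x t"
    and "f t \<le> 0" "\<And>x y. {x, y} \<in> E \<Longrightarrow> f x \<le> ereal (l {x, y}) + f y"
  shows "f x \<le> ereal (path_length l p)"
  using assms(1)
proof (induction rule: simple_path_induct)
  case single
  then show ?case using assms(2) by (simp add: zero_ereal_def[symmetric])
next
  case (Cons v p)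
  have "f v \<le> ereal (l {v, hd p}) + f (hd p)" using assms(3) Cons by auto
  also have "\<dots> \<le> ereal (l {v, hd p}) + ereal (path_length l p)"
    using Cons by (intro add_left_mono)
  finally show ?case using Cons by (simp add: path_length_Cons)
qed

lemma subsolution_le_distance:
  assumes "f t \<le> 0" "\<And>x y. {x, y} \<in> E \<Longrightarrow> f x \<le> ereal (l {x, y}) + f y"
  shows "f x \<le> distance E l x t"
  unfolding distance_def using assms by (intro INF_greatest subsolution_le_path_length)

lemma distance_self_le: "distance E l t t \<le> 0"
  unfolding distance_def by (rule INF_lower2[of "[t]"]) auto

text \<open>Prepending \<open>x\<close> to a simple path fails if the path already visits
  \<open>x\<close>; then its suffix from \<open>x\<close> is simple and, by nonnegativity, no
  longer.\<close>

lemma distance_step: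
  assumes nn: "\<forall>e\<in>E. 0 \<le> l e" and e: "{x, y} \<in> E"
  shows "distance E l x t \<le> ereal (l {x, y}) + distance E l y t"
proof -
  have "distance E l x t - ereal (l {x, y}) \<le> distance E l y t"
    unfolding distance_def[of E l y t]
  proof (rule INF_greatest)
    fix p assume p: "p \<in> simple_paths E y t"
    have "distance E l x t \<le> ereal (l {x, y} + path_length l p)"
    proof (cases "x \<in> set p")
      case False
      have "p \<noteq> []" "hd p = y" using p by (auto simp: simple_paths_def)
      then have "x # p \<in> simple_paths E x t" "path_length l (x # p) = l {x, y} + path_length l p"
        using p e False by (auto simp: simple_paths_Cons path_length_Cons)
      then show ?thesis unfolding distance_def by (metis INF_lower)
    next
      case True
      then obtain q r where qr: "p = q @ x # r" by (meson split_list)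
      have s: "x # r \<in> simple_paths E x t" "path_edges (x # r) \<subseteq> path_edges p"
        using simple_paths_suffix[of q x r E y t] p qr by auto
      have "path_length l (x # r) \<le> path_length l p"
        unfolding path_length_def
        using s simple_paths_path_edges[OF p] nn by (intro sum_mono2) auto
      then have "path_length l (x # r) \<le> l {x, y} + path_length l p"
        using nn e by force
      then show ?thesis unfolding distance_def using s(1)
        by (meson INF_lower2 ereal_less_eq(3))
    qed
    then show "distance E l x t - ereal (l {x, y}) \<le> ereal (path_length l p)"
      by (subst ereal_minus_le) (auto simp: add.commute)
  qed
  then show ?thesis by (subst (asm) ereal_minus_le) (auto simp: add.commute)
qed

lemma Val_single [simp]: "Val E l t [v] = 0"
  by (simp add: Val_def)

text \<open>This recursion makes the robust length accessible to dynamic programming. All prefixes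
  of \<open>p\<close> grow by the same edge, and adding a constant commutes with \<open>Max\<close>;
  the new position \<open>0\<close> has prefix length \<open>0\<close> and contributes the bare
  replacement distance.\<close>

lemma Val_Cons:
  assumes "p \<noteq> []" "v \<notin> set p"
  shows "Val E l t (v # p) =
    max (replacement_distance E l t {v, hd p} v) (ereal (l {v, hd p}) + Val E l t p)"
proof -
  define g where "g p i = ereal (path_length l (take (Suc i) p)) +
    replacement_distance E l t {p ! i, p ! Suc i} (p ! i)" for p i
  define S where "S p = g p ` {i. Suc i < length p}" for p
  have V: "Val E l t p = Max (insert (ereal (path_length l p)) (S p))" for p
    unfolding Val_def S_def g_def by (simp add: setcompr_eq_image)
  have fin: "finite (S p)" for p
    unfolding S_def by (rule finite_imageI, rule finite_subset[of _ "{..<length p}"]) auto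
  let ?c = "\<lambda>x. ereal (l {v, hd p}) + x"
  have I: "{i. Suc i < length (v # p)} = insert 0 (Suc ` {i. Suc i < length p})"
    using assms by (auto simp: image_iff gr0_conv_Suc) (metis not0_implies_Suc Suc_less_eq)
  have g0: "g (v # p) 0 = replacement_distance E l t {v, hd p} v"
    using assms by (simp add: g_def hd_conv_nth zero_ereal_def[symmetric])
  have gS: "g (v # p) (Suc i) = ?c (g p i)" for i
  proof -
    have "path_length l (v # take (Suc i) p) = l {v, hd p} + path_length l (take (Suc i) p)"
      using assms by (subst path_length_Cons) (auto dest: in_set_takeD)
    then show ?thesis
      by (simp add: g_def add.assoc flip: plus_ereal.simps(1))
  qed
  have S: "S (v # p) = insert (replacement_distance E l t {v, hd p} v) (?c ` S p)"
    unfolding S_def I by (simp add: image_image g0 gS)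
  have "?c (Max (insert (ereal (path_length l p)) (S p))) =
      Max (?c ` insert (ereal (path_length l p)) (S p))"
    by (intro mono_Max_commute) (auto simp: mono_def fin intro: add_left_mono)
  then have "?c (Val E l t p) = Max (insert (ereal (path_length l (v # p))) (?c ` S p))"
    using assms by (simp add: V path_length_Cons)
  then show ?thesis
    unfolding V[of "v # p"] S
    by (subst insert_commute) (simp add: fin)
qed

text \<open>Weak duality for the robust length. Applied to the labels of the second Dijkstra run, it
  shows that no path does better than they claim.\<close>

lemma subsolution_le_Val:
  assumes "p \<in> simple_paths E x t"
    and "f t \<le> 0"
    and "\<And>x y. {x, y} \<in> E \<Longrightarrow>
      f x \<le> max (replacement_distance E l t {x, y} x) (ereal (l {x, y}) + f y)"
  shows "f x \<le> Val E l t p"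
  using assms(1)
proof (induction rule: simple_path_induct)
  case single
  then show ?case using assms(2) by simp
next
  case (Cons v p)
  have "f v \<le> max (replacement_distance E l t {v, hd p} v) (ereal (l {v, hd p}) + f (hd p))"
    using assms(3) Cons by auto
  also have "\<dots> \<le> max (replacement_distance E l t {v, hd p} v) (ereal (l {v, hd p}) + Val E l t p)"
    using Cons by (intro max.mono add_left_mono) auto
  finally show ?case using Cons by (simp add: Val_Cons)
qed

section \<open>Replacement distances in terms of a shortest path tree\<close>

text \<open>\<open>R\<close> will be the set of vertices connected to \<open>t\<close>. The separate
  measure \<open>ord\<close> is needed because \<open>D\<close> does not decrease strictly along an
  edge of weight \<open>0\<close>.\<close>

locale shortest_path_tree =
  fixes E :: "'a set set" and l :: "'a set \<Rightarrow> real" and t :: 'a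
    and R :: "'a set" and par :: "'a \<Rightarrow> 'a" and ord :: "'a \<Rightarrow> nat" and D :: "'a \<Rightarrow> real"
  assumes nonneg: "\<forall>e\<in>E. 0 \<le> l e"
    and t_in: "t \<in> R" and D_t: "D t = 0"
    and closed: "\<And>x y. x \<in> R \<Longrightarrow> {x, y} \<in> E \<Longrightarrow> y \<in> R \<and> D y \<le> D x + l {x, y}"
    and tree: "\<And>v. v \<in> R \<Longrightarrow> v \<noteq> t \<Longrightarrow>
      par v \<in> R \<and> {v, par v} \<in> E \<and> D v = l {v, par v} + D (par v) \<and> ord (par v) < ord v"
begin

text \<open>The first argument is the upper one: \<open>x\<close> lies in the subtree of
  \<open>v\<close>.\<close>

inductive desc :: "'a \<Rightarrow> 'a \<Rightarrow> bool" for v where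
  desc_refl: "v \<in> R \<Longrightarrow> desc v v"
| desc_step: "x \<in> R \<Longrightarrow> x \<noteq> t \<Longrightarrow> desc v (par x) \<Longrightarrow> desc v x"

lemma desc_in: "desc v x \<Longrightarrow> x \<in> R"
  by (induction rule: desc.induct) auto

lemma desc_in_left: "desc v x \<Longrightarrow> v \<in> R"
  by (induction rule: desc.induct) auto

lemma desc_iff: "x \<in> R \<Longrightarrow> x \<noteq> t \<Longrightarrow> desc v x \<longleftrightarrow> v = x \<or> desc v (par x)"
  by (metis desc.simps)

lemma desc_t: "desc v t \<longleftrightarrow> v = t"
  by (metis desc.simps t_in)

lemma desc_ord: "desc v x \<Longrightarrow> v = x \<or> ord v < ord x"
  by (induction rule: desc.induct) (use tree in fastforce)+

lemma ord_induct [consumes 1, case_names root step]: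
  assumes "x \<in> R" "P t"
    and "\<And>x. \<lbrakk>x \<in> R; x \<noteq> t; P (par x)\<rbrakk> \<Longrightarrow> P x"
  shows "P x"
  using assms(1)
proof (induction "ord x" arbitrary: x rule: less_induct)
  case less
  then show ?case using assms(2,3) tree by (cases "x = t") auto
qed

lemma desc_trans: "desc u v \<Longrightarrow> desc v x \<Longrightarrow> desc u x"
  by (rotate_tac, induction rule: desc.induct) (auto intro: desc.intros)

text \<open>The guards protect against \<open>par t\<close>, which is an arbitrary vertex.\<close>

definition nontree :: "'a \<Rightarrow> 'a \<Rightarrow> bool" where
  "nontree x y \<longleftrightarrow> {x, y} \<in> E \<and> (x \<noteq> t \<longrightarrow> y \<noteq> par x) \<and> (y \<noteq> t \<longrightarrow> x \<noteq> par y)"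

definition detour :: "'a \<Rightarrow> 'a \<Rightarrow> 'a \<Rightarrow> bool" where
  "detour v x y \<longleftrightarrow> nontree x y \<and> x \<in> R \<and> y \<in> R \<and> desc v x \<and> \<not> desc v y"

abbreviation rep :: "'a \<Rightarrow> 'a \<Rightarrow> ereal" where
  "rep v u \<equiv> replacement_distance E l t {v, u} v"

lemma crossing_edge_nontree:
  assumes "{x, y} \<in> E - {{v, par v}}" "desc v x" "\<not> desc v y"
  shows "detour v x y"
proof -
  have x: "x \<in> R" and y: "y \<in> R" using assms desc_in closed by blast+
  have "y \<noteq> par x" if "x \<noteq> t"
    using assms x that desc_iff[of x v] by auto
  moreover have "x \<noteq> par y" if "y \<noteq> t"
    using assms y that desc_iff[of y v] by auto
  ultimately show ?thesis using assms x y by (auto simp: detour_def nontree_def)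
qed

text \<open>The subsolution takes, on the subtree of \<open>v\<close>, the maximum of \<open>D\<close> and \<open>K - D\<close>: the first
  part handles edges entering the subtree, the second part handles edges leaving it.\<close>

lemma rep_parent_ge:
  assumes v: "v \<in> R" "v \<noteq> t" and K: "\<And>x y. detour v x y \<Longrightarrow> K \<le> ereal (D x + l {x, y} + D y)"
  shows "K - ereal (D v) \<le> rep v (par v)"
proof -
  define f where "f x = (if x \<notin> R then \<infinity> else if desc v x then max (ereal (D x)) (K - ereal (D x))
     else ereal (D x))" for x
  have "f v \<le> distance (E - {{v, par v}}) l v t"
  proof (rule subsolution_le_distance)
    show "f t \<le> 0" using v t_in D_t by (auto simp: f_def desc_t)
    fix x y assume e: "{x, y} \<in> E - {{v, par v}}"
    then have e': "{y, x} \<in> E" "{x, y} \<in> E" by (auto simp: insert_commute)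
    show "f x \<le> ereal (l {x, y}) + f y"
    proof (cases "y \<in> R")
      case False
      then show ?thesis by (simp add: f_def)
    next
      case yR: True
      then have xR: "x \<in> R" and Dx: "D x \<le> D y + l {x, y}"
        using closed[OF yR e'(1)] by (auto simp: insert_commute)
      have Dy: "D y \<le> D x + l {x, y}" using closed[OF xR e'(2)] by auto
      have Dle: "ereal (D x) \<le> ereal (l {x, y}) + f y"
      proof -
        have "ereal (D x) \<le> ereal (l {x, y}) + ereal (D y)" using Dx by simp
        also have "\<dots> \<le> ereal (l {x, y}) + f y"
          by (intro add_left_mono) (simp add: f_def)
        finally show ?thesis .
      qed
      have "K - ereal (D x) \<le> ereal (l {x, y}) + f y" if dx: "desc v x"
      proof (cases "desc v y")
        case True
        have "K - ereal (D x) \<le> ereal (l {x, y}) + (K - ereal (D y))"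
          using Dy by (cases K) auto
        also have "\<dots> \<le> ereal (l {x, y}) + f y"
          using True yR by (intro add_left_mono) (simp add: f_def)
        finally show ?thesis .
      next
        case False
        then have "K \<le> ereal (D x + l {x, y} + D y)"
          using K crossing_edge_nontree e dx by blast
        then show ?thesis using False yR by (cases K) (auto simp: f_def)
      qed
      with Dle xR show ?thesis by (auto simp: f_def)
    qed
  qed
  moreover have "K - ereal (D v) \<le> f v"
    using v by (simp add: f_def desc_refl)
  ultimately show ?thesis by (auto simp: replacement_distance_def)
qed

text \<open>The hypothesis says that the whole tree path from \<open>y\<close> to \<open>t\<close>
  survives in \<open>F\<close>.\<close>

lemma distance_avoiding_le:
  assumes "F \<subseteq> E" "y \<in> R" "\<And>z. z \<noteq> t \<Longrightarrow> desc z y \<Longrightarrow> {z, par z} \<in> F"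
  shows "distance F l y t \<le> ereal (D y)"
  using assms(2,3)
proof (induction rule: ord_induct)
  case root
  then show ?case using distance_self_le by (simp add: D_t zero_ereal_def[symmetric])
next
  case (step x)
  have "distance F l x t \<le> ereal (l {x, par x}) + distance F l (par x) t"
    using step nonneg assms(1) by (intro distance_step) (auto intro: desc_refl)
  also have "\<dots> \<le> ereal (l {x, par x}) + ereal (D (par x))"
    using step by (intro add_left_mono step) (auto intro: desc_step)
  finally show ?case using tree[of x] step by simp
qed

text \<open>The detour descends in the tree from \<open>v\<close> to \<open>x\<close>, crosses to
  \<open>y\<close> and follows the tree path of \<open>y\<close>, which avoids the failed edge
  because \<open>y\<close> is outside the subtree.\<close>

lemma rep_parent_le:
  assumes v: "v \<in> R" "v \<noteq> t" and d: "detour v x y"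
  shows "rep v (par v) \<le> ereal (D x + l {x, y} + D y - D v)"
proof -
  define F where "F = E - {{v, par v}}"
  have nnF: "\<forall>e\<in>F. 0 \<le> l e" using nonneg by (auto simp: F_def)
  have ne: "{z, par z} \<in> F" if "z \<in> R" "z \<noteq> t" "z \<noteq> v" for z
    using that tree[of z] tree[of v] v by (auto simp: F_def doubleton_eq_iff)
  have xy: "x \<in> R" "y \<in> R" "desc v x" "\<not> desc v y" "nontree x y"
    using d by (auto simp: detour_def)
  have "distance F l y t \<le> ereal (D y)"
    using xy by (intro distance_avoiding_le ne) (auto simp: F_def intro: desc_in_left)
  moreover have "{x, y} \<in> F"
    using xy v by (auto simp: nontree_def F_def doubleton_eq_iff)
  then have "distance F l x t \<le> ereal (l {x, y}) + distance F l y t"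
    by (intro distance_step nnF)
  ultimately have x: "distance F l x t \<le> ereal (l {x, y} + D y)"
    by (metis add_left_mono order_trans plus_ereal.simps(1))
  \<comment> \<open>Descending from \<open>v\<close> to \<open>x\<close>, the sum of
    \<open>D z\<close> and the distance in \<open>F\<close> never decreases, since each tree edge
    below \<open>v\<close> belongs to \<open>F\<close>.\<close>
  have "distance F l v t + ereal (D v) \<le> ereal (D x) + distance F l x t"
    using xy(3)
  proof (induction rule: desc.induct)
    case desc_refl
    then show ?case by (simp add: add.commute)
  next
    case (desc_step z)
    show ?case
    proof (cases "z = v")
      case True
      then show ?thesis by (simp add: add.commute)
    next
      case False
      have "distance F l (par z) t \<le> ereal (l {z, par z}) + distance F l z t"
        using distance_step[OF nnF, of "par z" z] ne[of z] desc_step False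
        by (simp add: insert_commute)
      then have "ereal (D (par z)) + distance F l (par z) t
          \<le> ereal (D (par z)) + (ereal (l {z, par z}) + distance F l z t)"
        by (rule add_left_mono)
      also have "\<dots> = ereal (D z) + distance F l z t"
        using tree[of z] desc_step by (simp add: add.commute flip: add.assoc)
      finally show ?thesis using desc_step by auto
    qed
  qed
  also have "\<dots> \<le> ereal (D x) + ereal (l {x, y} + D y)"
    by (intro add_left_mono x)
  finally have "distance F l v t \<le> ereal (D x + l {x, y} + D y) - ereal (D v)"
    by (subst ereal_le_minus) (auto simp: add.assoc)
  then show ?thesis by (simp add: replacement_distance_def F_def)
qed

text \<open>The edge may still be a tree edge, namely of a child \<open>u\<close> of
  \<open>v\<close>. It is not on the tree path of \<open>v\<close>, though, where \<open>ord\<close>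
  decreases strictly from \<open>v\<close> onwards.\<close>

lemma rep_other_le:
  assumes v: "v \<in> R" and u: "v \<noteq> t \<longrightarrow> u \<noteq> par v"
  shows "rep v u \<le> ereal (D v)"
  unfolding replacement_distance_def
proof (rule distance_avoiding_le)
  fix z assume z: "z \<noteq> t" "desc z v"
  have zR: "z \<in> R" using z(2) by (rule desc_in_left)
  have "{z, par z} \<noteq> {v, u}"
    using tree[OF zR z(1)] desc_ord[OF z(2)] u z(1) by (auto simp: doubleton_eq_iff)
  then show "{z, par z} \<in> E - {{v, u}}" using tree[OF zR z(1)] by auto
qed (use v in auto)

lemma no_path_outside:
  assumes "v \<notin> R"
  shows "simple_paths E v t = {}"
proof (rule ccontr)
  \<comment> \<open>No edge leaves \<open>R\<close>, so this indicator is a subsolution, and its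
    infinite value at \<open>v\<close> contradicts the finite length of a path.\<close>
  define f where "f x = (if x \<in> R then 0 else \<infinity> :: ereal)" for x
  assume "simple_paths E v t \<noteq> {}"
  then obtain p where p: "p \<in> simple_paths E v t" by auto
  have "f v \<le> ereal (path_length l p)"
    using p
  proof (rule subsolution_le_path_length)
    fix x y assume "{x, y} \<in> E"
    moreover from this have "{y, x} \<in> E" by (simp add: insert_commute)
    ultimately show "f x \<le> ereal (l {x, y}) + f y"
      using closed[of y x] nonneg by (auto simp: f_def)
  qed (simp add: f_def t_in)
  with assms show False by (simp add: f_def)
qed

end

section \<open>Weakest preconditions with running time\<close>

text \<open>Total correctness: existence of an execution covers both termination and respect for the
  word bound, and determinism makes the existential as strong as a statement about all
  executions.\<close>

definition wp :: "nat \<Rightarrow> com \<Rightarrow> store \<Rightarrow> (nat \<Rightarrow> store \<Rightarrow> bool) \<Rightarrow> bool" where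
  "wp W c s Q \<longleftrightarrow> (\<exists>T s'. exec W c s T s' \<and> Q T s')"

text \<open>Oriented so that the simplifier sorts updates of distinct fields.\<close>

lemma store_update_order [simp]:
  "(s :: store)\<lparr>rvars := r, ivars := i\<rparr> = s\<lparr>ivars := i, rvars := r\<rparr>"
  "s\<lparr>iarrs := a, ivars := i\<rparr> = s\<lparr>ivars := i, iarrs := a\<rparr>"
  "s\<lparr>rarrs := b, ivars := i\<rparr> = s\<lparr>ivars := i, rarrs := b\<rparr>"
  "s\<lparr>iarrs := a, rvars := r\<rparr> = s\<lparr>rvars := r, iarrs := a\<rparr>"
  "s\<lparr>rarrs := b, rvars := r\<rparr> = s\<lparr>rvars := r, rarrs := b\<rparr>"
  "s\<lparr>rarrs := b, iarrs := a\<rparr> = s\<lparr>iarrs := a, rarrs := b\<rparr>"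
  by (rule store.equality; simp)+

lemma wp_conseq: "wp W c s Q \<Longrightarrow> (\<And>T s'. Q T s' \<Longrightarrow> Q' T s') \<Longrightarrow> wp W c s Q'"
  by (auto simp: wp_def)

inductive_cases SkipE: "exec W Skip s T s'"
inductive_cases IAssignE: "exec W (IAssign x i) s T s'"
inductive_cases RAssignE: "exec W (RAssign x p) s T s'"
inductive_cases IStoreE: "exec W (IStore a i j) s T s'"
inductive_cases RStoreE: "exec W (RStore a i p) s T s'"
inductive_cases SeqE: "exec W (Seq c d) s T s'"
inductive_cases IfE: "exec W (If b c d) s T s'"

lemma wp_Skip [simp]: "wp W Skip s Q \<longleftrightarrow> Q 1 s"
  unfolding wp_def by (rule iffI) (use exec.Skip in \<open>fastforce elim: SkipE\<close>)+

lemma wp_IAssign [simp]: "wp W (IAssign x i) s Q \<longleftrightarrow>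
    ival s i \<le> W \<and> Q (1 + icost i) (s\<lparr>ivars := (ivars s)(x := ival s i)\<rparr>)"
  unfolding wp_def by (rule iffI) (use exec.IAssign in \<open>fastforce elim: IAssignE\<close>)+

lemma wp_RAssign [simp]: "wp W (RAssign x p) s Q \<longleftrightarrow>
    Q (1 + rcost p) (s\<lparr>rvars := (rvars s)(x := rval s p)\<rparr>)"
  unfolding wp_def by (rule iffI) (use exec.RAssign in \<open>fastforce elim: RAssignE\<close>)+

lemma wp_IStore [simp]: "wp W (IStore a i j) s Q \<longleftrightarrow>
    ival s i \<le> W \<and> ival s j \<le> W \<and> Q (1 + icost i + icost j)
      (s\<lparr>iarrs := (iarrs s)(a := (iarrs s a)(ival s i := ival s j))\<rparr>)"
  unfolding wp_def by (rule iffI) (use exec.IStore in \<open>fastforce elim: IStoreE\<close>)+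

lemma wp_RStore [simp]: "wp W (RStore a i p) s Q \<longleftrightarrow>
    ival s i \<le> W \<and> Q (1 + icost i + rcost p)
      (s\<lparr>rarrs := (rarrs s)(a := (rarrs s a)(ival s i := rval s p))\<rparr>)"
  unfolding wp_def by (rule iffI) (use exec.RStore in \<open>fastforce elim: RStoreE\<close>)+

lemma wp_Seq [simp]:
  "wp W (Seq c d) s Q \<longleftrightarrow> wp W c s (\<lambda>T s'. wp W d s' (\<lambda>T' s''. Q (1 + T + T') s''))"
proof
  assume "wp W (Seq c d) s Q"
  then obtain T s' where "exec W (Seq c d) s T s'" "Q T s'" unfolding wp_def by blast
  then show "wp W c s (\<lambda>T s'. wp W d s' (\<lambda>T' s''. Q (1 + T + T') s''))"
    unfolding wp_def by (elim SeqE) auto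
next
  assume "wp W c s (\<lambda>T s'. wp W d s' (\<lambda>T' s''. Q (1 + T + T') s''))"
  then obtain T s' T' s'' where
    "exec W c s T s'" "exec W d s' T' s''" "Q (1 + T + T') s''" unfolding wp_def by blast
  then show "wp W (Seq c d) s Q" unfolding wp_def using exec.Seq by blast
qed

lemma wp_SeqI:
  assumes "wp W c s Q1" "\<And>T s'. Q1 T s' \<Longrightarrow> wp W d s' (\<lambda>T'. Q (1 + T + T'))"
  shows "wp W (Seq c d) s Q"
  unfolding wp_Seq using assms by (rule wp_conseq)

lemma wp_If [simp]: "wp W (If b c d) s Q \<longleftrightarrow>
    (if bval s b then wp W c s (\<lambda>T. Q (1 + bcost b + T)) else wp W d s (\<lambda>T. Q (1 + bcost b + T)))"
proof
  assume "wp W (If b c d) s Q"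
  then obtain T s' where "exec W (If b c d) s T s'" "Q T s'" unfolding wp_def by blast
  then show "if bval s b then wp W c s (\<lambda>T. Q (1 + bcost b + T))
      else wp W d s (\<lambda>T. Q (1 + bcost b + T))"
    unfolding wp_def by (elim IfE) auto
next
  assume "if bval s b then wp W c s (\<lambda>T. Q (1 + bcost b + T))
      else wp W d s (\<lambda>T. Q (1 + bcost b + T))"
  then show "wp W (If b c d) s Q"
    unfolding wp_def using exec.IfTrue[of s b W c] exec.IfFalse[of s b W d]
    by (cases "bval s b") (simp_all only: if_True if_False, blast+)
qed

text \<open>\<open>k\<close> is a time budget from which each iteration pays its test and body.
  Every iteration costs at least one unit, so the budget doubles as termination measure. The last,
  failing test is paid separately, and the unspent rest \<open>k'\<close> is handed back, which
  permits amortisation across nested loops.\<close>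

lemma wp_While:
  assumes inv: "I k s"
    and step: "\<And>k s. I k s \<Longrightarrow> bval s b \<Longrightarrow>
      wp W c s (\<lambda>T s'. \<exists>k'. I k' s' \<and> 1 + bcost b + T + k' \<le> k)"
    and exit: "\<And>k' s' T. I k' s' \<Longrightarrow> \<not> bval s' b \<Longrightarrow> T + k' \<le> k + 1 + bcost b \<Longrightarrow> Q T s'"
  shows "wp W (While b c) s Q"
proof -
  have "\<exists>T s' k'. exec W (While b c) s T s' \<and> I k' s' \<and> \<not> bval s' b \<and> T + k' \<le> k + 1 + bcost b"
    using inv
  proof (induction k arbitrary: s rule: less_induct)
    case (less k)
    show ?case
    proof (cases "bval s b")
      case True
      from step[OF less.prems True] obtain T1 s1 k1 where
        1: "exec W c s T1 s1" "I k1 s1" "1 + bcost b + T1 + k1 \<le> k"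
        by (auto simp: wp_def)
      from less.IH[OF _ 1(2)] 1(3) obtain T2 s2 k2 where
        "exec W (While b c) s1 T2 s2" "I k2 s2" "\<not> bval s2 b" "T2 + k2 \<le> k1 + 1 + bcost b"
        by auto
      with exec.WhileTrue[OF True 1(1)] 1(3) show ?thesis by fastforce
    next
      case False
      with less.prems exec.WhileFalse[OF False] show ?thesis by fastforce
    qed
  qed
  then show ?thesis using exit unfolding wp_def by blast
qed

primrec written_ivars :: "com \<Rightarrow> vname set" where
  "written_ivars Skip = {}"
| "written_ivars (IAssign x i) = {x}"
| "written_ivars (RAssign x p) = {}"
| "written_ivars (IStore a i j) = {}"
| "written_ivars (RStore a i p) = {}"
| "written_ivars (Seq c d) = written_ivars c \<union> written_ivars d"
| "written_ivars (If b c d) = written_ivars c \<union> written_ivars d"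
| "written_ivars (While b c) = written_ivars c"

primrec written_iarrs :: "com \<Rightarrow> vname set" where
  "written_iarrs Skip = {}"
| "written_iarrs (IAssign x i) = {}"
| "written_iarrs (RAssign x p) = {}"
| "written_iarrs (IStore a i j) = {a}"
| "written_iarrs (RStore a i p) = {}"
| "written_iarrs (Seq c d) = written_iarrs c \<union> written_iarrs d"
| "written_iarrs (If b c d) = written_iarrs c \<union> written_iarrs d"
| "written_iarrs (While b c) = written_iarrs c"

primrec written_rarrs :: "com \<Rightarrow> vname set" where
  "written_rarrs Skip = {}"
| "written_rarrs (IAssign x i) = {}"
| "written_rarrs (RAssign x p) = {}"
| "written_rarrs (IStore a i j) = {}"
| "written_rarrs (RStore a i p) = {a}"
| "written_rarrs (Seq c d) = written_rarrs c \<union> written_rarrs d"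
| "written_rarrs (If b c d) = written_rarrs c \<union> written_rarrs d"
| "written_rarrs (While b c) = written_rarrs c"

definition unchanged :: "com \<Rightarrow> store \<Rightarrow> store \<Rightarrow> bool" where
  "unchanged c s s' \<longleftrightarrow>
    (\<forall>x. x \<notin> written_ivars c \<longrightarrow> ivars s' x = ivars s x) \<and>
    (\<forall>a. a \<notin> written_iarrs c \<longrightarrow> iarrs s' a = iarrs s a) \<and>
    (\<forall>a. a \<notin> written_rarrs c \<longrightarrow> rarrs s' a = rarrs s a)"

text \<open>A syntactic frame rule, which lets the specifications of the phases mention only what
  they compute.\<close>

lemma exec_unchanged: "exec W c s T s' \<Longrightarrow> unchanged c s s'"
  by (induction rule: exec.induct) (auto simp: unchanged_def)

lemma wp_unchanged: "wp W c s Q \<Longrightarrow> wp W c s (\<lambda>T s'. Q T s' \<and> unchanged c s s')"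
  by (auto simp: wp_def dest: exec_unchanged)

section \<open>A priority queue: the tournament tree\<close>

text \<open>Items are numbers below \<open>N\<close>; item \<open>j\<close> lives at leaf \<open>N + j\<close>, and the inner node \<open>i\<close> with
  \<open>1 \<le> i < N\<close> has the children \<open>2 * i\<close> and \<open>2 * i + 1\<close>, for arbitrary \<open>N\<close>. A node stores \<open>Suc j\<close> for
  the winner \<open>j\<close> of its subtree and \<open>0\<close> if no item of its subtree is present, so that the initial
  memory represents an empty queue.\<close>

definition winner :: "(nat \<Rightarrow> real) \<Rightarrow> nat \<Rightarrow> nat \<Rightarrow> nat" where
  "winner k a b = (if a = 0 \<or> b \<noteq> 0 \<and> k (b - 1) < k (a - 1) then b else a)"

text \<open>The bound on all nodes, even those with outdated entries, ensures that whatever a match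
  copies upwards fits into a word.\<close>

definition tournament_leaves :: "nat \<Rightarrow> nat set \<Rightarrow> (nat \<Rightarrow> nat) \<Rightarrow> bool" where
  "tournament_leaves N A w \<longleftrightarrow> A \<subseteq> {..<N} \<and> (\<forall>j<N. w (N + j) = (if j \<in> A then Suc j else 0)) \<and>
     (\<forall>i. 1 \<le> i \<longrightarrow> i < 2 * N \<longrightarrow> w i \<le> N)"

text \<open>The ancestors of node \<open>i0\<close>, itself included, are the numbers
  \<open>i0 div 2 ^ e\<close>; only there may a match result be outdated. For \<open>i0 = 0\<close>
  this exempts no node.\<close>

definition tournament_pending ::
    "nat \<Rightarrow> nat set \<Rightarrow> (nat \<Rightarrow> real) \<Rightarrow> (nat \<Rightarrow> nat) \<Rightarrow> nat \<Rightarrow> bool" where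
  "tournament_pending N A k w i0 \<longleftrightarrow> tournament_leaves N A w \<and>
     (\<forall>i. 1 \<le> i \<longrightarrow> i < N \<longrightarrow> (\<forall>e. i \<noteq> i0 div 2 ^ e) \<longrightarrow>
        w i = winner k (w (i + i)) (w (Suc (i + i))))"

definition tournament :: "nat \<Rightarrow> nat set \<Rightarrow> (nat \<Rightarrow> real) \<Rightarrow> (nat \<Rightarrow> nat) \<Rightarrow> bool" where
  "tournament N A k w \<longleftrightarrow> tournament_leaves N A w \<and>
     (\<forall>i. 1 \<le> i \<longrightarrow> i < N \<longrightarrow> w i = winner k (w (i + i)) (w (Suc (i + i))))"

lemma tournament_pending_0: "tournament_pending N A k w 0 \<Longrightarrow> tournament N A k w"
  by (auto simp: tournament_pending_def tournament_def)

lemma tournament_empty_init: "tournament N {} k (\<lambda>_. 0)"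
  by (auto simp: tournament_def tournament_leaves_def winner_def)

text \<open>A winner always comes from a child, so induction from the leaves upwards traces it to a
  leaf below \<open>i\<close>. This locality means that a new key of \<open>j\<close> matters only
  at the ancestors of leaf \<open>N + j\<close>.\<close>

lemma tournament_winner_above:
  assumes "tournament N A k w" "1 \<le> i" "i < 2 * N" "w i = Suc j"
  shows "j \<in> A \<and> (\<exists>e. i = (N + j) div 2 ^ e)"
  using assms(2-4)
proof (induction "2 * N - i" arbitrary: i rule: less_induct)
  case less
  show ?case
  proof (cases "i < N")
    case False
    then obtain j' where j': "i = N + j'" "j' < N"
      using less.prems by (metis add_less_cancel_left le_Suc_ex mult_2 not_le)
    then have "w i = (if j' \<in> A then Suc j' else 0)"
      using assms(1) by (auto simp: tournament_def tournament_leaves_def)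
    then have "j' = j" "j \<in> A" using less.prems by (auto split: if_splits)
    then show ?thesis using j' by (auto intro: exI[of _ 0])
  next
    case True
    then have "w i = winner k (w (i + i)) (w (Suc (i + i)))"
      using assms(1) less.prems by (auto simp: tournament_def)
    then obtain i' where i': "i' = i + i \<or> i' = Suc (i + i)" "w i' = Suc j"
      using less.prems by (auto simp: winner_def split: if_splits)
    have "j \<in> A \<and> (\<exists>e. i' = (N + j) div 2 ^ e)"
      using i' True less.prems by (intro less.hyps) auto
    moreover have "i = i' div 2" using i' by auto
    ultimately show ?thesis
      by (metis div_mult2_eq power_Suc2)
  qed
qed

lemma tournament_winner_le:
  assumes "tournament N A k w" "j \<in> A" "1 \<le> (N + j) div 2 ^ e"
  shows "w ((N + j) div 2 ^ e) \<noteq> 0 \<and> k (w ((N + j) div 2 ^ e) - 1) \<le> k j"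
  using assms(3)
proof (induction e)
  case 0
  then show ?case using assms by (auto simp: tournament_def tournament_leaves_def)
next
  case (Suc e)
  let ?i = "(N + j) div 2 ^ Suc e" and ?i' = "(N + j) div 2 ^ e"
  have i: "?i = ?i' div 2" by (metis div_mult2_eq power_Suc2)
  have j: "j < N" using assms by (auto simp: tournament_def tournament_leaves_def)
  have "?i' \<le> N + j" by simp
  then have lt: "?i < N" using i j by linarith
  have w: "w ?i = winner k (w (?i + ?i)) (w (Suc (?i + ?i)))"
    using assms(1) Suc.prems lt unfolding tournament_def by blast
  have "?i' = ?i + ?i \<or> ?i' = Suc (?i + ?i)" using i by linarith
  moreover have "w ?i' \<noteq> 0 \<and> k (w ?i' - 1) \<le> k j"
    using Suc i by (intro Suc.IH) linarith
  ultimately show ?case unfolding w by (auto simp: winner_def)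
qed

text \<open>Hence the root \<open>1\<close> is above every leaf, also when \<open>N\<close> is not a
  power of two and the leaves lie on different levels.\<close>

lemma div_power_reaches_1:
  assumes "1 \<le> (x :: nat)"
  shows "\<exists>e. x div 2 ^ e = 1"
  using assms
proof (induction x rule: less_induct)
  case (less x)
  show ?case
  proof (cases "x = 1")
    case True
    then show ?thesis by (auto intro: exI[of _ 0])
  next
    case False
    then obtain e where "x div 2 div 2 ^ e = 1" using less by force
    then have "x div 2 ^ Suc e = 1" by (simp add: div_mult2_eq)
    then show ?thesis by blast
  qed
qed

lemma tournament_root:
  assumes "tournament N A k w" "0 < N"
  shows "w 1 = 0 \<Longrightarrow> A = {}"
    and "0 < w 1 \<Longrightarrow> w 1 - 1 \<in> A \<and> (\<forall>j\<in>A. k (w 1 - 1) \<le> k j)"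
proof -
  have *: "w 1 \<noteq> 0 \<and> k (w 1 - 1) \<le> k j" if "j \<in> A" for j
  proof -
    obtain e where "(N + j) div 2 ^ e = 1"
      using div_power_reaches_1[of "N + j"] assms(2) by auto
    then show ?thesis using tournament_winner_le[OF assms(1) that, of e] by simp
  qed
  then show "w 1 = 0 \<Longrightarrow> A = {}" by auto
  assume "0 < w 1"
  then obtain j where "w 1 = Suc j" using gr0_conv_Suc by auto
  then show "w 1 - 1 \<in> A \<and> (\<forall>j\<in>A. k (w 1 - 1) \<le> k j)"
    using tournament_winner_above[OF assms(1), of 1 j] assms(2) * by auto
qed

text \<open>An emptied queue has only null entries, so the same array can serve the next phase with
  a different key array.\<close>

lemma tournament_empty_cong: "tournament N {} k w \<Longrightarrow> tournament N {} k' w"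
proof -
  assume t: "tournament N {} k w"
  have "w i = 0" if "1 \<le> i" "i < 2 * N" for i
    using tournament_winner_above[OF t that] by (cases "w i") auto
  then show ?thesis using t by (auto simp: tournament_def winner_def)
qed

text \<open>One statement for insertion, deletion and change of key, according to whether
  \<open>j\<close> belongs to \<open>A\<close> and \<open>B\<close>.\<close>

lemma tournament_change_leaf:
  assumes t: "tournament N A k w" and j: "j < N"
    and k': "\<And>j'. j' \<noteq> j \<Longrightarrow> k' j' = k j'"
    and B: "\<And>j'. j' \<noteq> j \<Longrightarrow> j' \<in> B \<longleftrightarrow> j' \<in> A"
    and x: "x = (if j \<in> B then Suc j else 0)"
  shows "tournament_pending N B k' (w(N + j := x)) ((N + j) div 2)"
  unfolding tournament_pending_def
proof (intro conjI allI impI)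
  have tl: "tournament_leaves N A w" using t by (simp add: tournament_def)
  have "B \<subseteq> {..<N}" using B j tl by (fastforce simp: tournament_leaves_def)
  then show "tournament_leaves N B (w(N + j := x))"
    using tl B x j by (auto simp: tournament_leaves_def)
  fix i assume i: "1 \<le> i" "i < N" and ne: "\<forall>e. i \<noteq> (N + j) div 2 div 2 ^ e"
  \<comment> \<open>A node off the path from the leaf to the root has both children off it, so
    neither contestant of its match is \<open>j\<close>.\<close>
  have ne2: "i' \<noteq> (N + j) div 2 ^ e" if "i' = i + i \<or> i' = Suc (i + i)" for i' e
  proof
    assume "i' = (N + j) div 2 ^ e"
    then have "i = (N + j) div 2 div 2 ^ e"
      using that by (metis add_diff_cancel_left' bit_eq_rec div2_Suc_Suc div_add1_eq
          div_mult2_eq mult.commute mult_2 nonzero_mult_div_cancel_left numeral_2_eq_2 even_Suc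
          even_Suc_div_two dvd_triv_left zero_neq_numeral)
    with ne show False by blast
  qed
  have "N + j \<noteq> i + i" "N + j \<noteq> Suc (i + i)" using ne2[of _ 0] by auto
  moreover have "k' (w i' - 1) = k (w i' - 1)" if nz: "w i' \<noteq> 0" and i': "i' = i + i \<or> i' = Suc (i + i)" for i'
  proof (rule k')
    obtain j' where j': "w i' = Suc j'" using nz by (cases "w i'") auto
    have "\<exists>e. i' = (N + j') div 2 ^ e"
      using tournament_winner_above[OF t _ _ j'] i' i by auto
    then show "w i' - 1 \<noteq> j" using ne2[OF i'] j' by auto
  qed
  moreover have "w i = winner k (w (i + i)) (w (Suc (i + i)))"
    using t i by (auto simp: tournament_def)
  ultimately show "(w(N + j := x)) i =
      winner k' ((w(N + j := x)) (i + i)) ((w(N + j := x)) (Suc (i + i)))"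
    using i by (auto simp: winner_def)
qed

lemma tournament_pending_step:
  assumes t: "tournament_pending N A k w i" and i: "1 \<le> i" "i < N"
  shows "tournament_pending N A k (w(i := winner k (w (i + i)) (w (Suc (i + i))))) (i div 2)"
    and "winner k (w (i + i)) (w (Suc (i + i))) \<le> N"
proof -
  have tl: "tournament_leaves N A w" using t by (simp add: tournament_pending_def)
  then have "w (i + i) \<le> N" "w (Suc (i + i)) \<le> N"
    using i by (auto simp: tournament_leaves_def)
  then show le: "winner k (w (i + i)) (w (Suc (i + i))) \<le> N" by (simp add: winner_def)
  define w' where "w' = w(i := winner k (w (i + i)) (w (Suc (i + i))))"
  show "tournament_pending N A k w' (i div 2)"
    unfolding tournament_pending_def
  proof (intro conjI allI impI)
    show "tournament_leaves N A w'" using tl le i by (auto simp: w'_def tournament_leaves_def)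
    fix i' assume i': "1 \<le> i'" "i' < N" and ne: "\<forall>e. i' \<noteq> i div 2 div 2 ^ e"
    have half: "i' \<noteq> i div 2" using spec[OF ne, of 0] by simp
    then have same: "w' (i' + i') = w (i' + i')" "w' (Suc (i' + i')) = w (Suc (i' + i'))"
      by (auto simp: w'_def)
    show "w' i' = winner k (w' (i' + i')) (w' (Suc (i' + i')))"
    proof (cases "i' = i")
      case True
      then show ?thesis unfolding same by (simp add: w'_def)
    next
      case False
      have "i' \<noteq> i div 2 ^ e" for e
        using False ne by (cases e) (auto simp: div_mult2_eq)
      then show ?thesis unfolding same using t i' False
        by (simp add: w'_def tournament_pending_def)
    qed
  qed
qed

text \<open>The nested negations express the disjunction in \<open>winner\<close>. For a null entry,
  truncated subtraction makes the key lookup read cell \<open>0\<close>, whose value the test for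
  null then masks.\<close>

definition play :: "vname \<Rightarrow> com" where
  "play K =
     (let a = IArr ''w'' (IPlus (IVar ''i'') (IVar ''i''));
          b = IArr ''w'' (IPlus (IPlus (IVar ''i'') (IVar ''i'')) (IConst 1))
      in If (BNot (BAnd (ILess (IConst 0) a) (BNot (BAnd (ILess (IConst 0) b)
              (RLess (RArr K (IMinus b (IConst 1))) (RArr K (IMinus a (IConst 1))))))))
           (IStore ''w'' (IVar ''i'') b) (IStore ''w'' (IVar ''i'') a))"

lemma wp_play:
  assumes "ivars s ''i'' = i" "iarrs s ''w'' = w" "i \<le> W"
    and "winner (rarrs s K) (w (i + i)) (w (Suc (i + i))) \<le> W"
    and "\<And>T. T \<le> 60 \<Longrightarrow> Q T (s\<lparr>iarrs := (iarrs s)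
      (''w'' := w(i := winner (rarrs s K) (w (i + i)) (w (Suc (i + i)))))\<rparr>)"
  shows "wp W (play K) s Q"
  using assms by (auto simp: play_def Let_def winner_def)

definition replay :: "vname \<Rightarrow> com" where
  "replay K =
     Seq (IAssign ''i'' (IHalf (IVar ''i'')))
    (While (ILess (IConst 0) (IVar ''i''))
       (Seq (play K) (IAssign ''i'' (IHalf (IVar ''i'')))))"

text \<open>The invariant \<open>i < 2 ^ e\<close> bounds the remaining levels by \<open>e\<close>;
  one match and one halving are paid from 70 units per level.\<close>

lemma wp_replay:
  assumes "tournament_pending N A (rarrs s K) (iarrs s ''w'') (ivars s ''i'' div 2)"
    and "ivars s ''i'' < 2 * N" "N \<le> W" "ivars s ''i'' div 2 < 2 ^ L"
  shows "wp W (replay K) s (\<lambda>T s'. T \<le> 80 * (L + 1) \<and> (\<exists>w. tournament N A (rarrs s K) w \<and>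
    s' = s\<lparr>ivars := (ivars s)(''i'' := 0), iarrs := (iarrs s)(''w'' := w)\<rparr>))"
proof -
  define I where "I k s' \<longleftrightarrow> (\<exists>i w e. tournament_pending N A (rarrs s K) w i \<and> i < N \<and> i < 2 ^ e \<and>
      k = 70 * e \<and> s' = s\<lparr>ivars := (ivars s)(''i'' := i), iarrs := (iarrs s)(''w'' := w)\<rparr>)"
    for k s'
  define s0 where "s0 = s\<lparr>ivars := (ivars s)(''i'' := ivars s ''i'' div 2)\<rparr>"
  have "wp W (While (ILess (IConst 0) (IVar ''i''))
       (Seq (play K) (IAssign ''i'' (IHalf (IVar ''i''))))) s0
     (\<lambda>T s'. T \<le> 70 * L + 4 \<and> (\<exists>w. tournament N A (rarrs s K) w \<and>
              s' = s\<lparr>ivars := (ivars s)(''i'' := 0), iarrs := (iarrs s)(''w'' := w)\<rparr>))"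
  proof (rule wp_While[where I = I and k = "70 * L"], goal_cases)
    case 1
    then show ?case unfolding I_def s0_def using assms
      by (intro exI[of _ "ivars s ''i'' div 2"] exI[of _ "iarrs s ''w''"] exI[of _ L]) auto
  next
    case (2 k s')
    then obtain i w e where *: "tournament_pending N A (rarrs s K) w i" "i < N" "i < 2 ^ e"
      "k = 70 * e" "0 < i" and s': "s' = s\<lparr>ivars := (ivars s)(''i'' := i), iarrs := (iarrs s)(''w'' := w)\<rparr>"
      by (auto simp: I_def)
    then obtain e' where e': "e = Suc e'" by (cases e) auto
    note st = tournament_pending_step[OF *(1)]
    have "I (70 * e') (s\<lparr>ivars := (ivars s)(''i'' := i div 2),
         iarrs := (iarrs s)(''w'' := w(i := winner (rarrs s K) (w (i + i)) (w (Suc (i + i)))))\<rparr>)"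
      unfolding I_def using st * e' by (intro exI conjI) auto
    then show ?case using * st(2) assms e' unfolding wp_Seq s'
      by (intro wp_play[where i = i and w = w]) auto
  next
    case (3 k s' T)
    then obtain w where "tournament_pending N A (rarrs s K) w 0"
      "s' = s\<lparr>ivars := (ivars s)(''i'' := 0), iarrs := (iarrs s)(''w'' := w)\<rparr>"
      by (auto simp: I_def)
    with 3 tournament_pending_0 show ?case by force
  qed
  then show ?thesis using assms unfolding replay_def
    by (auto simp: s0_def elim!: wp_conseq)
qed

definition set_leaf :: "vname \<Rightarrow> vname \<Rightarrow> iexp \<Rightarrow> com" where
  "set_leaf K v x =
     Seq (IAssign ''i'' (IPlus (IVar ''N'') (IVar v)))
    (Seq (IStore ''w'' (IVar ''i'') x) (replay K))"

text \<open>The caller may already have overwritten the key of \<open>j\<close>, so the old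
  tournament refers to a former key function \<open>k\<close> that agrees elsewhere.\<close>

lemma wp_set_leaf:
  assumes t: "tournament N A k (iarrs s ''w'')"
    and j: "ivars s v = j" "j < N" and N: "ivars s ''N'' = N" "2 * N \<le> W" "2 * N \<le> 2 ^ L"
    and k: "\<And>j'. j' \<noteq> j \<Longrightarrow> rarrs s K j' = k j'"
    and B: "\<And>j'. j' \<noteq> j \<Longrightarrow> j' \<in> B \<longleftrightarrow> j' \<in> A"
    and x: "ival (s\<lparr>ivars := (ivars s)(''i'' := N + j)\<rparr>) x = (if j \<in> B then Suc j else 0)"
    and Q: "\<And>T w. T \<le> 100 * (L + 1) + icost x \<Longrightarrow> tournament N B (rarrs s K) w \<Longrightarrow>
      Q T (s\<lparr>ivars := (ivars s)(''i'' := 0), iarrs := (iarrs s)(''w'' := w)\<rparr>)"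
  shows "wp W (set_leaf K v x) s Q"
proof -
  define s1 where "s1 = s\<lparr>ivars := (ivars s)(''i'' := N + j),
    iarrs := (iarrs s)(''w'' := (iarrs s ''w'')(N + j := if j \<in> B then Suc j else 0))\<rparr>"
  have "tournament_pending N B (rarrs s1 K) (iarrs s1 ''w'') (ivars s1 ''i'' div 2)"
    unfolding s1_def using tournament_change_leaf[OF t j(2) _ B] k by simp
  from wp_replay[OF this, of W L] have
    "wp W (replay K) s1 (\<lambda>T s'. T \<le> 80 * (L + 1) \<and> (\<exists>w. tournament N B (rarrs s1 K) w \<and>
      s' = s1\<lparr>ivars := (ivars s1)(''i'' := 0), iarrs := (iarrs s1)(''w'' := w)\<rparr>))"
    using j N by (auto simp: s1_def)
  then show ?thesis
    using j N x unfolding set_leaf_def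
    by (auto simp: s1_def intro!: Q elim!: wp_conseq)
qed

section \<open>Instances and adjacency lists\<close>

text \<open>A single tree with \<open>N = n + m\<close> leaves serves as queue of vertices and as
  queue of edges. Its indices stay below \<open>2 * N\<close>, so \<open>L\<close> bounds its
  depth.\<close>

locale orp_instance =
  fixes n :: nat and E :: "nat set set" and l :: "nat set \<Rightarrow> real" and t :: nat
    and es :: "(nat \<times> nat) list" and W L :: nat
  assumes graph: "undirected_graph {..<n} E" and nonneg: "\<forall>e\<in>E. 0 \<le> l e" and t_less: "t < n"
    and edges: "edge_list es E"
    and W: "2 * (n + length es) + 2 \<le> W" and L: "2 * (n + length es) \<le> 2 ^ L"
begin

abbreviation "m \<equiv> length es"
abbreviation "N \<equiv> n + length es"

text \<open>The edge with index \<open>i\<close> consists of the two arcs \<open>2 * i + 1\<close> and \<open>2 * i + 2\<close>; arc \<open>0\<close> is the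
  null pointer.\<close>

definition arc_src :: "nat \<Rightarrow> nat" where
  "arc_src a = (if odd a then fst else snd) (es ! ((a - 1) div 2))"

definition arc_dst :: "nat \<Rightarrow> nat" where
  "arc_dst a = (if odd a then snd else fst) (es ! ((a - 1) div 2))"

definition arcs :: "nat set" where "arcs = {1..2 * m}"

lemma finite_arcs [simp]: "finite arcs" by (simp add: arcs_def)

lemma edge_nth: "i < m \<Longrightarrow> {fst (es ! i), snd (es ! i)} \<in> E"
  using edges by (force simp: edge_list_def edge_of_def)

lemma edge_less: "{u, v} \<in> E \<Longrightarrow> u < n \<and> v < n \<and> u \<noteq> v"
  using graph by (fastforce simp: undirected_graph_def)

lemma edge_of_arc: "a \<in> arcs \<Longrightarrow> {arc_src a, arc_dst a} = edge_of (es ! ((a - 1) div 2))"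
  by (auto simp: arc_src_def arc_dst_def edge_of_def)

lemma arc_index: "a \<in> arcs \<Longrightarrow> (a - 1) div 2 < m"
  by (auto simp: arcs_def)

lemma arc_edge: "a \<in> arcs \<Longrightarrow> {arc_src a, arc_dst a} \<in> E"
  using edge_of_arc[of a] edge_nth[of "(a - 1) div 2"] arc_index[of a] by (simp add: edge_of_def)

lemma edge_arc:
  assumes "{u, v} \<in> E"
  obtains a where "a \<in> arcs" "arc_src a = u" "arc_dst a = v"
proof -
  have "{u, v} \<in> set (map edge_of es)" using assms edges by (simp add: edge_list_def)
  then obtain i where i: "i < m" "edge_of (es ! i) = {u, v}"
    by (auto simp: in_set_conv_nth)
  then consider "fst (es ! i) = u" "snd (es ! i) = v" | "fst (es ! i) = v" "snd (es ! i) = u"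
    by (auto simp: edge_of_def doubleton_eq_iff)
  then show ?thesis
  proof cases
    case 1
    then show ?thesis using i by (intro that[of "2 * i + 1"]) (auto simp: arcs_def arc_src_def arc_dst_def)
  next
    case 2
    then show ?thesis using i by (intro that[of "2 * i + 2"]) (auto simp: arcs_def arc_src_def arc_dst_def)
  qed
qed

text \<open>Arcs are prepended in increasing order, so each linked list is decreasing. Its shape can
  thus be described by maxima: \<open>head u\<close> is the greatest arc of \<open>u\<close>, and
  \<open>link a\<close> the next smaller one with the same source. No inductive list predicate is
  involved.\<close>

definition adjacency :: "nat \<Rightarrow> (nat \<Rightarrow> nat) \<Rightarrow> (nat \<Rightarrow> nat) \<Rightarrow> (nat \<Rightarrow> nat) \<Rightarrow> bool" where
  "adjacency k head link tgt \<longleftrightarrow>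
     (\<forall>u. head u \<le> k \<and> (head u \<noteq> 0 \<longrightarrow> arc_src (head u) = u) \<and>
        (\<forall>a. 1 \<le> a \<longrightarrow> a \<le> k \<longrightarrow> arc_src a = u \<longrightarrow> a \<le> head u)) \<and>
     (\<forall>a. 1 \<le> a \<longrightarrow> a \<le> k \<longrightarrow> tgt a = arc_dst a \<and> link a < a \<and>
        (link a \<noteq> 0 \<longrightarrow> arc_src (link a) = arc_src a) \<and>
        (\<forall>a'. 1 \<le> a' \<longrightarrow> a' < a \<longrightarrow> arc_src a' = arc_src a \<longrightarrow> a' \<le> link a))"

lemma adjacency_0: "adjacency 0 (\<lambda>_. 0) link tgt"
  by (simp add: adjacency_def)

lemma adjacency_Suc:
  assumes "adjacency k head link tgt" "u = arc_src (Suc k)" "v = arc_dst (Suc k)"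
  shows "adjacency (Suc k) (head(u := Suc k)) (link(Suc k := head u)) (tgt(Suc k := v))"
proof -
  have a1: "a < Suc k" if "a \<le> k" for a using that by simp
  have A: "head u \<le> k" "head u \<noteq> 0 \<Longrightarrow> arc_src (head u) = u"
    "1 \<le> a \<Longrightarrow> a \<le> k \<Longrightarrow> arc_src a = u \<Longrightarrow> a \<le> head u" for u a
    using assms(1) unfolding adjacency_def by blast+
  have B: "tgt a = arc_dst a" "link a < a" "link a \<noteq> 0 \<Longrightarrow> arc_src (link a) = arc_src a"
    "1 \<le> a' \<Longrightarrow> a' < a \<Longrightarrow> arc_src a' = arc_src a \<Longrightarrow> a' \<le> link a" if "1 \<le> a" "a \<le> k" for a a'
    using assms(1) that unfolding adjacency_def by blast+
  show ?thesis
    unfolding adjacency_def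
  proof (intro conjI allI impI)
    fix a assume a: "1 \<le> a" "a \<le> Suc k"
    show "(tgt(Suc k := v)) a = arc_dst a" "(link(Suc k := head u)) a < a"
      using a B[of a] A(1)[of u] assms by (auto simp: le_Suc_eq)
    show "arc_src ((link(Suc k := head u)) a) = arc_src a" if "(link(Suc k := head u)) a \<noteq> 0"
      using a B(3)[of a] A(2)[of u] that assms by (auto simp: le_Suc_eq)
    show "a' \<le> (link(Suc k := head u)) a" if "1 \<le> a'" "a' < a" "arc_src a' = arc_src a" for a'
      using a B(4)[of a a'] A(3)[of a' u] that assms by (auto simp: le_Suc_eq)
  next
    fix u'
    show "(head(u := Suc k)) u' \<le> Suc k" using A(1)[of u'] by auto
    show "arc_src ((head(u := Suc k)) u') = u'" if "(head(u := Suc k)) u' \<noteq> 0"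
      using A(2)[of u'] that assms by (auto split: if_splits)
    show "a \<le> (head(u := Suc k)) u'" if "1 \<le> a" "a \<le> Suc k" "arc_src a = u'" for a
      using A(3)[of a u'] that assms by (auto simp: le_Suc_eq)
  qed
qed

definition graph_store :: "store \<Rightarrow> bool" where
  "graph_store s \<longleftrightarrow> ivars s ''m'' = m \<and> ivars s ''t'' = t \<and> ivars s ''N'' = N \<and>
     iarrs s ''src'' = array_of (map fst es) \<and> iarrs s ''dst'' = array_of (map snd es) \<and>
     rarrs s ''weight'' = array_of (map (\<lambda>uv. l (edge_of uv)) es)"

definition adjacency_store :: "store \<Rightarrow> bool" where
  "adjacency_store s \<longleftrightarrow> graph_store s \<and>
     adjacency (2 * m) (iarrs s ''head'') (iarrs s ''link'') (iarrs s ''tgt'')"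

section \<open>Dijkstra's algorithm for inflationary arc functions\<close>

text \<open>\<open>c u v x\<close> is the value offered to \<open>v\<close> by \<open>u\<close> with
  label \<open>x\<close>, and \<open>None\<close> is infinity. \<open>F\<close> is the rank of
  settlement, \<open>X\<close> the successor pointer, \<open>D\<close> the label and
  \<open>A\<close> the queue. Ranks decrease along pointers of settled vertices, which excludes
  cycles, and are bounded by the number of settled vertices, so that the next number is a fresh
  maximal rank.\<close>

definition labelling :: "(nat \<Rightarrow> nat \<Rightarrow> real \<Rightarrow> real option) \<Rightarrow>
    (nat \<Rightarrow> nat) \<Rightarrow> (nat \<Rightarrow> nat) \<Rightarrow> (nat \<Rightarrow> real) \<Rightarrow> nat set \<Rightarrow> bool" where
  "labelling c F X D A \<longleftrightarrow>
     (\<forall>v. F v \<noteq> 0 \<or> v \<in> A \<longrightarrow> v < n) \<and> (\<forall>v\<in>A. F v = 0) \<and>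
     D t = 0 \<and> X t = 0 \<and> (t \<in> A \<or> F t \<noteq> 0) \<and> (t \<in> A \<longrightarrow> A = {t} \<and> F = (\<lambda>_. 0)) \<and>
     (\<forall>v. F v = 0 \<longrightarrow> v \<notin> A \<longrightarrow> X v = 0) \<and>
     (\<forall>v. v \<noteq> t \<longrightarrow> F v \<noteq> 0 \<or> v \<in> A \<longrightarrow> (\<exists>u. X v = Suc u \<and> F u \<noteq> 0 \<and> (F v \<noteq> 0 \<longrightarrow> F u < F v) \<and>
        {u, v} \<in> E \<and> c u v (D u) = Some (D v))) \<and>
     (\<forall>v. F v \<le> card {v. F v \<noteq> 0}) \<and>
     (\<forall>u v. F u \<noteq> 0 \<longrightarrow> v \<in> A \<longrightarrow> D u \<le> D v)"

definition relaxed :: "(nat \<Rightarrow> nat \<Rightarrow> real \<Rightarrow> real option) \<Rightarrow>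
    (nat \<Rightarrow> nat) \<Rightarrow> (nat \<Rightarrow> real) \<Rightarrow> nat set \<Rightarrow> nat \<Rightarrow> nat \<Rightarrow> bool" where
  "relaxed c F D A u v \<longleftrightarrow> (\<forall>x. c u v (D u) = Some x \<longrightarrow> (F v \<noteq> 0 \<or> v \<in> A) \<and> D v \<le> x)"

definition scanned :: "(nat \<Rightarrow> nat \<Rightarrow> real \<Rightarrow> real option) \<Rightarrow>
    (nat \<Rightarrow> nat) \<Rightarrow> (nat \<Rightarrow> nat) \<Rightarrow> (nat \<Rightarrow> real) \<Rightarrow> nat set \<Rightarrow> bool" where
  "scanned c F X D A \<longleftrightarrow> labelling c F X D A \<and>
     (\<forall>u v. F u \<noteq> 0 \<longrightarrow> {u, v} \<in> E \<longrightarrow> relaxed c F D A u v)"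

text \<open>The state inside the scan of \<open>u\<close>, where \<open>a\<close> is the next arc.
  Since lists are decreasing, the arcs already dealt with are those with a greater number.\<close>

definition scanning :: "(nat \<Rightarrow> nat \<Rightarrow> real \<Rightarrow> real option) \<Rightarrow>
    (nat \<Rightarrow> nat) \<Rightarrow> (nat \<Rightarrow> nat) \<Rightarrow> (nat \<Rightarrow> real) \<Rightarrow> nat set \<Rightarrow> nat \<Rightarrow> nat \<Rightarrow> bool" where
  "scanning c F X D A u a \<longleftrightarrow> labelling c F X D A \<and> F u \<noteq> 0 \<and> (\<forall>u'. F u' \<noteq> 0 \<longrightarrow> D u' \<le> D u) \<and>
     (\<forall>u' v. F u' \<noteq> 0 \<longrightarrow> {u', v} \<in> E \<longrightarrow> u' \<noteq> u \<longrightarrow> relaxed c F D A u' v) \<and>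
     (\<forall>a'\<in>arcs. a < a' \<longrightarrow> arc_src a' = u \<longrightarrow> relaxed c F D A u (arc_dst a'))"

lemma finite_settled: "labelling c F X D A \<Longrightarrow> finite {v. F v \<noteq> 0}"
  by (rule finite_subset[of _ "{..<n}"]) (auto simp: labelling_def)

lemma card_settled_le: "labelling c F X D A \<Longrightarrow> card {v. F v \<noteq> 0} \<le> n"
  using card_mono[of "{..<n}" "{v. F v \<noteq> 0}"] by (auto simp: labelling_def)

lemma labelling_init: "D t = 0 \<Longrightarrow> labelling c (\<lambda>_. 0) (\<lambda>_. 0) D {t}"
  using t_less by (auto simp: labelling_def)

text \<open>A minimum of the queue has a label at least as large as all settled ones, so it becomes
  their maximum, and the order between settled and queued labels survives.\<close>

lemma settle:
  assumes s: "scanned c F X D A" and u: "u \<in> A" "\<And>v. v \<in> A \<Longrightarrow> D u \<le> D v"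
    and a: "\<And>a'. a' \<in> arcs \<Longrightarrow> arc_src a' = u \<Longrightarrow> a' \<le> a"
    and k: "k = Suc (card {v. F v \<noteq> 0})"
  shows "scanning c (F(u := k)) X D (A - {u}) u a"
    and "card {v. (F(u := k)) v \<noteq> 0} = k"
proof -
  have lab: "labelling c F X D A" using s by (simp add: scanned_def)
  have Fu: "F u = 0" using lab u by (simp add: labelling_def)
  have "{v. (F(u := k)) v \<noteq> 0} = insert u {v. F v \<noteq> 0}" using k by auto
  then show k': "card {v. (F(u := k)) v \<noteq> 0} = k"
    using k Fu finite_settled[OF lab] by simp
  have le: "F v < k" for v using lab k by (auto simp: labelling_def less_Suc_eq_le)
  have k0: "k \<noteq> 0" using k by simp
  have "labelling c (F(u := k)) X D (A - {u})"
    unfolding labelling_def k'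
  proof (intro conjI allI impI ballI)
    fix z assume z: "z \<noteq> t" "(F(u := k)) z \<noteq> 0 \<or> z \<in> A - {u}"
    then have "F z \<noteq> 0 \<or> z \<in> A" using u(1) by (auto split: if_splits)
    then obtain u' where u': "X z = Suc u'" "F u' \<noteq> 0" "F z \<noteq> 0 \<longrightarrow> F u' < F z"
      "{u', z} \<in> E" "c u' z (D u') = Some (D z)"
      using z lab unfolding labelling_def by auto
    then have "u' \<noteq> u" using Fu by auto
    then show "\<exists>u'. X z = Suc u' \<and> (F(u := k)) u' \<noteq> 0 \<and> ((F(u := k)) z \<noteq> 0 \<longrightarrow> (F(u := k)) u' < (F(u := k)) z) \<and>
        {u', z} \<in> E \<and> c u' z (D u') = Some (D z)"
      using u' le[of u'] by (intro exI[of _ u']) auto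
  next
    fix u' v assume "(F(u := k)) u' \<noteq> 0" "v \<in> A - {u}"
    then show "D u' \<le> D v" using u(2) lab by (auto simp: labelling_def split: if_splits)
  next
    fix v show "(F(u := k)) v \<le> k" using less_imp_le[OF le] by simp
  next
    show "t \<in> A - {u} \<Longrightarrow> A - {u} = {t}" "t \<in> A - {u} \<Longrightarrow> F(u := k) = (\<lambda>_. 0)"
      using lab u(1) by (auto simp: labelling_def)
  qed (use lab u(1) k0 in \<open>auto simp: labelling_def split: if_splits\<close>)
  moreover have "D u' \<le> D u" if "F u' \<noteq> 0" for u'
    using lab that u(1) by (simp add: labelling_def)
  moreover have "relaxed c (F(u := k)) D (A - {u}) u' v" if "F u' \<noteq> 0" "{u', v} \<in> E" for u' v
    using s that k0 unfolding scanned_def relaxed_def by auto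
  moreover have "\<not> a < a'" if "a' \<in> arcs" "arc_src a' = u" for a' using a that by force
  ultimately show "scanning c (F(u := k)) X D (A - {u}) u a"
    using k0 unfolding scanning_def by auto
qed

lemma scanning_done:
  assumes "scanning c F X D A u 0"
  shows "scanned c F X D A"
  unfolding scanned_def
proof (intro conjI allI impI)
  show "labelling c F X D A" using assms by (simp add: scanning_def)
  fix u' v assume *: "F u' \<noteq> 0" "{u', v} \<in> E"
  from *(2) obtain a where "a \<in> arcs" "arc_src a = u'" "arc_dst a = v" by (rule edge_arc)
  then show "relaxed c F D A u' v"
    using assms * unfolding scanning_def by (cases "u' = u") (auto simp: arcs_def)
qed

lemma scanning_next:
  assumes "scanning c F X D A u a" "arc_src a = u \<Longrightarrow> relaxed c F D A u (arc_dst a)"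
    and "\<And>a'. a' \<in> arcs \<Longrightarrow> a' < a \<Longrightarrow> arc_src a' = u \<Longrightarrow> a' \<le> b"
  shows "scanning c F X D A u b"
proof -
  have "relaxed c F D A u (arc_dst a')" if "a' \<in> arcs" "b < a'" "arc_src a' = u" for a'
  proof (cases "a' < a")
    case True
    then show ?thesis using assms(3) that by fastforce
  next
    case False
    then show ?thesis using assms(1,2) that unfolding scanning_def by (cases "a' = a") auto
  qed
  then show ?thesis using assms(1) unfolding scanning_def by blast
qed

text \<open>Here arc functions must be inflationary: the offer is at least \<open>D u\<close>, which
  is the largest settled label, so settled vertices can be passed over.\<close>

lemma relaxed_if_settled:
  assumes "scanning c F X D A u a" "F v \<noteq> 0" and infl: "\<And>x. c u v (D u) = Some x \<Longrightarrow> D u \<le> x"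
  shows "relaxed c F D A u v"
proof -
  have "D v \<le> D u" using assms(1,2) unfolding scanning_def by blast
  then show ?thesis using assms(2) infl order_trans unfolding relaxed_def by blast
qed

text \<open>Only the unsettled \<open>v\<close> changes, so the data of settled vertices stay
  intact; its new label is at least \<open>D u\<close> and thus respects the order of
  settlement.\<close>

lemma scanning_improve:
  assumes s: "scanning c F X D A u a" and v: "{u, v} \<in> E" "F v = 0"
    and x: "c u v (D u) = Some x" "D u \<le> x" "v \<in> A \<Longrightarrow> x < D v"
  shows "scanning c F (X(v := Suc u)) (D(v := x)) (insert v A) u a"
    and "relaxed c F (D(v := x)) (insert v A) u v"
proof -
  have lab: "labelling c F X D A" and Fu: "F u \<noteq> 0" and Du: "\<And>u'. F u' \<noteq> 0 \<Longrightarrow> D u' \<le> D u"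
    using s by (auto simp: scanning_def)
  have tA: "t \<notin> A" using lab Fu by (auto simp: labelling_def)
  then have vt: "v \<noteq> t" using lab v by (auto simp: labelling_def)
  have same: "(D(v := x)) u' = D u'" if "F u' \<noteq> 0" for u' using that v by auto
  have lab': "labelling c F (X(v := Suc u)) (D(v := x)) (insert v A)"
    unfolding labelling_def
  proof (intro conjI allI impI ballI)
    fix z assume z: "z \<noteq> t" "F z \<noteq> 0 \<or> z \<in> insert v A"
    show "\<exists>u'. (X(v := Suc u)) z = Suc u' \<and> F u' \<noteq> 0 \<and> (F z \<noteq> 0 \<longrightarrow> F u' < F z) \<and>
        {u', z} \<in> E \<and> c u' z ((D(v := x)) u') = Some ((D(v := x)) z)"
    proof (cases "z = v")
      case True
      then show ?thesis using Fu v x same[OF Fu] by auto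
    next
      case False
      then obtain u' where "X z = Suc u'" "F u' \<noteq> 0" "F z \<noteq> 0 \<longrightarrow> F u' < F z"
        "{u', z} \<in> E" "c u' z (D u') = Some (D z)"
        using z lab unfolding labelling_def by auto
      then show ?thesis using False same by auto
    qed
  next
    fix u' z assume "F u' \<noteq> 0" "z \<in> insert v A"
    then show "(D(v := x)) u' \<le> (D(v := x)) z"
      using same[of u'] Du[of u'] x(2) lab by (auto simp: labelling_def)
  qed (use lab v vt tA edge_less[OF v(1)] in \<open>auto simp: labelling_def\<close>)
  have rel: "relaxed c F (D(v := x)) (insert v A) u' z" if "F u' \<noteq> 0" "relaxed c F D A u' z" for u' z
    using that v x(3) unfolding relaxed_def same[OF that(1)] by force
  show "relaxed c F (D(v := x)) (insert v A) u v"
    unfolding relaxed_def same[OF Fu] using x by auto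
  show "scanning c F (X(v := Suc u)) (D(v := x)) (insert v A) u a"
    unfolding scanning_def
  proof (intro conjI allI impI ballI)
    show "(D(v := x)) u' \<le> (D(v := x)) u" if "F u' \<noteq> 0" for u'
      unfolding same[OF that] same[OF Fu] using Du that .
    show "relaxed c F (D(v := x)) (insert v A) u' z" if "F u' \<noteq> 0" "{u', z} \<in> E" "u' \<noteq> u" for u' z
      using s that unfolding scanning_def by (intro rel) blast+
    show "relaxed c F (D(v := x)) (insert v A) u (arc_dst a')"
      if "a' \<in> arcs" "a < a'" "arc_src a' = u" for a'
      using s that unfolding scanning_def by (intro rel Fu) blast
  qed (fact lab' Fu)+
qed

end

section \<open>The Dijkstra variant as a program\<close>

definition IEq :: "iexp \<Rightarrow> iexp \<Rightarrow> bexp" where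
  "IEq i j = BAnd (BNot (ILess i j)) (BNot (ILess j i))"

lemma bval_IEq [simp]: "bval s (IEq i j) \<longleftrightarrow> ival s i = ival s j"
  by (auto simp: IEq_def)

lemma bcost_IEq [simp]: "bcost (IEq i j) = 5 + 2 * icost i + 2 * icost j"
  by (simp add: IEq_def)

text \<open>Names of arrays: \<open>P\<close> holds the parents for which the value of the arc towards the parent is
  raised to the replacement distance; \<open>D\<close>, \<open>F\<close> and \<open>X\<close> receive the value, the rank in the order of
  settlement (\<open>0\<close> if not settled) and the successor of each vertex.\<close>

definition commit :: "vname \<Rightarrow> vname \<Rightarrow> com" where
  "commit D X =
     Seq (RStore D (IVar ''v'') (RVar ''y''))
    (Seq (IStore X (IVar ''v'') (IPlus (IVar ''u'') (IConst 1)))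
         (set_leaf D ''v'' (IPlus (IVar ''v'') (IConst 1))))"

text \<open>\<open>ok\<close> is cleared for an infinite offer. Membership in the queue is read off
  the leaf of \<open>v\<close> in \<open>w\<close>, so labels need no initialisation with
  infinity.\<close>

definition relax :: "vname \<Rightarrow> vname \<Rightarrow> vname \<Rightarrow> vname \<Rightarrow> com" where
  "relax P D F X =
     Seq (IAssign ''v'' (IArr ''tgt'' (IVar ''a'')))
    (If (ILess (IConst 0) (IArr F (IVar ''v''))) Skip
      (Seq (RAssign ''y'' (RPlus (RArr D (IVar ''u'')) (RArr ''weight'' (IHalf (IMinus (IVar ''a'') (IConst 1))))))
      (Seq (IAssign ''ok'' (IConst 1))
      (Seq (If (IEq (IArr P (IVar ''v'')) (IPlus (IVar ''u'') (IConst 1)))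
             (If (ILess (IConst 0) (IArr ''cov'' (IVar ''v'')))
               (If (RLess (RVar ''y'') (RArr ''r'' (IVar ''v''))) (RAssign ''y'' (RArr ''r'' (IVar ''v''))) Skip)
               (IAssign ''ok'' (IConst 0)))
             Skip)
           (If (BAnd (ILess (IConst 0) (IVar ''ok''))
                  (BNot (BAnd (ILess (IConst 0) (IArr ''w'' (IPlus (IVar ''N'') (IVar ''v''))))
                    (BNot (RLess (RVar ''y'') (RArr D (IVar ''v'')))))))
             (commit D X) Skip)))))"

definition scan_arc :: "vname \<Rightarrow> vname \<Rightarrow> vname \<Rightarrow> vname \<Rightarrow> com" where
  "scan_arc P D F X = Seq (relax P D F X) (IAssign ''a'' (IArr ''link'' (IVar ''a'')))"

definition settle_min :: "vname \<Rightarrow> vname \<Rightarrow> vname \<Rightarrow> vname \<Rightarrow> com" where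
  "settle_min P D F X =
     Seq (IAssign ''u'' (IMinus (IArr ''w'' (IConst 1)) (IConst 1)))
    (Seq (IAssign ''cnt'' (IPlus (IVar ''cnt'') (IConst 1)))
    (Seq (IStore F (IVar ''u'') (IVar ''cnt''))
    (Seq (set_leaf D ''u'' (IConst 0))
    (Seq (IAssign ''a'' (IArr ''head'' (IVar ''u'')))
         (While (ILess (IConst 0) (IVar ''a'')) (scan_arc P D F X))))))"

definition settle_all :: "vname \<Rightarrow> vname \<Rightarrow> vname \<Rightarrow> vname \<Rightarrow> com" where
  "settle_all P D F X = While (ILess (IConst 0) (IArr ''w'' (IConst 1))) (settle_min P D F X)"

definition dijkstra :: "vname \<Rightarrow> vname \<Rightarrow> vname \<Rightarrow> vname \<Rightarrow> com" where
  "dijkstra P D F X =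
     Seq (IAssign ''cnt'' (IConst 0))
    (Seq (set_leaf D ''t'' (IPlus (IVar ''t'') (IConst 1)))
         (settle_all P D F X))"

text \<open>Pointers are shifted by one, so \<open>pa v = Suc u\<close> says that \<open>u\<close>
  is the parent of \<open>v\<close>. An uncovered \<open>v\<close>, with \<open>cv v = 0\<close>,
  has no replacement path and receives no finite offer from its parent. With \<open>pa\<close>
  constantly \<open>0\<close> this is the ordinary arc function of shortest paths.\<close>

definition raised_arc_value :: "(nat set \<Rightarrow> real) \<Rightarrow> (nat \<Rightarrow> nat) \<Rightarrow> (nat \<Rightarrow> nat) \<Rightarrow> (nat \<Rightarrow> real) \<Rightarrow>
    nat \<Rightarrow> nat \<Rightarrow> real \<Rightarrow> real option" where
  "raised_arc_value l pa cv rr u v x =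
     (if pa v = Suc u then if cv v = 0 then None else Some (max (x + l {u, v}) (rr v))
      else Some (x + l {u, v}))"

section \<open>Verification and amortised running time of the Dijkstra variant\<close>

locale dijkstra_run = orp_instance +
  fixes P D F X :: vname and pa cv :: "nat \<Rightarrow> nat" and rr :: "nat \<Rightarrow> real"
  assumes names: "distinct [F, X, ''src'', ''dst'', ''head'', ''link'', ''tgt'', ''w'', ''cov'']"
      "P \<notin> {F, X, ''w''}" "D \<notin> {''weight'', ''r''}"
begin

abbreviation arc_value :: "nat \<Rightarrow> nat \<Rightarrow> real \<Rightarrow> real option" where
  "arc_value \<equiv> raised_arc_value l pa cv rr"

lemma arc_value_ge: "{u, v} \<in> E \<Longrightarrow> arc_value u v x = Some y \<Longrightarrow> x \<le> y"
  using nonneg by (auto simp: raised_arc_value_def split: if_splits)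

text \<open>The arrays \<open>P\<close>, \<open>cov\<close> and \<open>r\<close> are only read
  during a run, so their contents are the fixed parameters \<open>pa\<close>, \<open>cv\<close> and
  \<open>rr\<close>.\<close>

definition input_ok :: "store \<Rightarrow> bool" where
  "input_ok s \<longleftrightarrow> adjacency_store s \<and> iarrs s P = pa \<and> iarrs s ''cov'' = cv \<and> rarrs s ''r'' = rr"

lemma input_ok_cong:
  assumes "input_ok s" "\<forall>x\<in>{''m'', ''t'', ''N''}. ivars s' x = ivars s x"
    "\<forall>a\<in>{''src'', ''dst'', ''head'', ''link'', ''tgt'', P, ''cov''}. iarrs s' a = iarrs s a"
    "\<forall>a\<in>{''weight'', ''r''}. rarrs s' a = rarrs s a"
  shows "input_ok s'"
  using assms unfolding input_ok_def adjacency_store_def graph_store_def by simp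

definition queue_ok :: "store \<Rightarrow> nat set \<Rightarrow> bool" where
  "queue_ok s A \<longleftrightarrow> tournament N A (rarrs s D) (iarrs s ''w'')"

lemma tournament_finite: "tournament N A k w \<Longrightarrow> finite A"
  unfolding tournament_def tournament_leaves_def by (auto intro: finite_subset)

lemma arc_weight:
  "a \<in> arcs \<Longrightarrow> graph_store s \<Longrightarrow> rarrs s ''weight'' ((a - 1) div 2) = l {arc_src a, arc_dst a}"
  using arc_index[of a] edge_of_arc[of a] by (simp add: graph_store_def array_of_def)

lemma wp_commit:
  assumes "queue_ok s A" "ivars s ''v'' = v" "v < n" "ivars s ''u'' = u" "u < n" "ivars s ''N'' = N"
    and Q: "\<And>T w. T \<le> 100 * (L + 1) + 20 \<Longrightarrow>
      tournament N (insert v A) ((rarrs s D)(v := rvars s ''y'')) w \<Longrightarrow>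
      Q T (s\<lparr>ivars := (ivars s)(''i'' := 0),
        iarrs := (iarrs s)(X := (iarrs s X)(v := Suc u), ''w'' := w),
        rarrs := (rarrs s)(D := (rarrs s D)(v := rvars s ''y''))\<rparr>)"
  shows "wp W (commit D X) s Q"
proof -
  have X: "X \<noteq> ''w''" using names by auto
  note a = assms(1-6)[unfolded queue_ok_def] W L
  show ?thesis
    unfolding commit_def
    apply (simp add: a)
    using a X
    apply (intro conjI wp_set_leaf[where A = A and B = "insert v A" and j = v and N = N and L = L
          and k = "rarrs s D"])
    apply simp_all
    apply (rule Q)
    apply simp_all
    done
qed

lemma wp_scan_arc:
  assumes inp: "input_ok s" and q: "queue_ok s A"
    and sc: "scanning arc_value (iarrs s F) (iarrs s X) (rarrs s D) A u a"
    and v: "ivars s ''u'' = u" "ivars s ''a'' = a" "a \<in> arcs" "arc_src a = u"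
    and Q: "\<And>T s' A'. T \<le> 100 * (L + 1) + 100 \<Longrightarrow> input_ok s' \<Longrightarrow> queue_ok s' A' \<Longrightarrow>
      scanning arc_value (iarrs s' F) (iarrs s' X) (rarrs s' D) A' u (ivars s' ''a'') \<Longrightarrow>
      ivars s' ''u'' = u \<Longrightarrow> ivars s' ''a'' < a \<Longrightarrow>
      ivars s' ''a'' \<noteq> 0 \<longrightarrow> arc_src (ivars s' ''a'') = u \<Longrightarrow> iarrs s' F = iarrs s F \<Longrightarrow>
      ivars s' ''cnt'' = ivars s ''cnt'' \<Longrightarrow> card A' \<le> card A + 1 \<Longrightarrow> Q T s'"
  shows "wp W (scan_arc P D F X) s Q"
proof -
  define z where "z = arc_dst a"
  define b where "b = iarrs s ''link'' a"
  have gs: "graph_store s" and adj: "adjacency (2 * m) (iarrs s ''head'') (iarrs s ''link'') (iarrs s ''tgt'')"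
    using inp by (auto simp: input_ok_def adjacency_store_def)
  have e: "{u, z} \<in> E" and zn: "z < n" and un: "u < n"
    using arc_edge[OF v(3)] edge_less[of u z] v(4) by (auto simp: z_def)
  have wt: "rarrs s ''weight'' ((a - Suc 0) div 2) = l {u, z}"
    using arc_weight[OF v(3) gs] v(4) by (simp add: z_def)
  have a: "1 \<le> a" "a \<le> 2 * m" using v(3) by (auto simp: arcs_def)
  have tgt: "iarrs s ''tgt'' a = z" using adj a by (auto simp: adjacency_def z_def)
  have b: "b < a" "b \<noteq> 0 \<longrightarrow> arc_src b = u"
    and bmax: "\<And>a'. a' \<in> arcs \<Longrightarrow> a' < a \<Longrightarrow> arc_src a' = u \<Longrightarrow> a' \<le> b"
    using adj a v(4) by (auto simp: adjacency_def b_def arcs_def)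
  have bW: "b \<le> W" using b(1) a(2) W by arith
  have wz: "0 < iarrs s ''w'' (N + z) \<longleftrightarrow> z \<in> A" "iarrs s ''w'' (N + z) = 0 \<longleftrightarrow> z \<notin> A"
    using q zn by (auto simp: queue_ok_def tournament_def tournament_leaves_def)
  have nm: "P \<noteq> F" "P \<noteq> X" "P \<noteq> ''w''" "F \<noteq> X" "F \<noteq> ''w''" "X \<noteq> ''w''" "''weight'' \<noteq> D" "''r'' \<noteq> D"
    "X \<noteq> ''src''" "X \<noteq> ''dst''" "X \<noteq> ''head''" "X \<noteq> ''link''" "X \<noteq> ''tgt''" "X \<noteq> ''cov''"
    using names by auto
  have N: "ivars s ''N'' = N" using gs by (simp add: graph_store_def)
  have pa: "iarrs s P = pa" "iarrs s ''cov'' = cv" "rarrs s ''r'' = rr" using inp by (auto simp: input_ok_def)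
  define x where "x = rarrs s D u + l {u, z}"
  \<comment> \<open>Two final stores without improvement: after computing an offer that is infinite
    or too large, and after finding \<open>z\<close> settled, where \<open>y\<close> and
    \<open>ok\<close> are not written.\<close>
  have skip: "Q T (s\<lparr>ivars := (ivars s)(''v'' := z, ''ok'' := k, ''a'' := b), rvars := (rvars s)(''y'' := y)\<rparr>)"
    "Q T (s\<lparr>ivars := (ivars s)(''v'' := z, ''a'' := b)\<rparr>)"
    if "relaxed arc_value (iarrs s F) (rarrs s D) A u z" "T \<le> 100 * (L + 1) + 100" for T k y
    using q v scanning_next[OF sc, of b] that bmax b
    by (intro Q[where A' = A] input_ok_cong[OF inp]; simp add: queue_ok_def z_def)+
  have improve: "Q T (s\<lparr>ivars := (ivars s)(''v'' := z, ''ok'' := k, ''i'' := 0, ''a'' := b),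
        rvars := (rvars s)(''y'' := y),
        iarrs := (iarrs s)(X := (iarrs s X)(z := Suc u), ''w'' := w),
        rarrs := (rarrs s)(D := (rarrs s D)(z := y))\<rparr>)"
    if T: "T \<le> 100 * (L + 1) + 100" and w: "tournament N (insert z A) ((rarrs s D)(z := y)) w"
      and y: "arc_value u z (rarrs s D u) = Some y" and lt: "iarrs s F z = 0" "z \<in> A \<Longrightarrow> y < rarrs s D z" for T k y w
  proof -
    note imp = scanning_improve[OF sc e lt(1) y arc_value_ge[OF e y] lt(2)]
    have "scanning arc_value (iarrs s F) ((iarrs s X)(z := Suc u)) ((rarrs s D)(z := y)) (insert z A) u b"
      using scanning_next[OF imp(1), of b] imp(2) bmax by (simp add: z_def)
    moreover have "card (insert z A) \<le> card A + 1" by (rule card_insert_le_m1) auto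
    ultimately show ?thesis
      using v b T w nm
      by (intro Q[where A' = "insert z A"] input_ok_cong[OF inp]; simp add: queue_ok_def del: fun_upd_apply)
        (simp_all add: fun_upd_apply[abs_def])
  qed
  note sym = scan_arc_def relax_def v(1,2) tgt N nm nm[symmetric] pa wt bW b_def[symmetric] x_def[symmetric] wz
  show ?thesis
  proof (cases "iarrs s F z = 0")
    case False
    then have "relaxed arc_value (iarrs s F) (rarrs s D) A u z"
      using relaxed_if_settled[OF sc] arc_value_ge[OF e] by blast
    then show ?thesis using False zn W by (simp add: sym) (rule skip(2); simp)
  next
    case F0: True
    show ?thesis
    proof (cases "arc_value u z (rarrs s D u)")
      case None
      then have "relaxed arc_value (iarrs s F) (rarrs s D) A u z" by (simp add: relaxed_def)
      note sk = skip(1)[OF this]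
      have c: "pa z = Suc u" "cv z = 0"
        using None by (auto simp: raised_arc_value_def split: if_splits)
      have "1 \<le> W" "z \<le> W" using zn W by auto
      then show ?thesis using zn W apply (simp add: sym c F0 del: One_nat_def)
        apply (rule sk) apply simp done
    next
      case (Some y)
      have y: "y = (if pa z = Suc u \<and> x < rr z then rr z else x)" and cv: "pa z = Suc u \<longrightarrow> 0 < cv z"
        using Some by (auto simp: raised_arc_value_def x_def max_def split: if_splits)
      consider (keep) "pa z \<noteq> Suc u" "y = x" | (raise) "pa z = Suc u" "0 < cv z" "x < rr z" "y = rr z"
        | (no_raise) "pa z = Suc u" "0 < cv z" "\<not> x < rr z" "y = x"
        using y cv by (auto split: if_splits)
      note cs = this
      have W': "1 \<le> W" "z \<le> W" using zn W by auto
      show ?thesis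
      proof (cases "z \<in> A \<and> \<not> y < rarrs s D z")
        case True
        then have "relaxed arc_value (iarrs s F) (rarrs s D) A u z"
          using Some by (auto simp: relaxed_def)
        note sk = skip(1)[OF this]
        from cs show ?thesis
        proof cases
          case keep
          then show ?thesis using W' True by (simp add: sym F0) (rule sk; simp)
        next
          case raise
          then show ?thesis using W' True by (simp add: sym F0) (rule sk; simp)
        next
          case no_raise
          then show ?thesis using W' True by (simp add: sym F0) (rule sk; simp)
        qed
      next
        case False
        then have lt: "z \<in> A \<Longrightarrow> y < rarrs s D z" and lt': "z \<notin> A \<or> y < rarrs s D z" by auto
        note im = improve[OF _ _ Some F0 lt]
        note co = wp_commit[where A = A and v = z and u = u]
        from cs show ?thesis
        proof cases
          case keep
          then show ?thesis using W' lt' q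
            apply (simp add: sym F0)
            apply (rule co)
            apply (simp_all add: queue_ok_def v N zn un nm nm[symmetric] bW b_def[symmetric])
            apply (rule im[unfolded keep(2)])
            apply simp_all
            done
        next
          case raise
          then show ?thesis using W' lt' q
            apply (simp add: sym F0)
            apply (rule co)
            apply (simp_all add: queue_ok_def v N zn un nm nm[symmetric] bW b_def[symmetric])
            apply (rule im[unfolded raise(4)])
            apply simp_all
            done
        next
          case no_raise
          then show ?thesis using W' lt' q
            apply (simp add: sym F0)
            apply (rule co)
            apply (simp_all add: queue_ok_def v N zn un nm nm[symmetric] bW b_def[symmetric])
            apply (rule im[unfolded no_raise(4)])
            apply simp_all
            done
        qed
      qed
    qed
  qed
qed

definition arcs_upto :: "nat \<Rightarrow> nat \<Rightarrow> nat" where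
  "arcs_upto u a = card {a' \<in> arcs. arc_src a' = u \<and> a' \<le> a}"

text \<open>Arcs with unsettled source are the reserve of the outer loop; settling \<open>u\<close>
  hands the arcs of \<open>u\<close> over to the inner loop.\<close>

definition unscanned :: "(nat \<Rightarrow> nat) \<Rightarrow> nat" where
  "unscanned f = card {a \<in> arcs. f (arc_src a) = 0}"

lemma arcs_upto_0 [simp]: "arcs_upto u 0 = 0"
proof -
  have "{a' \<in> arcs. arc_src a' = u \<and> a' \<le> 0} = {}" by (auto simp: arcs_def)
  then show ?thesis by (simp add: arcs_upto_def)
qed

lemma arcs_upto_less:
  assumes "a \<in> arcs" "arc_src a = u" "b < a"
  shows "arcs_upto u b + 1 \<le> arcs_upto u a"
proof -
  have "{a' \<in> arcs. arc_src a' = u \<and> a' \<le> b} \<subset> {a' \<in> arcs. arc_src a' = u \<and> a' \<le> a}"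
    using assms by (intro psubsetI) (auto simp: set_eq_iff intro!: exI[of _ a])
  then have "arcs_upto u b < arcs_upto u a"
    unfolding arcs_upto_def by (intro psubset_card_mono) auto
  then show ?thesis by simp
qed

lemma unscanned_settle:
  assumes "f u = 0" "k \<noteq> 0"
  shows "unscanned (f(u := k)) + arcs_upto u a \<le> unscanned f"
proof -
  have "unscanned (f(u := k)) + arcs_upto u a =
      card ({a' \<in> arcs. (f(u := k)) (arc_src a') = 0} \<union> {a' \<in> arcs. arc_src a' = u \<and> a' \<le> a})"
    unfolding unscanned_def arcs_upto_def using assms
    by (intro card_Un_disjoint[symmetric]) auto
  also have "\<dots> \<le> unscanned f"
    unfolding unscanned_def using assms by (intro card_mono) (auto split: if_splits)
  finally show ?thesis .
qed

lemma unscanned_le: "unscanned f \<le> 2 * m"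
proof -
  have "unscanned f \<le> card arcs" unfolding unscanned_def by (intro card_mono) auto
  then show ?thesis by (simp add: arcs_def)
qed

text \<open>The budget is a multiple of \<open>card A + 2 * arcs_upto\<close>. Scanning an arc
  releases two units and may enqueue one vertex, so at least one unit remains to pay for it.\<close>

lemma wp_scan_arcs:
  assumes "input_ok s" "queue_ok s A"
    and "scanning arc_value (iarrs s F) (iarrs s X) (rarrs s D) A u (ivars s ''a'')"
    and "ivars s ''u'' = u" "ivars s ''a'' \<noteq> 0 \<longrightarrow> ivars s ''a'' \<in> arcs \<and> arc_src (ivars s ''a'') = u"
    and Q: "\<And>T s' A'. T + 300 * (L + 1) * card A' \<le> 300 * (L + 1) * (card A + 2 * arcs_upto u (ivars s ''a'')) + 4 \<Longrightarrow>
      input_ok s' \<Longrightarrow> queue_ok s' A' \<Longrightarrow> scanned arc_value (iarrs s' F) (iarrs s' X) (rarrs s' D) A' \<Longrightarrow>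
      iarrs s' F = iarrs s F \<Longrightarrow> ivars s' ''cnt'' = ivars s ''cnt'' \<Longrightarrow> Q T s'"
  shows "wp W (While (ILess (IConst 0) (IVar ''a'')) (scan_arc P D F X)) s Q"
proof -
  define I where "I k s' \<longleftrightarrow> (\<exists>A'. input_ok s' \<and> queue_ok s' A' \<and>
    scanning arc_value (iarrs s' F) (iarrs s' X) (rarrs s' D) A' u (ivars s' ''a'') \<and>
    ivars s' ''u'' = u \<and> (ivars s' ''a'' \<noteq> 0 \<longrightarrow> ivars s' ''a'' \<in> arcs \<and> arc_src (ivars s' ''a'') = u) \<and>
    iarrs s' F = iarrs s F \<and> ivars s' ''cnt'' = ivars s ''cnt'' \<and>
    k = 300 * (L + 1) * (card A' + 2 * arcs_upto u (ivars s' ''a'')))" for k s'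
  show ?thesis
  proof (rule wp_While[where I = I and k = "300 * (L + 1) * (card A + 2 * arcs_upto u (ivars s ''a''))"],
      goal_cases)
    case 1
    show ?case
      unfolding I_def using assms(1-5) by blast
  next
    case (2 k s1)
    then obtain A1 where A1: "input_ok s1" "queue_ok s1 A1"
      "scanning arc_value (iarrs s1 F) (iarrs s1 X) (rarrs s1 D) A1 u (ivars s1 ''a'')"
      "ivars s1 ''u'' = u" "ivars s1 ''a'' \<in> arcs" "arc_src (ivars s1 ''a'') = u"
      "iarrs s1 F = iarrs s F" "ivars s1 ''cnt'' = ivars s ''cnt''"
      "k = 300 * (L + 1) * (card A1 + 2 * arcs_upto u (ivars s1 ''a''))"
      unfolding I_def by auto
    show ?case
    proof (rule wp_scan_arc[OF A1(1-4) refl A1(5,6)])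
      fix T s' A'
      assume *: "T \<le> 100 * (L + 1) + 100" "input_ok s'" "queue_ok s' A'"
        "scanning arc_value (iarrs s' F) (iarrs s' X) (rarrs s' D) A' u (ivars s' ''a'')"
        "ivars s' ''u'' = u" "ivars s' ''a'' < ivars s1 ''a''"
        "ivars s' ''a'' \<noteq> 0 \<longrightarrow> arc_src (ivars s' ''a'') = u" "iarrs s' F = iarrs s1 F"
        "ivars s' ''cnt'' = ivars s1 ''cnt''" "card A' \<le> card A1 + 1"
      have "arcs_upto u (ivars s' ''a'') + 1 \<le> arcs_upto u (ivars s1 ''a'')"
        using arcs_upto_less A1 * by blast
      then have "card A' + 2 * arcs_upto u (ivars s' ''a'') + 1 \<le> card A1 + 2 * arcs_upto u (ivars s1 ''a'')"
        using * by linarith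
      then have "300 * (L + 1) * (card A' + 2 * arcs_upto u (ivars s' ''a'') + 1) \<le> k"
        unfolding A1 by (rule mult_le_mono2)
      then have "1 + bcost (ILess (IConst 0) (IVar ''a'')) + T +
          300 * (L + 1) * (card A' + 2 * arcs_upto u (ivars s' ''a'')) \<le> k"
        using *(1) by (simp add: algebra_simps)
      moreover have "ivars s' ''a'' \<noteq> 0 \<longrightarrow> ivars s' ''a'' \<in> arcs"
        using * A1(5) by (auto simp: arcs_def)
      ultimately show "\<exists>k'. I k' s' \<and> 1 + bcost (ILess (IConst 0) (IVar ''a'')) + T + k' \<le> k"
        unfolding I_def using * A1 by (metis (no_types, lifting))
    qed
  next
    case (3 k' s' T)
    then obtain A' where A': "input_ok s'" "queue_ok s' A'" "iarrs s' F = iarrs s F"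
      "ivars s' ''cnt'' = ivars s ''cnt''" "k' = 300 * (L + 1) * card A'"
      "scanning arc_value (iarrs s' F) (iarrs s' X) (rarrs s' D) A' u 0"
      unfolding I_def by auto
    then show ?case using 3(3) by (intro Q[where A' = A'] scanning_done[OF A'(6)]) auto
  qed
qed

text \<open>The cost unit \<open>B\<close> is kept opaque, so that the nonlinear accounting reduces
  to one monotone multiplication.\<close>

lemma settle_arith:
  fixes B :: nat
  assumes "T' + B * a' \<le> B * (a0 + 2 * h) + 4" "T + 40 \<le> B" "c' + h \<le> c" "a0 + 1 = a"
  shows "T + T' + 36 + B * (a' + 2 * c') \<le> B * (a + 2 * c)"
proof -
  have "B * (c' + h) \<le> B * c" using assms(3) by (rule mult_le_mono2)
  then show ?thesis using assms(1,2) unfolding assms(4)[symmetric] by (simp add: algebra_simps)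
qed

text \<open>Removing \<open>u\<close> from the queue releases one unit, which pays for the work
  outside the scan; the spare 10 cover the loop test of \<open>settle_all\<close>.\<close>

lemma wp_settle_min:
  assumes inp: "input_ok s" and q: "queue_ok s A"
    and sc: "scanned arc_value (iarrs s F) (iarrs s X) (rarrs s D) A"
    and cnt: "ivars s ''cnt'' = card {v. iarrs s F v \<noteq> 0}" and ne: "iarrs s ''w'' 1 \<noteq> 0"
    and Q: "\<And>T s' A'. T + 10 + 300 * (L + 1) * (card A' + 2 * unscanned (iarrs s' F))
        \<le> 300 * (L + 1) * (card A + 2 * unscanned (iarrs s F)) \<Longrightarrow>
      input_ok s' \<Longrightarrow> queue_ok s' A' \<Longrightarrow> scanned arc_value (iarrs s' F) (iarrs s' X) (rarrs s' D) A' \<Longrightarrow>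
      ivars s' ''cnt'' = card {v. iarrs s' F v \<noteq> 0} \<Longrightarrow> Q T s'"
  shows "wp W (settle_min P D F X) s Q"
proof -
  define u where "u = iarrs s ''w'' 1 - 1"
  define k where "k = Suc (card {v. iarrs s F v \<noteq> 0})"
  define h where "h = iarrs s ''head'' u"
  have gs: "graph_store s" and adj: "adjacency (2 * m) (iarrs s ''head'') (iarrs s ''link'') (iarrs s ''tgt'')"
    using inp by (auto simp: input_ok_def adjacency_store_def)
  have lab: "labelling arc_value (iarrs s F) (iarrs s X) (rarrs s D) A"
    using sc by (simp add: scanned_def)
  have u: "u \<in> A" "\<forall>v\<in>A. rarrs s D u \<le> rarrs s D v"
    using tournament_root(2)[OF q[unfolded queue_ok_def]] ne t_less by (auto simp: u_def)
  have un: "u < n" and Fu: "iarrs s F u = 0" using u lab by (auto simp: labelling_def)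
  have h: "h \<le> 2 * m" "h \<noteq> 0 \<longrightarrow> h \<in> arcs \<and> arc_src h = u"
    and hmax: "\<And>a'. a' \<in> arcs \<Longrightarrow> arc_src a' = u \<Longrightarrow> a' \<le> h"
    using adj by (auto simp: adjacency_def h_def arcs_def)
  note st = settle[OF sc u(1) u(2)[rule_format] hmax k_def]
  have "labelling arc_value ((iarrs s F)(u := k)) (iarrs s X) (rarrs s D) (A - {u})"
    using st(1) unfolding scanning_def by blast
  from card_settled_le[OF this] have k: "k \<le> n" by (simp only: st(2))
  have k0: "k \<noteq> 0" by (simp add: k_def)
  have nm: "F \<noteq> X" "F \<noteq> ''w''" "X \<noteq> ''w''" "F \<noteq> ''head''" "F \<noteq> ''link''" "F \<noteq> ''tgt''" "F \<noteq> ''src''"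
    "F \<noteq> ''dst''" "F \<noteq> ''cov''"
    and pn: "P \<noteq> F" "P \<noteq> ''w''"
    using names by auto
  have N: "ivars s ''N'' = N" using gs by (simp add: graph_store_def)
  have cA: "card (A - {u}) + 1 = card A"
    using u(1) tournament_finite q card_Suc_Diff1[of A u] by (auto simp: queue_ok_def)
  have uns: "unscanned ((iarrs s F)(u := k)) + arcs_upto u h \<le> unscanned (iarrs s F)"
    using unscanned_settle[of "iarrs s F" u k h] Fu k0 by blast
  have bounds: "u \<le> W" "k \<le> W" "h \<le> W" using W un k h(1) by auto
  have eqs: "iarrs s ''w'' (Suc 0) - Suc 0 = u" "Suc (ivars s ''cnt'') = k"
    using cnt by (auto simp: u_def k_def)
  note sym = eqs bounds nm nm[symmetric] pn N h_def[symmetric]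
  have fin: "Q T'' s'"
    if "T \<le> 101 + 100 * L" "T' + 300 * (L + 1) * card A' \<le> 300 * (L + 1) * (card (A - {u}) + 2 * arcs_upto u h) + 4"
      "input_ok s'" "queue_ok s' A'" "scanned arc_value (iarrs s' F) (iarrs s' X) (rarrs s' D) A'"
      "iarrs s' F = (iarrs s F)(u := k)" "ivars s' ''cnt'' = k" "T'' \<le> T + T' + 26"
    for T T' A' s' T''
  proof (rule Q[where A' = A'])
    have "T + 40 \<le> 300 * (L + 1)" using that(1) by simp
    from settle_arith[OF that(2) this uns cA] that(6,8)
    show "T'' + 10 + 300 * (L + 1) * (card A' + 2 * unscanned (iarrs s' F))
        \<le> 300 * (L + 1) * (card A + 2 * unscanned (iarrs s F))"
      by (simp only:)
    show "ivars s' ''cnt'' = card {v. iarrs s' F v \<noteq> 0}"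
      using st(2) that(6,7) by (simp only:)
  qed (fact that(3-5))+
  show ?thesis
    unfolding settle_min_def
    apply (simp add: sym)
    apply (rule wp_set_leaf[where A = A and B = "A - {u}" and j = u and N = N and L = L and k = "rarrs s D"])
    using q un L W
    apply (simp_all add: sym queue_ok_def)
    apply (rule wp_scan_arcs[where A = "A - {u}" and u = u])
    subgoal by (rule input_ok_cong[OF inp]) (simp_all add: sym)
    subgoal by (simp add: sym queue_ok_def)
    subgoal by (simp add: sym st(1))
    subgoal by simp
    subgoal by (simp add: h(2))
    subgoal for T w T' s' A' by (rule fin[of T T' A' s']) (simp_all add: sym)
    done
qed

lemma wp_settle_all:
  assumes "input_ok s" "queue_ok s A" "scanned arc_value (iarrs s F) (iarrs s X) (rarrs s D) A"
    and "ivars s ''cnt'' = card {v. iarrs s F v \<noteq> 0}"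
    and Q: "\<And>T s'. T \<le> 300 * (L + 1) * (card A + 2 * unscanned (iarrs s F)) + 10 \<Longrightarrow>
      input_ok s' \<Longrightarrow> queue_ok s' {} \<Longrightarrow> scanned arc_value (iarrs s' F) (iarrs s' X) (rarrs s' D) {} \<Longrightarrow> Q T s'"
  shows "wp W (settle_all P D F X) s Q"
proof -
  define I where "I k s' \<longleftrightarrow> (\<exists>A. input_ok s' \<and> queue_ok s' A \<and>
    scanned arc_value (iarrs s' F) (iarrs s' X) (rarrs s' D) A \<and>
    ivars s' ''cnt'' = card {v. iarrs s' F v \<noteq> 0} \<and>
    k = 300 * (L + 1) * (card A + 2 * unscanned (iarrs s' F)))" for k s'
  show ?thesis
    unfolding settle_all_def
  proof (rule wp_While[where I = I and k = "300 * (L + 1) * (card A + 2 * unscanned (iarrs s F))"], goal_cases)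
    case 1
    show ?case unfolding I_def using assms(1-4) by blast
  next
    case (2 k s')
    from 2(1)[unfolded I_def] obtain A where A: "input_ok s'" "queue_ok s' A"
      "scanned arc_value (iarrs s' F) (iarrs s' X) (rarrs s' D) A"
      "ivars s' ''cnt'' = card {v. iarrs s' F v \<noteq> 0}"
      "k = 300 * (L + 1) * (card A + 2 * unscanned (iarrs s' F))" by blast
    have ne: "iarrs s' ''w'' 1 \<noteq> 0" using 2(2) by simp
    show ?case
    proof (rule wp_settle_min[OF A(1-4) ne], goal_cases)
      case (1 T s'' A')
      then show ?case unfolding I_def A(5)
        by (intro exI[of _ "300 * (L + 1) * (card A' + 2 * unscanned (iarrs s'' F))"] conjI
            exI[of _ A']) simp_all
    qed
  next
    case (3 k' s' T)
    from 3(1)[unfolded I_def] obtain A where A: "input_ok s'" "queue_ok s' A"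
      "scanned arc_value (iarrs s' F) (iarrs s' X) (rarrs s' D) A" by blast
    have "A = {}" using 3(2) tournament_root(1)[OF A(2)[unfolded queue_ok_def]] t_less by simp
    then show ?case using A 3(3) by (intro Q) auto
  qed
qed

text \<open>Of the \<open>4 * m + 2\<close> units, \<open>4 * m\<close> belong to at most
  \<open>2 * m\<close> arcs, one to the queued \<open>t\<close>, and one to its insertion and the
  overhead.\<close>

lemma wp_dijkstra:
  assumes inp: "input_ok s" and D: "rarrs s D t = 0" and F: "iarrs s F = (\<lambda>_. 0)" and X: "iarrs s X = (\<lambda>_. 0)"
    and q: "tournament N {} k (iarrs s ''w'')"
    and Q: "\<And>T s'. T \<le> 300 * (L + 1) * (4 * m + 2) \<Longrightarrow>
      input_ok s' \<Longrightarrow> queue_ok s' {} \<Longrightarrow> scanned arc_value (iarrs s' F) (iarrs s' X) (rarrs s' D) {} \<Longrightarrow> Q T s'"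
  shows "wp W (dijkstra P D F X) s Q"
proof -
  have q': "tournament N {} (rarrs s D) (iarrs s ''w'')" using q by (rule tournament_empty_cong)
  have gs: "ivars s ''N'' = N" "ivars s ''t'' = t"
    using inp by (auto simp: input_ok_def adjacency_store_def graph_store_def)
  have nm: "F \<noteq> ''w''" "X \<noteq> ''w''" and pn: "P \<noteq> ''w''"
    using names by auto
  have tW: "t < W" "t < N" using t_less W by auto
  have fin: "Q T'' s'"
    if "T' \<le> 300 * (L + 1) * (1 + 2 * unscanned (\<lambda>_. 0)) + 10" "T \<le> 100 * L + 103" "T'' \<le> T + T' + 10"
      "input_ok s'" "queue_ok s' {}" "scanned arc_value (iarrs s' F) (iarrs s' X) (rarrs s' D) {}"
    for T T' T'' s'
  proof (rule Q)
    have "300 * (L + 1) * (1 + 2 * unscanned (\<lambda>_. 0)) \<le> 300 * (L + 1) * (1 + 4 * m)"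
      using unscanned_le[of "\<lambda>_. 0"] by (intro mult_le_mono2) simp
    then show "T'' \<le> 300 * (L + 1) * (4 * m + 2)" using that(1-3) by (simp add: algebra_simps)
  qed (fact that(4-6))+
  show ?thesis
    unfolding dijkstra_def
    apply (simp add: gs)
    apply (rule wp_set_leaf[where A = "{}" and B = "{t}" and j = t and N = N and L = L and k = "rarrs s D"])
    using q' L W tW
    apply (simp_all add: gs)
    apply (rule wp_settle_all[where A = "{t}"])
    subgoal by (rule input_ok_cong[OF inp]) (simp_all add: nm pn)
    subgoal by (simp add: queue_ok_def)
    subgoal using labelling_init[where D = "rarrs s D"] D by (simp add: nm F X scanned_def)
    subgoal by (simp add: nm F)
    subgoal for T w T' s' by (rule fin[of T' T]) (simp_all add: nm F)
    done
qed

end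

section \<open>Union by rank\<close>

text \<open>\<open>rt\<close> is a ghost function giving the root. Ranks increase along
  \<open>up\<close>, so they bound the length of a search; the class size bounds the ranks
  logarithmically.\<close>

definition union_find ::
    "'a set \<Rightarrow> ('a \<Rightarrow> 'a option) \<Rightarrow> ('a \<Rightarrow> nat) \<Rightarrow> ('a \<Rightarrow> 'a) \<Rightarrow> bool" where
  "union_find R up rk rt \<longleftrightarrow> finite R \<and> (\<forall>x\<in>R. rt x \<in> R \<and> up (rt x) = None \<and> (up x = None \<longrightarrow> rt x = x) \<and>
     (\<forall>p. up x = Some p \<longrightarrow> p \<in> R \<and> rt p = rt x \<and> rk x < rk p) \<and>
     2 ^ rk x \<le> card {z \<in> R. rt z = rt x})"

lemma union_find_init: "finite R \<Longrightarrow> union_find R (\<lambda>_. None) (\<lambda>_. 0) (\<lambda>x. x)"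
  by (auto simp: union_find_def Suc_le_eq card_gt_0_iff)

lemma union_find_root: "union_find R up rk rt \<Longrightarrow> x \<in> R \<Longrightarrow> rt (rt x) = rt x"
  unfolding union_find_def by blast

lemma union_find_rank: "union_find R up rk rt \<Longrightarrow> x \<in> R \<Longrightarrow> 2 ^ rk x \<le> card R"
proof -
  assume uf: "union_find R up rk rt" and x: "x \<in> R"
  have "2 ^ rk x \<le> card {z \<in> R. rt z = rt x}" using uf x by (simp add: union_find_def)
  also have "\<dots> \<le> card R" using uf by (intro card_mono) (auto simp: union_find_def)
  finally show ?thesis .
qed

text \<open>A rank grows only if both roots have equal rank; then each class has at least
  \<open>2 ^ rk a\<close> elements, and their union twice as many.\<close>

lemma union_find_union:
  assumes uf: "union_find R up rk rt" and ab: "a \<in> R" "b \<in> R" "rt a = a" "rt b = b" "a \<noteq> b"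
    and rk: "rk a \<le> rk b"
  shows "union_find R (up(a := Some b)) (rk(b := if rk a = rk b then Suc (rk b) else rk b))
    (\<lambda>z. if rt z = a then b else rt z)"
proof -
  have fin: "finite R" using uf by (simp add: union_find_def)
  have r: "rt x \<in> R" "up (rt x) = None" "up x = None \<Longrightarrow> rt x = x"
    "up x = Some p \<Longrightarrow> p \<in> R \<and> rt p = rt x \<and> rk x < rk p" "2 ^ rk x \<le> card {z \<in> R. rt z = rt x}"
    if "x \<in> R" for x p
    using uf that by (auto simp: union_find_def)
  define rt' where "rt' z = (if rt z = a then b else rt z)" for z
  define rk' where "rk' = rk(b := if rk a = rk b then Suc (rk b) else rk b)"
  have mono: "rk x \<le> rk' x" for x by (simp add: rk'_def)
  have upb: "up b = None" using r(2)[OF ab(2)] ab(4) by simp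
  have merged: "card {z \<in> R. rt' z = b} = card {z \<in> R. rt z = a} + card {z \<in> R. rt z = b}"
  proof -
    have "{z \<in> R. rt' z = b} = {z \<in> R. rt z = a} \<union> {z \<in> R. rt z = b}" by (auto simp: rt'_def)
    then show ?thesis using fin ab(5) by (simp add: card_Un_disjoint disjoint_iff)
  qed
  have "union_find R (up(a := Some b)) rk' rt'"
    unfolding union_find_def
  proof (intro conjI ballI allI impI fin)
    fix x assume x: "x \<in> R"
    show "rt' x \<in> R" using r[OF x] ab by (simp add: rt'_def)
    show "(up(a := Some b)) (rt' x) = None" using r[OF x] ab upb by (auto simp: rt'_def)
    show "rt' x = x" if "(up(a := Some b)) x = None"
      using that r(3)[OF x] by (auto simp: rt'_def split: if_splits)
    show "2 ^ rk' x \<le> card {z \<in> R. rt' z = rt' x}"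
    proof (cases "rt' x = b")
      case True
      show ?thesis
      proof (cases "x = b")
        case True
        then show ?thesis
          using \<open>rt' x = b\<close> merged r(5)[OF ab(1)] r(5)[OF ab(2)] ab by (auto simp: rk'_def)
      next
        case False
        then have "2 ^ rk' x \<le> card {z \<in> R. rt z = rt x}" using r(5)[OF x] by (simp add: rk'_def)
        also have "\<dots> \<le> card {z \<in> R. rt' z = rt' x}"
          using fin by (intro card_mono) (auto simp: rt'_def)
        finally show ?thesis .
      qed
    next
      case False
      then have "rt x \<noteq> a" "rt x \<noteq> b" "x \<noteq> b" using ab by (auto simp: rt'_def)
      then have "{z \<in> R. rt' z = rt' x} = {z \<in> R. rt z = rt x}" "rk' x = rk x"
        by (auto simp: rt'_def rk'_def)
      then show ?thesis using r(5)[OF x] by simp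
    qed
    fix p assume p: "(up(a := Some b)) x = Some p"
    show "p \<in> R" "rt' p = rt' x" "rk' x < rk' p"
    proof -
      have "p \<in> R \<and> rt' p = rt' x \<and> rk' x < rk' p"
      proof (cases "x = a")
        case True
        then show ?thesis using p ab rk by (auto simp: rt'_def rk'_def)
      next
        case False
        then have *: "p \<in> R \<and> rt p = rt x \<and> rk x < rk p" using p r(4)[OF x] by simp
        moreover have "x \<noteq> b" using False p upb by auto
        ultimately show ?thesis using mono[of p] by (auto simp: rt'_def rk'_def)
      qed
      then show "p \<in> R" "rt' p = rt' x" "rk' x < rk' p" by auto
    qed
  qed
  then show ?thesis unfolding rt'_def rk'_def .
qed

section \<open>Covering tree edges in the order of their detours\<close>

context shortest_path_tree
begin

text \<open>The term \<open>- D v\<close> is left out on purpose: what remains depends on the edge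
  alone, so one order of the edges is right for all \<open>v\<close> at once.\<close>

definition detour_length :: "'a \<Rightarrow> 'a \<Rightarrow> real" where
  "detour_length x y = D x + l {x, y} + D y"

text \<open>A vertex \<open>v\<close> is covered once the replacement distance for the edge to its parent is known. The
  vertices with the same \<open>rt\<close> are those with the same closest uncovered ancestor-or-self, which is
  recorded as \<open>tp\<close> of their common root.\<close>

definition cover_state :: "('a \<Rightarrow> nat) \<Rightarrow> ('a \<Rightarrow> 'a) \<Rightarrow> ('a \<Rightarrow> 'a) \<Rightarrow> bool" where
  "cover_state cv rt tp \<longleftrightarrow> (\<forall>z\<in>R. tp (rt z) \<in> R \<and> cv (tp (rt z)) = 0 \<and>
     desc (tp (rt z)) z \<and> rt (tp (rt z)) = rt z \<and>
     (\<forall>v. desc v z \<longrightarrow> \<not> desc v (tp (rt z)) \<longrightarrow> cv v \<noteq> 0))"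

definition cover_values :: "('a \<Rightarrow> nat) \<Rightarrow> ('a \<Rightarrow> real) \<Rightarrow> bool" where
  "cover_values cv rr \<longleftrightarrow> (\<forall>v. cv v \<noteq> 0 \<longrightarrow> v \<in> R \<and> v \<noteq> t \<and> (\<exists>x y. detour v x y \<and>
     rr v = detour_length x y - D v \<and> (\<forall>x' y'. detour v x' y' \<longrightarrow> detour_length x y \<le> detour_length x' y')))"

text \<open>\<open>A\<close> are the edges not yet finished. For \<open>A = {}\<close> an uncovered
  vertex has no detour, so the edge to its parent is a bridge.\<close>

definition cover_pending :: "('a \<Rightarrow> nat) \<Rightarrow> 'a set set \<Rightarrow> bool" where
  "cover_pending cv A \<longleftrightarrow> (\<forall>v\<in>R. cv v = 0 \<longrightarrow> v \<noteq> t \<longrightarrow> (\<forall>x y. detour v x y \<longrightarrow> {x, y} \<in> A))"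

lemma cover_state_init: "cover_state (\<lambda>_. 0) (\<lambda>x. x) (\<lambda>x. x)"
  by (auto simp: cover_state_def intro: desc_refl)

lemma desc_root: "x \<in> R \<Longrightarrow> desc t x"
  by (induction rule: ord_induct) (auto intro: desc.intros t_in)

text \<open>All vertices between \<open>z\<close> and the top of its class, excluding the top, are
  covered. An uncovered \<open>v\<close> is therefore above \<open>z\<close> iff it is above that
  top, which is common to the class.\<close>

lemma cover_state_desc:
  assumes "cover_state cv rt tp" "x \<in> R" "y \<in> R" "rt x = rt y" "cv v = 0"
  shows "desc v x \<longleftrightarrow> desc v y"
proof -
  have "desc v z \<longleftrightarrow> desc v (tp (rt z))" if "z \<in> R" for z
    using assms(1,5) that desc_trans unfolding cover_state_def by blast
  then show ?thesis using assms by metis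
qed

lemma nontree_sym: "nontree x y \<Longrightarrow> nontree y x"
  unfolding nontree_def by (simp add: insert_commute)

lemma detour_length_sym: "detour_length x y = detour_length y x"
  by (simp add: detour_length_def insert_commute)

text \<open>Were the top of \<open>x\<close> above \<open>y\<close>, it would, being uncovered, be
  above the top of \<open>y\<close>. By the choice of the larger \<open>ord\<close> the tops would
  coincide, and so would the classes.\<close>

lemma cover_top_crossing:
  assumes cs: "cover_state cv rt tp" and xy: "x \<in> R" "y \<in> R" "rt x \<noteq> rt y"
    and ord: "ord (tp (rt y)) \<le> ord (tp (rt x))"
  shows "desc (tp (rt x)) x" "\<not> desc (tp (rt x)) y" "tp (rt x) \<noteq> t"
proof -
  define a where "a = tp (rt x)"
  have a: "a \<in> R" "cv a = 0" "desc a x" "rt a = rt x" using cs xy by (auto simp: cover_state_def a_def)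
  have b: "tp (rt y) \<in> R" "rt (tp (rt y)) = rt y" using cs xy by (auto simp: cover_state_def)
  have "\<not> desc a (tp (rt y))" using desc_ord[of a "tp (rt y)"] ord a b xy a_def by auto
  then have n: "\<not> desc a y" using cs xy(2) a(2) unfolding cover_state_def by blast
  then show "desc (tp (rt x)) x" "\<not> desc (tp (rt x)) y" "tp (rt x) \<noteq> t"
    using a desc_root[OF xy(2)] by (auto simp: a_def)
qed

text \<open>Covering \<open>a\<close> merges its class with that of its parent, whose top becomes
  the common top. The new root \<open>c\<close> is left open, because union by rank may choose
  either one.\<close>

lemma cover_step:
  assumes cs: "cover_state cv rt tp" and x: "x \<in> R" "rt x = x" and a: "a = tp x" "a \<noteq> t"
    and z: "z = rt (par a)"
    and rt': "\<And>w. rt' w = (if rt w = x \<or> rt w = z then c else rt w)" and c: "c = x \<or> c = z"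
    and tp': "tp' c = tp z" "\<And>w. w \<noteq> x \<Longrightarrow> w \<noteq> z \<Longrightarrow> tp' w = tp w"
  shows "cover_state (cv(a := 1)) rt' tp'" and "z \<noteq> x"
proof -
  note cs' = cs[unfolded cover_state_def, rule_format]
  have aR: "a \<in> R" "cv a = 0" "desc a x" "rt a = x" using cs'[OF x(1)] x a by auto
  have q: "par a \<in> R" "ord (par a) < ord a" using tree[OF aR(1) a(2)] by auto
  define b where "b = tp z"
  have b: "b \<in> R" "cv b = 0" "desc b (par a)" "rt b = z" using cs'[OF q(1)] by (auto simp: b_def z)
  have ob: "ord b < ord a" using desc_ord[OF b(3)] q(2) by auto
  then have ba: "b \<noteq> a" by auto
  show zx: "z \<noteq> x" using ba a(1) by (auto simp: b_def)
  have bda: "desc b a" using desc_step[OF aR(1) a(2) b(3)] .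
  show "cover_state (cv(a := 1)) rt' tp'"
    unfolding cover_state_def
  proof (rule ballI)
    fix w assume w: "w \<in> R"
    note csw = cs'[OF w]
    consider (x) "rt w = x" | (z) "rt w = z" "rt w \<noteq> x" | (other) "rt w \<noteq> x" "rt w \<noteq> z" by auto
    then show "tp' (rt' w) \<in> R \<and> (cv(a := 1)) (tp' (rt' w)) = 0 \<and> desc (tp' (rt' w)) w \<and>
        rt' (tp' (rt' w)) = rt' w \<and> (\<forall>v. desc v w \<longrightarrow> \<not> desc v (tp' (rt' w)) \<longrightarrow> (cv(a := 1)) v \<noteq> 0)"
    proof cases
      case x
      then have t: "rt' w = c" "tp' c = b" "rt' b = c" using b by (auto simp: rt' tp' b_def)
      have aw: "desc a w" using csw x a by simp
      have "(cv(a := 1)) v \<noteq> 0" if v: "desc v w" "\<not> desc v b" for v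
      proof (cases "desc v a")
        case False
        then show ?thesis using csw v x a by auto
      next
        case True
        then have "v = a \<or> desc v (par a)" using desc_iff[OF aR(1) a(2)] by simp
        then show ?thesis using cs'[OF q(1)] v(2) by (auto simp: b_def z)
      qed
      then show ?thesis using b ba desc_trans[OF bda aw] unfolding t by auto
    next
      case z
      then have t: "rt' w = c" "tp' c = b" "rt' b = c" using b by (auto simp: rt' tp' b_def)
      have "desc b w" "\<forall>v. desc v w \<longrightarrow> \<not> desc v b \<longrightarrow> cv v \<noteq> 0" using csw z by (simp_all add: b_def)
      then show ?thesis unfolding t using b ba by auto
    next
      case other
      then have t: "rt' w = rt w" "tp' (rt w) = tp (rt w)" by (auto simp: rt' tp')
      have "tp (rt w) \<noteq> a" using csw other aR by auto
      then show ?thesis unfolding t using csw other by (auto simp: rt')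
    qed
  qed
qed

text \<open>The greedy argument: all detours of an uncovered \<open>a\<close> are still pending, so
  a pending edge of minimal length that crosses its subtree is an optimal detour.\<close>

lemma cover_values_step:
  assumes cv: "cover_values cv rr" and p: "cover_pending cv A"
    and a: "a \<in> R" "a \<noteq> t" "cv a = 0"
    and e: "nontree x y" "x \<in> R" "y \<in> R" "desc a x \<noteq> desc a y"
    and min: "\<And>x' y'. {x', y'} \<in> A \<Longrightarrow> detour_length x y \<le> detour_length x' y'"
  shows "cover_values (cv(a := 1)) (rr(a := detour_length x y - D a))"
proof -
  obtain x1 y1 where 1: "detour a x1 y1" "detour_length x1 y1 = detour_length x y"
  proof (cases "desc a x")
    case True
    then show ?thesis using e by (intro that[of x y]) (auto simp: detour_def)
  next
    case False
    then have "detour a y x" using e nontree_sym by (auto simp: detour_def)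
    then show ?thesis using that detour_length_sym by blast
  qed
  have 2: "detour_length x y \<le> detour_length x' y'" if "detour a x' y'" for x' y'
    using p a that min by (auto simp: cover_pending_def)
  show ?thesis
    unfolding cover_values_def
  proof (intro allI impI)
    fix v assume v: "(cv(a := 1)) v \<noteq> 0"
    show "v \<in> R \<and> v \<noteq> t \<and> (\<exists>x1 y1. detour v x1 y1 \<and>
        (rr(a := detour_length x y - D a)) v = detour_length x1 y1 - D v \<and>
        (\<forall>x' y'. detour v x' y' \<longrightarrow> detour_length x1 y1 \<le> detour_length x' y'))"
    proof (cases "v = a")
      case True
      then show ?thesis using a 1 2 by simp (metis 1(1))
    next
      case False
      then show ?thesis using v cv by (simp add: cover_values_def)
    qed
  qed
qed

lemma cover_pending_mono: "cover_pending cv A \<Longrightarrow> cv v = 0 \<Longrightarrow> cover_pending (cv(v := Suc k)) A"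
  by (auto simp: cover_pending_def)

text \<open>Once both ends are in one class, an uncovered subtree contains both or neither, so the
  edge is a detour for no remaining vertex.\<close>

lemma cover_pending_done:
  assumes p: "cover_pending cv A" and cs: "cover_state cv rt tp"
    and e: "x \<in> R" "y \<in> R" "rt x = rt y"
  shows "cover_pending cv (A - {{x, y}})"
  unfolding cover_pending_def
proof (intro ballI allI impI)
  fix v x' y' assume v: "v \<in> R" "cv v = 0" "v \<noteq> t" "detour v x' y'"
  then have "desc v x' \<noteq> desc v y'" by (auto simp: detour_def)
  moreover have "desc v x \<longleftrightarrow> desc v y" using cover_state_desc[OF cs e v(2)] .
  ultimately show "{x', y'} \<in> A - {{x, y}}"
    using p v by (auto simp: cover_pending_def doubleton_eq_iff)
qed

lemma rep_parent_eq:
  assumes cv: "cover_values cv rr" and p: "cover_pending cv {}" and v: "v \<in> R" "v \<noteq> t"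
  shows "rep v (par v) = (if cv v = 0 then \<infinity> else ereal (rr v))"
proof (cases "cv v = 0")
  case True
  then have "\<not> detour v x y" for x y using p v by (auto simp: cover_pending_def)
  \<comment> \<open>Without any detour the hypothesis on \<open>K\<close> is vacuous, so
    \<open>K\<close> may be infinite.\<close>
  then have "\<infinity> - ereal (D v) \<le> rep v (par v)" by (intro rep_parent_ge v) auto
  then show ?thesis using True by simp
next
  case False
  then obtain x y where xy: "detour v x y" "rr v = detour_length x y - D v"
    "\<And>x' y'. detour v x' y' \<Longrightarrow> detour_length x y \<le> detour_length x' y'"
    using cv unfolding cover_values_def by blast
  have "ereal (detour_length x y) - ereal (D v) \<le> rep v (par v)"
    using xy(3) by (intro rep_parent_ge v) (auto simp: detour_length_def)
  moreover have "rep v (par v) \<le> ereal (D x + l {x, y} + D y - D v)"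
    using rep_parent_le[OF v xy(1)] .
  ultimately show ?thesis using False xy(2) by (simp add: detour_length_def antisym)
qed

end

section \<open>Programs for union-find and for covering tree edges\<close>

definition ptr :: "('a \<Rightarrow> nat) \<Rightarrow> 'a \<Rightarrow> nat option" where
  "ptr h x = (if h x = 0 then None else Some (h x - 1))"

lemma ptr_upd [simp]: "ptr (h(x := Suc y)) = (ptr h)(x := Some y)"
  by (auto simp: ptr_def)

text \<open>A null pointer in the array of tops stands for the vertex itself.\<close>

definition top_of :: "(nat \<Rightarrow> nat) \<Rightarrow> nat \<Rightarrow> nat" where
  "top_of h x = (if h x = 0 then x else h x - 1)"

definition find_root :: "vname \<Rightarrow> com" where
  "find_root v = While (ILess (IConst 0) (IArr ''up'' (IVar v)))
     (IAssign v (IMinus (IArr ''up'' (IVar v)) (IConst 1)))"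

definition get_top :: "vname \<Rightarrow> vname \<Rightarrow> com" where
  "get_top v a = If (ILess (IConst 0) (IArr ''top'' (IVar v)))
     (IAssign a (IMinus (IArr ''top'' (IVar v)) (IConst 1))) (IAssign a (IVar v))"

text \<open>\<open>z\<close> is the root of the upper class and \<open>b\<close> its top. If
  \<open>z\<close> stays root its top is already right; only if \<open>x\<close> becomes the root
  must \<open>b\<close> be stored.\<close>

definition unite :: com where
  "unite = If (ILess (IArr ''rank'' (IVar ''x'')) (IArr ''rank'' (IVar ''z'')))
     (IStore ''up'' (IVar ''x'') (IPlus (IVar ''z'') (IConst 1)))
     (Seq (IStore ''up'' (IVar ''z'') (IPlus (IVar ''x'') (IConst 1)))
     (Seq (If (IEq (IArr ''rank'' (IVar ''z'')) (IArr ''rank'' (IVar ''x'')))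
            (IStore ''rank'' (IVar ''x'') (IPlus (IArr ''rank'' (IVar ''x'')) (IConst 1))) Skip)
          (IStore ''top'' (IVar ''x'') (IPlus (IVar ''b'') (IConst 1)))))"

text \<open>Of the two tops, the one settled later is not an ancestor of the other one, so the edge to its
  parent is bypassed by the current edge.\<close>

definition pick_top :: com where
  "pick_top = Seq (get_top ''x'' ''a'') (Seq (get_top ''y'' ''b'')
     (If (ILess (IArr ''f'' (IVar ''a'')) (IArr ''f'' (IVar ''b'')))
       (Seq (IAssign ''a'' (IVar ''b'')) (Seq (IAssign ''z'' (IVar ''x''))
         (Seq (IAssign ''x'' (IVar ''y'')) (IAssign ''y'' (IVar ''z''))))) Skip))"

definition cover_top :: com where
  "cover_top =
     Seq (RStore ''r'' (IVar ''a'') (RMinus (RArr ''key'' (IVar ''e'')) (RArr ''d'' (IVar ''a''))))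
    (Seq (IStore ''cov'' (IVar ''a'') (IConst 1))
    (Seq (IAssign ''z'' (IMinus (IArr ''p'' (IVar ''a'')) (IConst 1)))
    (Seq (find_root ''z'') (get_top ''z'' ''b''))))"

definition cover_next :: com where
  "cover_next = Seq pick_top (Seq cover_top (Seq unite (Seq (find_root ''x'') (find_root ''y''))))"

definition cover_path :: com where
  "cover_path =
     Seq (IAssign ''x'' (IArr ''src'' (IVar ''e'')))
    (Seq (IAssign ''y'' (IArr ''dst'' (IVar ''e'')))
    (Seq (find_root ''x'')
    (Seq (find_root ''y'')
         (While (BNot (IEq (IVar ''x'') (IVar ''y''))) cover_next))))"

definition cover_min :: com where
  "cover_min =
     Seq (IAssign ''e'' (IMinus (IArr ''w'' (IConst 1)) (IConst 1)))
    (Seq (set_leaf ''key'' ''e'' (IConst 0)) cover_path)"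

definition cover_all :: com where
  "cover_all = While (ILess (IConst 0) (IArr ''w'' (IConst 1))) cover_min"

text \<open>The test of one end decides reachability of both, as \<open>R\<close> is closed under
  edges.\<close>

definition queue_edge :: com where
  "queue_edge =
     Seq (IAssign ''x'' (IArr ''src'' (IVar ''k'')))
    (Seq (IAssign ''y'' (IArr ''dst'' (IVar ''k'')))
    (Seq (If (BAnd (ILess (IConst 0) (IArr ''f'' (IVar ''x'')))
            (BAnd (BNot (IEq (IArr ''p'' (IVar ''x'')) (IPlus (IVar ''y'') (IConst 1))))
                  (BNot (IEq (IArr ''p'' (IVar ''y'')) (IPlus (IVar ''x'') (IConst 1))))))
          (Seq (RStore ''key'' (IVar ''k'') (RPlus (RPlus (RArr ''d'' (IVar ''x'')) (RArr ''weight'' (IVar ''k'')))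
                 (RArr ''d'' (IVar ''y''))))
               (set_leaf ''key'' ''k'' (IPlus (IVar ''k'') (IConst 1))))
          Skip)
         (IAssign ''k'' (IPlus (IVar ''k'') (IConst 1)))))"

definition queue_edges :: com where
  "queue_edges = Seq (IAssign ''k'' (IConst 0)) (While (ILess (IVar ''k'') (IVar ''m'')) queue_edge)"

section \<open>Verification of the covering phase\<close>

locale cover_run = orp_instance +
  fixes R :: "nat set" and pa f :: "nat \<Rightarrow> nat" and d :: "nat \<Rightarrow> real"
  assumes spt: "shortest_path_tree E l t R (\<lambda>v. pa v - 1) f d"
    and R_iff: "v \<in> R \<longleftrightarrow> f v \<noteq> 0"
    and pa_t: "pa t = 0" and pa_pos: "v \<in> R \<Longrightarrow> v \<noteq> t \<Longrightarrow> pa v \<noteq> 0"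
    and f_less: "v \<in> R \<Longrightarrow> v < n"
begin

sublocale T: shortest_path_tree E l t R "\<lambda>v. pa v - 1" f d
  by (rule spt)

lemma finite_R: "finite R"
  by (rule finite_subset[of _ "{..<n}"]) (auto simp: f_less)

lemma card_R_le: "card R \<le> n"
  using card_mono[of "{..<n}" R] f_less by (auto simp: subset_iff)

definition base_ok :: "store \<Rightarrow> bool" where
  "base_ok s \<longleftrightarrow> adjacency_store s \<and> iarrs s ''p'' = pa \<and> iarrs s ''f'' = f \<and> rarrs s ''d'' = d"

lemma base_ok_cong:
  assumes "base_ok s" "\<forall>x\<in>{''m'', ''t'', ''N''}. ivars s' x = ivars s x"
    "\<forall>a\<in>{''src'', ''dst'', ''head'', ''link'', ''tgt'', ''p'', ''f''}. iarrs s' a = iarrs s a"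
    "\<forall>a\<in>{''weight'', ''d''}. rarrs s' a = rarrs s a"
  shows "base_ok s'"
  using assms unfolding base_ok_def adjacency_store_def graph_store_def by simp

text \<open>The first bound lets an incremented rank fit into a word, the second one bounds searches
  by the tree depth \<open>L\<close>.\<close>

lemma rank_less:
  assumes uf: "union_find R up rk rt" and x: "x \<in> R"
  shows "rk x < n" "rk x \<le> L"
proof -
  have le: "2 ^ rk x \<le> n" using union_find_rank[OF uf x] card_R_le by simp
  then show "rk x < n" using less_exp[of "rk x"] by linarith
  have "n \<le> 2 ^ L" using L by simp
  with le have "(2::nat) ^ rk x \<le> 2 ^ L" by (rule order_trans)
  then show "rk x \<le> L" by (simp add: power_increasing_iff)
qed

text \<open>Each pointer step increases the rank, so \<open>L - rk y\<close> bounds the number of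
  remaining steps.\<close>

lemma wp_find_root:
  assumes uf: "union_find R (ptr (iarrs s ''up'')) rk rt" and x: "ivars s v \<in> R"
    and Q: "\<And>T. T \<le> 10 * (L + 1) \<Longrightarrow> Q T (s\<lparr>ivars := (ivars s)(v := rt (ivars s v))\<rparr>)"
  shows "wp W (find_root v) s Q"
proof -
  define I where "I k s' \<longleftrightarrow> (\<exists>y\<in>R. rt y = rt (ivars s v) \<and> k = 10 * (L - rk y) \<and>
    s' = s\<lparr>ivars := (ivars s)(v := y)\<rparr>)" for k s'
  show ?thesis
    unfolding find_root_def
  proof (rule wp_While[where I = I and k = "10 * (L - rk (ivars s v))"], goal_cases)
    case 1
    show ?case unfolding I_def using x by (intro bexI[of _ "ivars s v"]) auto
  next
    case (2 k s')
    then obtain y where y: "y \<in> R" "rt y = rt (ivars s v)" "k = 10 * (L - rk y)"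
      "s' = s\<lparr>ivars := (ivars s)(v := y)\<rparr>" "0 < iarrs s ''up'' y"
      by (auto simp: I_def)
    define q where "q = iarrs s ''up'' y - 1"
    have "ptr (iarrs s ''up'') y = Some q" using y(5) by (simp add: ptr_def q_def)
    then have q: "q \<in> R" "rt q = rt y" "rk y < rk q" using uf y(1) by (auto simp: union_find_def)
    have "rk q \<le> L" using rank_less[OF uf q(1)] by simp
    then have kk: "10 * (L - rk q) + 10 \<le> k" using q(3) y(3) by simp
    have qW: "q \<le> W" using q(1) f_less[of q] W by simp
    have "I (10 * (L - rk q)) (s\<lparr>ivars := (ivars s)(v := q)\<rparr>)"
      unfolding I_def using q y by auto
    then show ?case using qW kk by (auto simp: y(4) q_def)
  next
    case (3 k' s' T)
    then obtain y where y: "y \<in> R" "rt y = rt (ivars s v)"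
      "s' = s\<lparr>ivars := (ivars s)(v := y)\<rparr>" "iarrs s ''up'' y = 0"
      by (auto simp: I_def)
    have "ptr (iarrs s ''up'') y = None" using y(4) by (simp add: ptr_def)
    then have "rt y = y" using uf y(1) unfolding union_find_def by blast
    then have s': "s' = s\<lparr>ivars := (ivars s)(v := rt (ivars s v))\<rparr>" using y(2,3) by simp
    have "10 * (L - rk (ivars s v)) + 1 + bcost (ILess (IConst 0) (IArr ''up'' (IVar v))) \<le> 10 * L + 5"
      by simp
    with 3(3) have "T \<le> 10 * L + 5" by arith
    then show ?case unfolding s' by (intro Q) simp
  qed
qed

lemma wp_get_top:
  assumes "top_of (iarrs s ''top'') (ivars s v) \<le> W"
    and "\<And>T. T \<le> 20 \<Longrightarrow> Q T (s\<lparr>ivars := (ivars s)(a := top_of (iarrs s ''top'') (ivars s v))\<rparr>)"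
  shows "wp W (get_top v a) s Q"
  using assms by (cases "iarrs s ''top'' (ivars s v) = 0") (simp_all add: get_top_def top_of_def)

lemma wp_unite:
  assumes uf: "union_find R (ptr (iarrs s ''up'')) (iarrs s ''rank'') rt"
    and x: "ivars s ''x'' = x" "x \<in> R" "rt x = x" and z: "ivars s ''z'' = z" "z \<in> R" "rt z = z" "x \<noteq> z"
    and b: "ivars s ''b'' = top_of (iarrs s ''top'') z" "ivars s ''b'' < n"
    and Q: "\<And>T s' c. T \<le> 60 \<Longrightarrow> c = x \<or> c = z \<Longrightarrow>
      union_find R (ptr (iarrs s' ''up'')) (iarrs s' ''rank'') (\<lambda>w. if rt w = x \<or> rt w = z then c else rt w) \<Longrightarrow>
      top_of (iarrs s' ''top'') c = top_of (iarrs s ''top'') z \<Longrightarrow>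
      (\<And>w. w \<noteq> c \<Longrightarrow> top_of (iarrs s' ''top'') w = top_of (iarrs s ''top'') w) \<Longrightarrow>
      ivars s' = ivars s \<Longrightarrow> rarrs s' = rarrs s \<Longrightarrow>
      (\<And>h. h \<notin> {''up'', ''rank'', ''top''} \<Longrightarrow> iarrs s' h = iarrs s h) \<Longrightarrow> Q T s'"
  shows "wp W unite s Q"
proof -
  have xz: "x < n" "z < n" using x z f_less by auto
  have rk: "iarrs s ''rank'' x < n" using rank_less[OF uf x(2)] by simp
  have eq1: "(\<lambda>w. if rt w = x \<or> rt w = z then z else rt w) = (\<lambda>w. if rt w = x then z else rt w)"
    and eq2: "(\<lambda>w. if rt w = x \<or> rt w = z then x else rt w) = (\<lambda>w. if rt w = z then x else rt w)"
    by auto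
  show ?thesis
  proof (cases "iarrs s ''rank'' x < iarrs s ''rank'' z")
    case True
    have uf': "union_find R (ptr ((iarrs s ''up'')(x := Suc z))) (iarrs s ''rank'')
        (\<lambda>w. if rt w = x \<or> rt w = z then z else rt w)"
      using union_find_union[OF uf x(2) z(2) x(3) z(3,4)] True unfolding eq1 by simp
    show ?thesis
      using True xz W by (simp add: unite_def x(1) z(1)) (rule Q[of _ z]; use uf' in simp)
  next
    case False
    define rk' where "rk' = (if iarrs s ''rank'' z = iarrs s ''rank'' x
      then (iarrs s ''rank'')(x := Suc (iarrs s ''rank'' x)) else iarrs s ''rank'')"
    have uf': "union_find R (ptr ((iarrs s ''up'')(z := Suc x))) rk'
        (\<lambda>w. if rt w = x \<or> rt w = z then x else rt w)"
      using union_find_union[OF uf z(2) x(2) z(3) x(3)] z(4) False unfolding eq2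
      by (auto simp: rk'_def split: if_splits)
    show ?thesis
    proof (cases "iarrs s ''rank'' z = iarrs s ''rank'' x")
      case True
      note uf'' = uf'[unfolded rk'_def if_P[OF True]]
      show ?thesis
        using True False xz W rk b
        by (simp add: unite_def x(1) z(1)) (rule Q[of _ x]; use uf'' in \<open>simp add: top_of_def\<close>)
    next
      case neq: False
      note uf'' = uf'[unfolded rk'_def if_not_P[OF neq]]
      show ?thesis
        using neq False xz W rk b
        by (simp add: unite_def x(1) z(1)) (rule Q[of _ x]; use uf'' in \<open>simp add: top_of_def\<close>)
    qed
  qed
qed

lemma wp_pick_top:
  assumes ab: "top_of (iarrs s ''top'') (ivars s ''x'') = a" "top_of (iarrs s ''top'') (ivars s ''y'') = b"
    and W': "ivars s ''x'' \<le> W" "ivars s ''y'' \<le> W" "a \<le> W" "b \<le> W" and f: "iarrs s ''f'' = f"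
    and Q: "\<And>T s' x y. T \<le> 100 \<Longrightarrow> ivars s' ''a'' = top_of (iarrs s ''top'') x \<Longrightarrow>
      ivars s' ''x'' = x \<Longrightarrow> ivars s' ''y'' = y \<Longrightarrow> {x, y} = {ivars s ''x'', ivars s ''y''} \<Longrightarrow>
      f (top_of (iarrs s ''top'') y) \<le> f (top_of (iarrs s ''top'') x) \<Longrightarrow>
      (\<And>v. v \<notin> {''a'', ''b'', ''x'', ''y'', ''z''} \<Longrightarrow> ivars s' v = ivars s v) \<Longrightarrow>
      iarrs s' = iarrs s \<Longrightarrow> rarrs s' = rarrs s \<Longrightarrow> Q T s'"
  shows "wp W pick_top s Q"
proof (cases "f a < f b")
  case True
  show ?thesis
    unfolding pick_top_def
    apply simp
    apply (rule wp_get_top)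
    subgoal using ab W' by simp
    apply (rule wp_get_top)
    subgoal using ab W' by simp
    subgoal for T T'
      using True W' by (simp add: ab f) (rule Q[of _ _ "ivars s ''y''" "ivars s ''x''"]; simp add: ab insert_commute)
    done
next
  case False
  show ?thesis
    unfolding pick_top_def
    apply simp
    apply (rule wp_get_top)
    subgoal using ab W' by simp
    apply (rule wp_get_top)
    subgoal using ab W' by simp
    subgoal for T T'
      using False W' by (simp add: ab f) (rule Q[of _ _ "ivars s ''x''" "ivars s ''y''"]; simp add: ab)
    done
qed

lemma wp_cover_top:
  assumes uf: "union_find R (ptr (iarrs s ''up'')) rk rt" and z: "z = rt (pa a - 1)" "pa a - 1 \<in> R"
    and p: "iarrs s ''p'' = pa" and d: "rarrs s ''d'' = d"
    and a: "ivars s ''a'' = a" "a < n" and b: "top_of (iarrs s ''top'') z < n"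
    and Q: "\<And>T s'. T \<le> 10 * (L + 1) + 50 \<Longrightarrow> ivars s' ''z'' = z \<Longrightarrow>
      ivars s' ''b'' = top_of (iarrs s ''top'') z \<Longrightarrow>
      (\<And>v. v \<notin> {''b'', ''z''} \<Longrightarrow> ivars s' v = ivars s v) \<Longrightarrow>
      iarrs s' = (iarrs s)(''cov'' := (iarrs s ''cov'')(a := 1)) \<Longrightarrow>
      rarrs s' = (rarrs s)(''r'' := (rarrs s ''r'')(a := rarrs s ''key'' (ivars s ''e'') - d a)) \<Longrightarrow> Q T s'"
  shows "wp W cover_top s Q"
proof -
  have "pa a - 1 < n" using z f_less by auto
  then have W': "1 \<le> W" "a \<le> W" "pa a - Suc 0 \<le> W" "top_of (iarrs s ''top'') z \<le> W"
    using W a b by auto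
  show ?thesis
    unfolding cover_top_def
    using W'
    apply (simp add: a(1) p d)
    apply (rule wp_find_root[where rk = rk and rt = rt])
    subgoal using uf by simp
    subgoal using z(2) by simp
    apply (rule wp_get_top)
    subgoal using z(1) by simp
    subgoal for T T' using z(1) by (intro Q) simp_all
    done
qed

definition cov_ok :: "store \<Rightarrow> (nat \<Rightarrow> nat) \<Rightarrow> bool" where
  "cov_ok s rt \<longleftrightarrow> union_find R (ptr (iarrs s ''up'')) (iarrs s ''rank'') rt \<and>
     T.cover_state (iarrs s ''cov'') rt (top_of (iarrs s ''top'')) \<and>
     T.cover_values (iarrs s ''cov'') (rarrs s ''r'')"

definition nontree_edges :: "nat set" where
  "nontree_edges = {i. i < m \<and> fst (es ! i) \<in> R \<and> T.nontree (fst (es ! i)) (snd (es ! i))}"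

definition edge_key :: "nat \<Rightarrow> real" where
  "edge_key i = T.detour_length (fst (es ! i)) (snd (es ! i))"

definition keys_ok :: "store \<Rightarrow> nat set \<Rightarrow> bool" where
  "keys_ok s A \<longleftrightarrow> A \<subseteq> nontree_edges \<and> (\<forall>i\<in>A. rarrs s ''key'' i = edge_key i) \<and>
     tournament N A (rarrs s ''key'') (iarrs s ''w'')"

definition pending_ok :: "store \<Rightarrow> nat set \<Rightarrow> bool" where
  "pending_ok s A \<longleftrightarrow> T.cover_pending (iarrs s ''cov'') ((\<lambda>i. edge_of (es ! i)) ` A)"

definition uncovered :: "store \<Rightarrow> nat" where
  "uncovered s = card {v \<in> R. iarrs s ''cov'' v = 0}"

lemma nontree_edges_ends:
  assumes "i \<in> nontree_edges"
  shows "i < m" "fst (es ! i) \<in> R" "snd (es ! i) \<in> R" "T.nontree (fst (es ! i)) (snd (es ! i))"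
  using assms T.closed edge_nth by (auto simp: nontree_edges_def)

text \<open>Edge \<open>e\<close> has left the queue \<open>A\<close> but remains pending until its
  ends share a class. Only the unordered pair of roots is recorded, since \<open>pick_top\<close>
  may exchange them.\<close>

definition path_ok :: "store \<Rightarrow> nat \<Rightarrow> nat set \<Rightarrow> (nat \<Rightarrow> nat) \<Rightarrow> bool" where
  "path_ok s e A rt \<longleftrightarrow> base_ok s \<and> keys_ok s A \<and> cov_ok s rt \<and> pending_ok s (insert e A) \<and>
     ivars s ''e'' = e \<and> rarrs s ''key'' e = edge_key e \<and>
     ivars s ''x'' \<in> R \<and> ivars s ''y'' \<in> R \<and> rt (ivars s ''x'') = ivars s ''x'' \<and> rt (ivars s ''y'') = ivars s ''y'' \<and>
     {ivars s ''x'', ivars s ''y''} = {rt (fst (es ! e)), rt (snd (es ! e))}"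

lemma edge_key_le:
  assumes "e \<in> nontree_edges" "\<forall>i\<in>A. edge_key e \<le> edge_key i" "{x, y} \<in> (\<lambda>i. edge_of (es ! i)) ` insert e A"
  shows "edge_key e \<le> T.detour_length x y"
proof -
  obtain i where i: "i \<in> insert e A" "{x, y} = edge_of (es ! i)" using assms(3) by auto
  have "edge_key i = T.detour_length x y"
    using i(2) T.detour_length_sym[of x y] unfolding edge_key_def edge_of_def doubleton_eq_iff by auto
  then show ?thesis using assms(2) i(1) by auto
qed

text \<open>One pass covers exactly one new vertex, the top \<open>a\<close>, which pays for the
  pass.\<close>

lemma wp_cover_next:
  assumes p: "path_ok s e A rt" and e: "e \<in> nontree_edges" "\<forall>i\<in>A. edge_key e \<le> edge_key i"
    and ne: "ivars s ''x'' \<noteq> ivars s ''y''"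
    and Q: "\<And>T s' rt'. T \<le> 250 * (L + 1) \<Longrightarrow> path_ok s' e A rt' \<Longrightarrow> uncovered s' + 1 \<le> uncovered s \<Longrightarrow> Q T s'"
  shows "wp W cover_next s Q"
proof -
  define up where "up = iarrs s ''up''"
  define rk where "rk = iarrs s ''rank''"
  define tp where "tp = top_of (iarrs s ''top'')"
  define cv where "cv = iarrs s ''cov''"
  define rr where "rr = rarrs s ''r''"
  have uf: "union_find R (ptr up) rk rt" and cs: "T.cover_state cv rt tp" and cvals: "T.cover_values cv rr"
    using p by (auto simp: path_ok_def cov_ok_def up_def rk_def tp_def cv_def rr_def)
  have base: "base_ok s" using p by (simp add: path_ok_def)
  have pf: "iarrs s ''p'' = pa" "iarrs s ''f'' = f" "rarrs s ''d'' = d" using base by (auto simp: base_ok_def)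
  have pend: "T.cover_pending cv ((\<lambda>i. edge_of (es ! i)) ` insert e A)"
    using p by (simp add: path_ok_def pending_ok_def cv_def)
  have tpR: "tp x \<in> R" "cv (tp x) = 0" if "x \<in> R" "rt x = x" for x
    using cs that unfolding T.cover_state_def by metis+
  have lt: "v \<le> W" "v < n" if "v \<in> R" for v using f_less[OF that] W by auto
  have xyR: "ivars s ''x'' \<in> R" "ivars s ''y'' \<in> R" "rt (ivars s ''x'') = ivars s ''x''" "rt (ivars s ''y'') = ivars s ''y''"
    and xye: "{ivars s ''x'', ivars s ''y''} = {rt (fst (es ! e)), rt (snd (es ! e))}"
    using p by (auto simp: path_ok_def)
  \<comment> \<open>Stated for an abstract pair \<open>x\<close>, \<open>y\<close>, so that both
    outcomes of the exchange are treated at once.\<close>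
  have step: "wp W (Seq cover_top (Seq unite (Seq (find_root ''x'') (find_root ''y'')))) s1 (\<lambda>T'. Q (1 + T + T'))"
    if T: "T \<le> 100" and s1: "ivars s1 ''a'' = tp x" "ivars s1 ''x'' = x" "ivars s1 ''y'' = y"
      and xy: "{x, y} = {ivars s ''x'', ivars s ''y''}" and fle: "f (tp y) \<le> f (tp x)"
      and iv: "\<And>v. v \<notin> {''a'', ''b'', ''x'', ''y'', ''z''} \<Longrightarrow> ivars s1 v = ivars s v"
      and ia: "iarrs s1 = iarrs s" and ra: "rarrs s1 = rarrs s" for T s1 x y
  proof -
    have x: "x \<in> R" "rt x = x" and y: "y \<in> R" "rt y = y" and "x \<noteq> y"
      using xy xyR ne by (auto simp: doubleton_eq_iff)
    define a where "a = tp x"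
    have "a \<noteq> t" and ax: "T.desc a x" and ay: "\<not> T.desc a y"
      using T.cover_top_crossing[OF cs x(1) y(1)] fle x y \<open>x \<noteq> y\<close> by (auto simp: a_def)
    have aR: "a \<in> R" "cv a = 0" using tpR[OF x] by (auto simp: a_def)
    define q where "q = pa a - 1"
    define z where "z = rt q"
    have qR: "q \<in> R" using T.tree[OF aR(1) \<open>a \<noteq> t\<close>] by (simp add: q_def)
    have zR: "z \<in> R" using uf qR by (simp add: union_find_def z_def)
    have rz: "rt z = z" using union_find_root[OF uf qR] by (simp add: z_def)
    have bR: "tp z \<in> R" using tpR[OF zR rz] by simp
    note cstep = T.cover_step[OF cs x a_def \<open>a \<noteq> t\<close>, of z]
    have zx: "x \<noteq> z" using cstep(2)[of "\<lambda>w. if rt w = x \<or> rt w = z then x else rt w" x "tp(x := tp z)"]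
      by (auto simp: z_def q_def)
    \<comment> \<open>The uncovered \<open>a\<close> does not distinguish members of a class, so
      separation of the roots \<open>x\<close> and \<open>y\<close> carries over to the ends of the
      edge.\<close>
    have cross: "T.desc a (fst (es ! e)) \<noteq> T.desc a (snd (es ! e))"
    proof -
      have eR: "fst (es ! e) \<in> R" "snd (es ! e) \<in> R" using nontree_edges_ends[OF e(1)] by auto
      have D: "T.desc a v \<longleftrightarrow> T.desc a (rt v)" if "v \<in> R" for v
        using T.cover_state_desc[OF cs that _ _ aR(2), of "rt v"] uf that union_find_root[OF uf that]
        by (auto simp: union_find_def)
      show ?thesis using ax ay xy xye D[OF eR(1)] D[OF eR(2)] by (auto simp: doubleton_eq_iff)
    qed
    have fin: "Q T' s'"
      if "T' \<le> 250 * (L + 1)" and c: "c = x \<or> c = z"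
        and uf': "union_find R (ptr (iarrs s' ''up'')) (iarrs s' ''rank'') rt'"
        and rt': "rt' = (\<lambda>w. if rt w = x \<or> rt w = z then c else rt w)"
        and tp': "top_of (iarrs s' ''top'') c = tp z" "\<And>w. w \<noteq> c \<Longrightarrow> top_of (iarrs s' ''top'') w = tp w"
        and iv': "\<And>v. v \<notin> {''a'', ''b'', ''x'', ''y'', ''z''} \<Longrightarrow> ivars s' v = ivars s v"
          "ivars s' ''x'' = rt' x" "ivars s' ''y'' = rt' y"
        and ia': "\<And>h. h \<notin> {''up'', ''rank'', ''top'', ''cov''} \<Longrightarrow> iarrs s' h = iarrs s h"
          "iarrs s' ''cov'' = cv(a := 1)"
        and ra': "rarrs s' = (rarrs s)(''r'' := rr(a := edge_key e - d a))" for T' s' c rt'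
    proof (rule Q[OF that(1)])
      have cs': "T.cover_state (cv(a := 1)) rt' (top_of (iarrs s' ''top''))"
        using c tp' by (intro cstep(1)[where c = c]) (auto simp: z_def q_def rt')
      have "T.cover_values (cv(a := 1)) (rr(a := edge_key e - d a))"
        unfolding edge_key_def using nontree_edges_ends[OF e(1)] cross aR \<open>a \<noteq> t\<close>
        by (intro T.cover_values_step[OF cvals pend] edge_key_le[OF e, unfolded edge_key_def]) auto
      then have cov: "cov_ok s' rt'" using cs' uf' by (simp add: cov_ok_def ia' ra')
      have pend': "pending_ok s' (insert e A)"
        using T.cover_pending_mono[OF pend aR(2), of 0] by (simp add: pending_ok_def ia')
      have "rt' x \<in> R" "rt' y \<in> R" "rt' (rt' x) = rt' x" "rt' (rt' y) = rt' y"
        using uf' x y union_find_root[OF uf'] by (auto simp: union_find_def)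
      moreover have "{rt' x, rt' y} = {rt' (fst (es ! e)), rt' (snd (es ! e))}"
      proof -
        \<comment> \<open>The union acts on roots through \<open>g\<close>, so applying
          \<open>g\<close> to both unordered pairs keeps them equal.\<close>
        define g where "g r = (if r = x \<or> r = z then c else r)" for r
        have g: "rt' w = g (rt w)" for w by (simp add: rt' g_def)
        have "{x, y} = {rt (fst (es ! e)), rt (snd (es ! e))}" using xy xye by simp
        then have "g ` {x, y} = g ` {rt (fst (es ! e)), rt (snd (es ! e))}" by (rule arg_cong)
        then show ?thesis unfolding g x y by (simp only: image_insert image_empty)
      qed
      moreover have "keys_ok s' A" "ivars s' ''e'' = e" "rarrs s' ''key'' e = edge_key e"
        using p by (simp_all add: path_ok_def keys_ok_def iv' ia' ra')
      moreover have "base_ok s'" using base by (rule base_ok_cong) (simp_all add: iv' ia' ra')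
      ultimately show "path_ok s' e A rt'" using cov pend' by (simp add: path_ok_def iv'(2,3))
      have "{v \<in> R. (cv(a := 1)) v = 0} = {v \<in> R. cv v = 0} - {a}" by auto
      then have "uncovered s' = card ({v \<in> R. cv v = 0} - {a})" by (simp add: uncovered_def ia')
      moreover have "card ({v \<in> R. cv v = 0} - {a}) + 1 = card {v \<in> R. cv v = 0}"
        using aR finite_R card_Suc_Diff1[of "{v \<in> R. cv v = 0}" a] by simp
      ultimately show "uncovered s' + 1 \<le> uncovered s" by (simp add: uncovered_def cv_def)
    qed
    have key: "rarrs s ''key'' (ivars s ''e'') = edge_key e" using p by (simp add: path_ok_def)
    show ?thesis
      unfolding wp_Seq
      apply (rule wp_cover_top[where a = a and z = z and rk = rk and rt = rt])
      subgoal using uf by (simp add: ia up_def)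
      subgoal by (simp add: z_def q_def)
      subgoal using qR by (simp add: q_def)
      subgoal by (simp add: ia pf)
      subgoal by (simp add: ra pf)
      subgoal by (simp add: s1 a_def)
      subgoal using lt aR by simp
      subgoal using lt bR by (simp add: ia tp_def)
      subgoal premises prems2 for T2 s2
        apply (rule wp_unite[where x = x and z = z and rt = rt])
        subgoal using uf by (simp add: prems2 ia up_def rk_def)
        subgoal by (simp add: prems2 s1)
        subgoal by (fact x)
        subgoal by (fact x)
        subgoal by (simp add: prems2)
        subgoal by (fact zR)
        subgoal by (fact rz)
        subgoal by (fact zx)
        subgoal by (simp add: prems2)
        subgoal using lt bR by (simp add: prems2 ia tp_def)
        subgoal premises prems3 for T3 s3 c
          apply (rule wp_find_root[OF prems3(3)])
          subgoal using x by (simp add: prems3 prems2 s1)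
          apply (rule wp_find_root)
            apply (simp, rule prems3(3))
          subgoal using y by (simp add: prems3 prems2 s1)
          subgoal for T4 T5
            apply (rule fin[OF _ prems3(2) _ refl])
            subgoal using T prems2(1) prems3(1) by simp
            subgoal using prems3(3) by simp
            subgoal using prems3(4) by (simp add: prems2 ia tp_def)
            subgoal using prems3(5) by (simp add: prems2 ia tp_def)
            subgoal using prems3(6) by (simp add: prems2 iv)
            subgoal using x by (simp add: prems3(6) prems2 s1)
            subgoal using y by (simp add: prems3(6) prems2 s1)
            subgoal using prems3(8) by (simp add: prems2 ia)
            subgoal using prems3(8) by (simp add: prems2 ia cv_def)
            subgoal by (simp add: prems3 prems2 ra rr_def iv key)
            done
          done
        done
      done
  qed
  show ?thesis
    unfolding cover_next_def wp_Seq[of _ pick_top]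
    apply (rule wp_pick_top[OF refl refl])
    subgoal using lt xyR by simp
    subgoal using lt xyR by simp
    subgoal using lt tpR[OF xyR(1,3)] by (simp add: tp_def)
    subgoal using lt tpR[OF xyR(2,4)] by (simp add: tp_def)
    subgoal by (simp add: pf)
    subgoal by (rule step) (simp_all add: tp_def)
    done
qed

definition run_ok :: "store \<Rightarrow> nat set \<Rightarrow> bool" where
  "run_ok s A \<longleftrightarrow> base_ok s \<and> keys_ok s A \<and> (\<exists>rt. cov_ok s rt) \<and> pending_ok s A"

text \<open>Vertices never become uncovered again, so passes are charged to newly covered vertices
  and not to the edge; tree paths of different edges may thus overlap freely.\<close>

lemma wp_cover_loop:
  assumes p: "path_ok s e A rt" and e: "e \<in> nontree_edges" "\<forall>i\<in>A. edge_key e \<le> edge_key i"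
    and Q: "\<And>T s'. T + 300 * (L + 1) * uncovered s' \<le> 300 * (L + 1) * uncovered s + 20 \<Longrightarrow> run_ok s' A \<Longrightarrow> Q T s'"
  shows "wp W (While (BNot (IEq (IVar ''x'') (IVar ''y''))) cover_next) s Q"
proof -
  define I where "I k s' \<longleftrightarrow> (\<exists>rt. path_ok s' e A rt) \<and> k = 300 * (L + 1) * uncovered s'" for k s'
  show ?thesis
  proof (rule wp_While[where I = I and k = "300 * (L + 1) * uncovered s"], goal_cases)
    case 1
    show ?case using p by (auto simp: I_def)
  next
    case (2 k s1)
    then obtain rt1 where p1: "path_ok s1 e A rt1" and k: "k = 300 * (L + 1) * uncovered s1"
      and ne: "ivars s1 ''x'' \<noteq> ivars s1 ''y''" by (auto simp: I_def)
    show ?case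
    proof (rule wp_cover_next[OF p1 e ne])
      fix T s' rt' assume *: "T \<le> 250 * (L + 1)" "path_ok s' e A rt'" "uncovered s' + 1 \<le> uncovered s1"
      have "300 * (L + 1) * (uncovered s' + 1) \<le> k" unfolding k using *(3) by (rule mult_le_mono2)
      then have "1 + bcost (BNot (IEq (IVar ''x'') (IVar ''y''))) + T + 300 * (L + 1) * uncovered s' \<le> k"
        using *(1) by (simp add: algebra_simps)
      then show "\<exists>k'. I k' s' \<and> 1 + bcost (BNot (IEq (IVar ''x'') (IVar ''y''))) + T + k' \<le> k"
        using *(2) unfolding I_def by blast
    qed
  next
    case (3 k' s' T)
    then obtain rt' where p': "path_ok s' e A rt'" and k': "k' = 300 * (L + 1) * uncovered s'"
      and xy: "ivars s' ''x'' = ivars s' ''y''" by (auto simp: I_def)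
    have "rt' (fst (es ! e)) = rt' (snd (es ! e))" using p' xy by (auto simp: path_ok_def doubleton_eq_iff)
    then have "T.cover_pending (iarrs s' ''cov'')
        ((\<lambda>i. edge_of (es ! i)) ` insert e A - {{fst (es ! e), snd (es ! e)}})"
      using p' nontree_edges_ends[OF e(1)]
      by (intro T.cover_pending_done[where rt = rt' and tp = "top_of (iarrs s' ''top'')"])
        (auto simp: path_ok_def pending_ok_def cov_ok_def)
    then have "pending_ok s' A"
      unfolding pending_ok_def T.cover_pending_def edge_of_def by blast
    then have "run_ok s' A" using p' by (auto simp: run_ok_def path_ok_def)
    moreover have "T + 300 * (L + 1) * uncovered s' \<le> 300 * (L + 1) * uncovered s + 20"
      using 3(3) unfolding k' by simp
    ultimately show ?case by (intro Q)
  qed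
qed

lemma wp_cover_path:
  assumes b: "base_ok s" and k: "keys_ok s A" and c: "cov_ok s rt" and pe: "pending_ok s (insert e A)"
    and e: "ivars s ''e'' = e" "rarrs s ''key'' e = edge_key e" "e \<in> nontree_edges" "\<forall>i\<in>A. edge_key e \<le> edge_key i"
    and Q: "\<And>T s'. T + 300 * (L + 1) * uncovered s' \<le> 300 * (L + 1) * uncovered s + 20 * (L + 1) + 50 \<Longrightarrow> run_ok s' A \<Longrightarrow> Q T s'"
  shows "wp W cover_path s Q"
proof -
  have uf: "union_find R (ptr (iarrs s ''up'')) (iarrs s ''rank'') rt" using c by (simp add: cov_ok_def)
  have en: "e < m" "fst (es ! e) \<in> R" "snd (es ! e) \<in> R" using nontree_edges_ends[OF e(3)] by auto
  have st: "iarrs s ''src'' e = fst (es ! e)" "iarrs s ''dst'' e = snd (es ! e)"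
    using b en(1) by (auto simp: base_ok_def adjacency_store_def graph_store_def array_of_def)
  have lt: "fst (es ! e) \<le> W" "snd (es ! e) \<le> W" using f_less en W by fastforce+
  show ?thesis
    unfolding cover_path_def
    using lt
    apply (simp add: e st)
    apply (rule wp_find_root)
      apply (simp, rule uf)
    subgoal using en by simp
    apply (rule wp_find_root)
      apply (simp, rule uf)
    subgoal using en by simp
    subgoal for T T'
      apply (rule wp_cover_loop[where e = e and A = A and rt = rt])
      subgoal
        unfolding path_ok_def
        apply (intro conjI)
        subgoal using b by (rule base_ok_cong) simp_all
        subgoal using k by (simp add: keys_ok_def)
        subgoal using c by (simp add: cov_ok_def)
        subgoal using pe by (simp add: pending_ok_def)
        subgoal using e by simp
        subgoal using e by simp
        subgoal using uf en by (simp add: union_find_def)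
        subgoal using uf en by (simp add: union_find_def)
        subgoal using union_find_root[OF uf] en by simp
        subgoal using union_find_root[OF uf] en by simp
        subgoal by simp
        done
      subgoal using e by simp
      subgoal using e by simp
      subgoal by (rule Q) (simp_all add: uncovered_def)
      done
    done
qed

lemma wp_cover_min:
  assumes r: "run_ok s A" and ne: "iarrs s ''w'' 1 \<noteq> 0"
    and Q: "\<And>T s' A'. T + 20 + 300 * (L + 1) * (card A' + uncovered s') \<le> 300 * (L + 1) * (card A + uncovered s) \<Longrightarrow>
      run_ok s' A' \<Longrightarrow> Q T s'"
  shows "wp W cover_min s Q"
proof -
  define e where "e = iarrs s ''w'' 1 - 1"
  obtain rt where b: "base_ok s" and k: "keys_ok s A" and c: "cov_ok s rt" and pe: "pending_ok s A"
    using r by (auto simp: run_ok_def)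
  have N0: "0 < N" using t_less by simp
  have q: "tournament N A (rarrs s ''key'') (iarrs s ''w'')" using k by (simp add: keys_ok_def)
  have "e \<in> A" and emin: "\<forall>i\<in>A. rarrs s ''key'' e \<le> rarrs s ''key'' i"
    using tournament_root(2)[OF q N0] ne by (auto simp: e_def)
  then have e: "e \<in> nontree_edges" "rarrs s ''key'' e = edge_key e" "\<forall>i\<in>A. edge_key e \<le> edge_key i"
    using k by (auto simp: keys_ok_def)
  have em: "e < m" using nontree_edges_ends[OF e(1)] by simp
  have ins: "insert e (A - {e}) = A" using \<open>e \<in> A\<close> by auto
  have "A \<subseteq> {..<N}" using q by (simp add: tournament_def tournament_leaves_def)
  then have "finite A" by (rule finite_subset) simp
  then have cA: "card (A - {e}) + 1 = card A" using \<open>e \<in> A\<close> card_Suc_Diff1[of A e] by simp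
  have N: "ivars s ''N'' = N" using b by (simp add: base_ok_def adjacency_store_def graph_store_def)
  have eqs: "iarrs s ''w'' (Suc 0) - Suc 0 = e" "e \<le> W" using em W by (auto simp: e_def)
  have fin: "Q T'' s'" if "T \<le> 100 * L + 101"
    "T' + 300 * (L + 1) * uncovered s' \<le> 300 * (L + 1) * uncovered s + 20 * (L + 1) + 50" "T'' \<le> T + T' + 30"
    "run_ok s' (A - {e})" for T T' T'' s'
  proof (rule Q[OF _ that(4)])
    show "T'' + 20 + 300 * (L + 1) * (card (A - {e}) + uncovered s') \<le> 300 * (L + 1) * (card A + uncovered s)"
      using that(1-3) unfolding cA[symmetric] by (simp add: algebra_simps)
  qed
  show ?thesis
    unfolding cover_min_def
    using eqs(2)
    apply (simp add: eqs(1))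
    apply (rule wp_set_leaf[where A = A and B = "A - {e}" and j = e and N = N and L = L and k = "rarrs s ''key''"])
    using q em L W
    apply (simp_all add: N)
    subgoal for T w
      apply (rule wp_cover_path[where A = "A - {e}" and e = e and rt = rt])
      subgoal using b by (rule base_ok_cong) simp_all
      subgoal using k by (auto simp: keys_ok_def)
      subgoal using c by (simp add: cov_ok_def)
      subgoal unfolding ins using pe by (simp add: pending_ok_def)
      subgoal by simp
      subgoal using e by simp
      subgoal using e by simp
      subgoal using e by simp
      subgoal for T' s' by (rule fin[of T T']) (simp_all add: uncovered_def)
      done
    done
qed

lemma wp_cover_all:
  assumes r: "run_ok s A"
    and Q: "\<And>T s'. T \<le> 300 * (L + 1) * (card A + uncovered s) + 10 \<Longrightarrow> run_ok s' {} \<Longrightarrow> Q T s'"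
  shows "wp W cover_all s Q"
proof -
  define I where "I k s' \<longleftrightarrow> (\<exists>A. run_ok s' A \<and> k = 300 * (L + 1) * (card A + uncovered s'))" for k s'
  show ?thesis
    unfolding cover_all_def
  proof (rule wp_While[where I = I and k = "300 * (L + 1) * (card A + uncovered s)"], goal_cases)
    case 1
    show ?case using r unfolding I_def by blast
  next
    case (2 k s')
    from 2(1) obtain A where A: "run_ok s' A" "k = 300 * (L + 1) * (card A + uncovered s')"
      unfolding I_def by blast
    have ne: "iarrs s' ''w'' 1 \<noteq> 0" using 2(2) by simp
    show ?case
    proof (rule wp_cover_min[OF A(1) ne], goal_cases)
      case (1 T s'' A')
      then show ?case unfolding I_def A(2)
        by (intro exI[of _ "300 * (L + 1) * (card A' + uncovered s'')"] conjI exI[of _ A']) simp_all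
    qed
  next
    case (3 k' s' T)
    from 3(1) obtain A where A: "run_ok s' A" unfolding I_def by blast
    then have "tournament N A (rarrs s' ''key'') (iarrs s' ''w'')" by (simp add: run_ok_def keys_ok_def)
    then have "A = {}" using 3(2) tournament_root(1) t_less by simp
    then show ?case using A 3(3) by (intro Q) auto
  qed
qed

text \<open>The null pointer \<open>pa t = 0\<close> differs from every \<open>Suc u\<close> and so
  realises the guards for \<open>t\<close>.\<close>

lemma nontree_edges_iff:
  assumes "i < m" "fst (es ! i) = x" "snd (es ! i) = y"
  shows "i \<in> nontree_edges \<longleftrightarrow> f x \<noteq> 0 \<and> pa x \<noteq> Suc y \<and> pa y \<noteq> Suc x"
proof (cases "x \<in> R")
  case False
  then show ?thesis using assms R_iff by (simp add: nontree_edges_def)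
next
  case True
  have e: "{x, y} \<in> E" using edge_nth assms by auto
  then have y: "y \<in> R" using T.closed True by blast
  have *: "(v \<noteq> t \<longrightarrow> u \<noteq> pa v - 1) \<longleftrightarrow> pa v \<noteq> Suc u" if "v \<in> R" for u v
    using pa_t pa_pos[OF that] by (cases "v = t") auto
  have "T.nontree x y \<longleftrightarrow> pa x \<noteq> Suc y \<and> pa y \<noteq> Suc x"
    unfolding T.nontree_def using e *[OF True, of y] *[OF y, of x] by blast
  then show ?thesis using assms True R_iff unfolding nontree_edges_def by blast
qed

lemma wp_queue_edge:
  assumes b: "base_ok s" and k: "keys_ok s {i \<in> nontree_edges. i < j}" and j: "ivars s ''k'' = j" "j < m"
    and Q: "\<And>T s'. T \<le> 100 * (L + 1) + 100 \<Longrightarrow> base_ok s' \<Longrightarrow> keys_ok s' {i \<in> nontree_edges. i < Suc j} \<Longrightarrow>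
      ivars s' ''k'' = Suc j \<Longrightarrow> Q T s'"
  shows "wp W queue_edge s Q"
proof -
  define x where "x = fst (es ! j)"
  define y where "y = snd (es ! j)"
  have st: "iarrs s ''src'' j = x" "iarrs s ''dst'' j = y" "rarrs s ''weight'' j = l {x, y}"
    "iarrs s ''f'' = f" "iarrs s ''p'' = pa" "rarrs s ''d'' = d" "ivars s ''N'' = N"
    using b j(2) by (auto simp: base_ok_def adjacency_store_def graph_store_def array_of_def x_def y_def edge_of_def)
  have xy: "x \<le> W" "y \<le> W" using edge_less[of x y] edge_nth[OF j(2)] W by (auto simp: x_def y_def)
  have jW: "Suc j \<le> W" "j \<le> W" using j(2) W by auto
  have key: "d x + l {x, y} + d y = edge_key j" by (simp add: edge_key_def T.detour_length_def x_def y_def)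
  have iff: "j \<in> nontree_edges \<longleftrightarrow> f x \<noteq> 0 \<and> pa x \<noteq> Suc y \<and> pa y \<noteq> Suc x"
    using nontree_edges_iff[OF j(2)] by (simp add: x_def y_def)
  have q: "tournament N {i \<in> nontree_edges. i < j} (rarrs s ''key'') (iarrs s ''w'')" using k by (simp add: keys_ok_def)
  show ?thesis
  proof (cases "j \<in> nontree_edges")
    case False
    then have same: "{i \<in> nontree_edges. i < Suc j} = {i \<in> nontree_edges. i < j}" by (auto simp: less_Suc_eq)
    have k': "keys_ok s' {i \<in> nontree_edges. i < Suc j}" if "rarrs s' = rarrs s" "iarrs s' = iarrs s" for s'
      using k that unfolding same by (simp add: keys_ok_def)
    show ?thesis
      unfolding queue_edge_def
      using False[unfolded iff] xy jW
      apply (simp add: j(1) st)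
      apply (intro conjI impI)
      subgoal by auto
      subgoal by (rule Q; (rule base_ok_cong[OF b] k')?; simp)
      done
  next
    case True
    then have ins: "{i \<in> nontree_edges. i < Suc j} = insert j {i \<in> nontree_edges. i < j}" by (auto simp: less_Suc_eq)
    show ?thesis
      unfolding queue_edge_def
      using True[unfolded iff] xy jW
      apply (simp add: j(1) st key)
      apply (rule wp_set_leaf[where A = "{i \<in> nontree_edges. i < j}" and B = "{i \<in> nontree_edges. i < Suc j}"
            and j = j and N = N and L = L and k = "rarrs s ''key''"])
      using q j(2) L W True
      apply (simp_all add: j(1) st)
      subgoal by auto
      subgoal for T w
        apply (rule Q)
        subgoal by simp
        subgoal by (rule base_ok_cong[OF b]) simp_all
        subgoal using k unfolding ins by (auto simp: keys_ok_def)
        subgoal by (simp add: j)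
        done
      done
  qed
qed

lemma wp_queue_edges:
  assumes b: "base_ok s" and q: "tournament N {} k (iarrs s ''w'')"
    and Q: "\<And>T s'. T \<le> 300 * (L + 1) * (m + 1) \<Longrightarrow> base_ok s' \<Longrightarrow> keys_ok s' nontree_edges \<Longrightarrow> Q T s'"
  shows "wp W queue_edges s Q"
proof -
  have M: "ivars s' ''m'' = m" if "base_ok s'" for s'
    using that by (simp add: base_ok_def adjacency_store_def graph_store_def)
  define I where "I c s' \<longleftrightarrow> (\<exists>j. base_ok s' \<and> keys_ok s' {i \<in> nontree_edges. i < j} \<and> ivars s' ''k'' = j \<and>
    j \<le> m \<and> c = 300 * (L + 1) * (m - j))" for c s'
  have k0: "keys_ok (s\<lparr>ivars := (ivars s)(''k'' := 0)\<rparr>) {}"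
    using tournament_empty_cong[OF q] by (simp add: keys_ok_def)
  have b0: "base_ok (s\<lparr>ivars := (ivars s)(''k'' := 0)\<rparr>)" by (rule base_ok_cong[OF b]) simp_all
  have "wp W (While (ILess (IVar ''k'') (IVar ''m'')) queue_edge) (s\<lparr>ivars := (ivars s)(''k'' := 0)\<rparr>)
      (\<lambda>T. Q (3 + T))"
  proof (rule wp_While[where I = I and k = "300 * (L + 1) * m"], goal_cases)
    case 1
    show ?case unfolding I_def using k0 b0 by (intro exI[of _ 0]) simp
  next
    case (2 c s1)
    then obtain j where j: "base_ok s1" "keys_ok s1 {i \<in> nontree_edges. i < j}" "ivars s1 ''k'' = j" "j < m"
      "c = 300 * (L + 1) * (m - j)" using M by (auto simp: I_def)
    show ?case
    proof (rule wp_queue_edge[OF j(1-4)], goal_cases)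
      case (1 T s')
      have "m - j = m - Suc j + 1" using j(4) by simp
      then have "c = 300 * (L + 1) * (m - Suc j) + 300 * (L + 1)" unfolding j(5) by (simp only: distrib_left mult_1_right)
      then show ?case using 1 j(4) unfolding I_def
        by (intro exI[of _ "300 * (L + 1) * (m - Suc j)"]) simp
    qed
  next
    case (3 c s' T)
    then have "base_ok s'" "keys_ok s' {i \<in> nontree_edges. i < m}" "T \<le> 300 * (L + 1) * m + 10"
      using M by (auto simp: I_def)
    moreover have "{i \<in> nontree_edges. i < m} = nontree_edges" by (auto simp: nontree_edges_def)
    ultimately show ?case by (intro Q) (simp_all add: algebra_simps)
  qed
  then show ?thesis by (simp add: queue_edges_def numeral_3_eq_3)
qed

end

section \<open>Correctness of the final labelling\<close>

lemma output_path_Cons: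
  assumes "p \<noteq> []"
  shows "output_path s (v # p) \<longleftrightarrow> iarrs s ''next'' v = Suc (hd p) \<and> output_path s p"
proof -
  obtain k where k: "length p = Suc k" using assms by (cases p) auto
  show ?thesis using assms by (auto simp: output_path_def k all_less_Suc_shift hd_conv_nth)
qed

lemma output_path_single: "output_path s [v] \<longleftrightarrow> iarrs s ''next'' v = 0"
  by (simp add: output_path_def)

text \<open>With a null parent array no arc is raised: relaxed arcs give the triangle inequality,
  pointers give tight tree edges, and the rank of settlement is the measure
  \<open>ord\<close>.\<close>

lemma (in orp_instance) scanned_shortest_path_tree:
  assumes "scanned (raised_arc_value l (\<lambda>_. 0) cv rr) F X D {}"
  shows "shortest_path_tree E l t {v. F v \<noteq> 0} (\<lambda>v. X v - 1) F D"
proof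
  have lab: "labelling (raised_arc_value l (\<lambda>_. 0) cv rr) F X D {}"
    and rel: "\<And>u v. F u \<noteq> 0 \<Longrightarrow> {u, v} \<in> E \<Longrightarrow> relaxed (raised_arc_value l (\<lambda>_. 0) cv rr) F D {} u v"
    using assms by (auto simp: scanned_def)
  show "\<forall>e\<in>E. 0 \<le> l e" by (rule nonneg)
  show "t \<in> {v. F v \<noteq> 0}" "D t = 0" using lab by (auto simp: labelling_def)
  fix x
  show "y \<in> {v. F v \<noteq> 0} \<and> D y \<le> D x + l {x, y}" if "x \<in> {v. F v \<noteq> 0}" "{x, y} \<in> E" for y
    using rel[of x y] that by (auto simp: relaxed_def raised_arc_value_def)
  assume x: "x \<in> {v. F v \<noteq> 0}" "x \<noteq> t"
  then obtain u where "X x = Suc u" "F u \<noteq> 0" "F u < F x" "{u, x} \<in> E"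
    "raised_arc_value l (\<lambda>_. 0) cv rr u x (D u) = Some (D x)"
    using lab unfolding labelling_def by auto
  then show "X x - 1 \<in> {v. F v \<noteq> 0} \<and> {x, X x - 1} \<in> E \<and> D x = l {x, X x - 1} + D (X x - 1) \<and> F (X x - 1) < F x"
    by (simp add: raised_arc_value_def insert_commute)
qed

context cover_run begin

text \<open>Primal and dual meet: the labels form a subsolution, so they bound every path from
  below, and the pointer paths have robust length at most the labels.\<close>

lemma output_correct:
  assumes cv: "T.cover_values cv rr" and pend: "T.cover_pending cv {}"
    and sc: "scanned (raised_arc_value l pa cv rr) F X Y {}"
    and pa0: "\<And>v. v \<notin> R \<Longrightarrow> pa v = 0"
    and s: "rarrs s ''value'' = Y" "iarrs s ''finite'' = F"
      "\<And>v. iarrs s ''next'' v = (if F v = 0 then pa v else X v)"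
  shows "correct_output n E l t s"
proof -
  define g where "g v = (if F v = 0 then \<infinity> else ereal (Y v))" for v
  have lab: "labelling (raised_arc_value l pa cv rr) F X Y {}"
    and rel: "\<And>u v. F u \<noteq> 0 \<Longrightarrow> {u, v} \<in> E \<Longrightarrow> relaxed (raised_arc_value l pa cv rr) F Y {} u v"
    using sc by (auto simp: scanned_def)
  have Ft: "F t \<noteq> 0" "Y t = 0" "X t = 0" using lab by (auto simp: labelling_def)
  have chain: "\<exists>u. X v = Suc u \<and> F u \<noteq> 0 \<and> F u < F v \<and> {u, v} \<in> E \<and> raised_arc_value l pa cv rr u v (Y u) = Some (Y v)"
    if "F v \<noteq> 0" "v \<noteq> t" for v
    using lab that unfolding labelling_def by auto
  have par: "v \<in> R \<and> v \<noteq> t \<and> pa v - 1 = u" if "pa v = Suc u" for u v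
    using that pa0[of v] pa_t by fastforce
  have repl: "replacement_distance E l t {v, u} v = (if cv v = 0 then \<infinity> else ereal (rr v))"
    if "pa v = Suc u" for u v
    using T.rep_parent_eq[OF cv pend, of v] par[OF that] by simp
  \<comment> \<open>On an arc other than that to the parent, relaxation already bounds
    \<open>g v\<close> by the second argument of the maximum.\<close>
  have lower: "g v \<le> max (replacement_distance E l t {v, u} v) (ereal (l {v, u}) + g u)"
    if e: "{v, u} \<in> E" for v u
  proof (cases "F u = 0")
    case True
    then show ?thesis by (simp add: g_def)
  next
    case False
    have e': "{u, v} \<in> E" using e by (simp add: insert_commute)
    have lvu: "l {v, u} = l {u, v}" by (simp add: insert_commute)
    note r = rel[OF False e', unfolded relaxed_def raised_arc_value_def]
    show ?thesis
    proof (cases "pa v = Suc u")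
      case True
      then show ?thesis
        using r False by (auto simp: repl g_def lvu max_def add.commute split: if_splits)
    next
      case not: False
      then have "g v \<le> ereal (l {v, u}) + g u"
        using r False by (auto simp: g_def lvu add.commute)
      then show ?thesis by (simp add: le_max_iff_disj)
    qed
  qed
  have Val_ge: "g v \<le> Val E l t p" if "p \<in> simple_paths E v t" for v p
    using that by (rule subsolution_le_Val) (use Ft lower in \<open>auto simp: g_def zero_ereal_def\<close>)
  have pot_ge: "g v \<le> potential E l t v" for v
    unfolding potential_def by (intro INF_greatest Val_ge)
  have pot_eq: "Val E l t p = potential E l t v \<and> potential E l t v = g v"
    if "p \<in> simple_paths E v t" "Val E l t p \<le> g v" for p v
  proof -
    have "potential E l t v \<le> Val E l t p" unfolding potential_def using that(1) by (rule INF_lower)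
    then show ?thesis using pot_ge[of v] that(2) by (metis antisym order_trans)
  qed
  \<comment> \<open>Labels are at least the plain distances. As the replacement distance of a
    non-parent arc is at most \<open>d v\<close>, ignoring it in the arc function loses
    nothing.\<close>
  have settled: "v \<in> R \<and> d v \<le> Y v" if "F v \<noteq> 0" for v
    using that
  proof (induction "F v" arbitrary: v rule: less_induct)
    case less
    show ?case
    proof (cases "v = t")
      case True
      then show ?thesis using T.t_in T.D_t Ft by simp
    next
      case False
      then obtain u where u: "F u \<noteq> 0" "F u < F v" "{u, v} \<in> E"
        "raised_arc_value l pa cv rr u v (Y u) = Some (Y v)" using chain less.prems by blast
      have "u \<in> R \<and> d u \<le> Y u" using less.hyps u by blast
      moreover have "Y u + l {u, v} \<le> Y v" using u(4) by (auto simp: raised_arc_value_def split: if_splits)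
      ultimately show ?thesis using T.closed[of u v] u(3) by auto
    qed
  qed
  \<comment> \<open>The bound on the ranks keeps \<open>v\<close> off the path of its successor,
    which makes the extended path simple.\<close>
  have fin_path: "\<exists>p\<in>simple_paths E v t. Val E l t p \<le> g v \<and> output_path s p \<and> (\<forall>w\<in>set p. F w \<noteq> 0 \<and> F w \<le> F v)"
    if "F v \<noteq> 0" for v
    using that
  proof (induction "F v" arbitrary: v rule: less_induct)
    case less
    show ?case
    proof (cases "v = t")
      case True
      then show ?thesis using Ft
        by (intro bexI[of _ "[t]"]) (auto simp: output_path_single s g_def zero_ereal_def)
    next
      case False
      then obtain u where u: "X v = Suc u" "F u \<noteq> 0" "F u < F v" "{u, v} \<in> E"
        "raised_arc_value l pa cv rr u v (Y u) = Some (Y v)" using chain less.prems by blast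
      obtain p where p: "p \<in> simple_paths E u t" "Val E l t p \<le> g u" "output_path s p"
        "\<forall>w\<in>set p. F w \<noteq> 0 \<and> F w \<le> F u" using less.hyps u by blast
      have ne: "p \<noteq> []" using p(1) by (auto simp: simple_paths_nonempty)
      have hd: "hd p = u" using p(1) by (rule simple_paths_hd)
      have vp: "v \<notin> set p" using p(4) u(3) by force
      have vu: "{v, u} \<in> E" using u(4) by (simp add: insert_commute)
      have lvu: "l {v, u} = l {u, v}" by (simp add: insert_commute)
      have "ereal (l {v, u}) + Val E l t p \<le> ereal (l {v, u}) + g u" using p(2) by (rule add_left_mono)
      moreover have "max (replacement_distance E l t {v, u} v) (ereal (l {v, u}) + g u) \<le> g v"
      proof (cases "pa v = Suc u")
        case True
        then show ?thesis using u less.prems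
          by (auto simp: repl raised_arc_value_def g_def lvu max_def add.commute split: if_splits)
      next
        case not: False
        have v: "v \<in> R" "d v \<le> Y v" using settled less.prems by auto
        have "u \<noteq> pa v - 1" using not pa_pos[OF v(1) False] by auto
        then have "replacement_distance E l t {v, u} v \<le> ereal (d v)"
          using T.rep_other_le[OF v(1), of u] by simp
        then have "replacement_distance E l t {v, u} v \<le> g v"
          using v(2) less.prems by (simp add: g_def) (meson ereal_less_eq(3) order_trans)
        then show ?thesis using not u less.prems
          by (auto simp: raised_arc_value_def g_def lvu add.commute)
      qed
      ultimately have "Val E l t (v # p) \<le> g v"
        using ne vp hd by (simp add: Val_Cons) (meson order_trans)
      moreover have "v # p \<in> simple_paths E v t" using ne vp hd vu p(1) by (simp add: simple_paths_Cons)
      moreover have "output_path s (v # p)" using ne p(3) u(1) hd less.prems by (simp add: output_path_Cons s)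
      moreover have "\<forall>w\<in>set (v # p). F w \<noteq> 0 \<and> F w \<le> F v" using p(4) u(3) less.prems by auto
      ultimately show ?thesis by blast
    qed
  qed
  \<comment> \<open>Here \<open>g v\<close> is infinite and any simple path is optimal. An
    unlabelled \<open>v\<close> cannot recur, as later vertices are labelled or have smaller rank
    \<open>f\<close>.\<close>
  have tree_path: "\<exists>p\<in>simple_paths E v t. output_path s p \<and> (\<forall>w\<in>set p. F w \<noteq> 0 \<or> f w \<le> f v)"
    if "v \<in> R" "F v = 0" for v
    using that
  proof (induction "f v" arbitrary: v rule: less_induct)
    case less
    define u where "u = pa v - 1"
    have vt: "v \<noteq> t" using less.prems Ft by auto
    then have u: "pa v = Suc u" "u \<in> R" "{v, u} \<in> E" "f u < f v"
      using T.tree[OF less.prems(1) vt] pa_pos[OF less.prems(1) vt] by (auto simp: u_def)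
    obtain p where p: "p \<in> simple_paths E u t" "output_path s p" "\<forall>w\<in>set p. F w \<noteq> 0 \<or> f w \<le> f u"
      using fin_path[of u] less.hyps[of u] u by blast
    have ne: "p \<noteq> []" using p(1) by (auto simp: simple_paths_nonempty)
    have hd: "hd p = u" using p(1) by (rule simple_paths_hd)
    have vp: "v \<notin> set p" using p(3) u(4) less.prems by force
    have "v # p \<in> simple_paths E v t" using ne vp hd u(3) p(1) by (simp add: simple_paths_Cons)
    moreover have "output_path s (v # p)" using ne p(2) u(1) hd less.prems by (simp add: output_path_Cons s)
    moreover have "\<forall>w\<in>set (v # p). F w \<noteq> 0 \<or> f w \<le> f v" using p(3) u(4) by auto
    ultimately show ?case by blast
  qed
  show ?thesis
    unfolding correct_output_def
  proof (intro allI impI conjI)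
    fix v assume "v < n"
    have out: "output_value s v = g v" by (simp add: output_value_def s g_def)
    show "output_value s v = potential E l t v"
    proof (cases "F v = 0")
      case True
      then show ?thesis using pot_ge[of v] by (simp add: out g_def)
    next
      case False
      then show ?thesis using fin_path[OF False] pot_eq out by metis
    qed
    show "if simple_paths E v t = {} then iarrs s ''next'' v = 0
      else \<exists>p\<in>simple_paths E v t. Val E l t p = potential E l t v \<and> output_path s p"
    proof (cases "v \<in> R")
      case False
      then have "F v = 0" using settled by blast
      then show ?thesis using T.no_path_outside[OF False] pa0[OF False] by (simp add: s)
    next
      case True
      have "\<exists>p\<in>simple_paths E v t. Val E l t p \<le> g v \<and> output_path s p"
      proof (cases "F v = 0")
        case F: True
        then show ?thesis using tree_path[OF True F] by (auto simp: g_def)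
      next
        case False
        then show ?thesis using fin_path by blast
      qed
      then show ?thesis using pot_eq by auto
    qed
  qed
qed

end

section \<open>The complete program\<close>

definition link_arc :: "vname \<Rightarrow> vname \<Rightarrow> com" where
  "link_arc u v =
     Seq (IStore ''link'' (IVar ''a'') (IArr ''head'' (IVar u)))
    (Seq (IStore ''tgt'' (IVar ''a'') (IVar v)) (IStore ''head'' (IVar u) (IVar ''a'')))"

definition link_edge :: com where
  "link_edge =
     Seq (IAssign ''u'' (IArr ''src'' (IVar ''k'')))
    (Seq (IAssign ''v'' (IArr ''dst'' (IVar ''k'')))
    (Seq (IAssign ''a'' (IPlus (IPlus (IVar ''k'') (IVar ''k'')) (IConst 1)))
    (Seq (link_arc ''u'' ''v'')
    (Seq (IAssign ''a'' (IPlus (IVar ''a'') (IConst 1)))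
    (Seq (link_arc ''v'' ''u'')
         (IAssign ''k'' (IPlus (IVar ''k'') (IConst 1))))))))"

definition link_edges :: com where
  "link_edges =
     Seq (IAssign ''N'' (IPlus (IVar ''n'') (IVar ''m'')))
    (Seq (IAssign ''k'' (IConst 0)) (While (ILess (IVar ''k'') (IVar ''m'')) link_edge))"

definition complete_vertex :: com where
  "complete_vertex = If (ILess (IConst 0) (IArr ''finite'' (IVar ''v''))) Skip
     (IStore ''next'' (IVar ''v'') (IArr ''p'' (IVar ''v'')))"

text \<open>Visiting vertices through their edges keeps the time independent of \<open>n\<close>; an
  isolated vertex already has the correct null pointer.\<close>

definition complete_edge :: com where
  "complete_edge =
     Seq (IAssign ''v'' (IArr ''src'' (IVar ''k'')))
    (Seq complete_vertex
    (Seq (IAssign ''v'' (IArr ''dst'' (IVar ''k'')))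
    (Seq complete_vertex (IAssign ''k'' (IPlus (IVar ''k'') (IConst 1))))))"

definition complete_edges :: com where
  "complete_edges = Seq (IAssign ''k'' (IConst 0)) (While (ILess (IVar ''k'') (IVar ''m'')) complete_edge)"

text \<open>The array \<open>zero\<close> is never written, so in the first run no arc is treated as an arc to the
  parent and plain distances are computed. Vertices of infinite potential follow the shortest path tree
  until they meet a vertex of finite potential.\<close>

definition main_program :: com where
  "main_program =
     If (ILess (IConst 0) (IVar ''m''))
       (Seq link_edges
       (Seq (dijkstra ''zero'' ''d'' ''f'' ''p'')
       (Seq queue_edges
       (Seq cover_all
       (Seq (dijkstra ''p'' ''value'' ''finite'' ''next'') complete_edges)))))
       (IStore ''finite'' (IVar ''t'') (IConst 1))"

lemma written_dijkstra:
  "written_iarrs (dijkstra P D F X) = {F, X, ''w''}" "written_rarrs (dijkstra P D F X) = {D}"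
  by (auto simp: dijkstra_def settle_all_def settle_min_def scan_arc_def relax_def commit_def
      set_leaf_def replay_def play_def Let_def)

lemma written_queue_edges:
  "written_iarrs queue_edges = {''w''}" "written_rarrs queue_edges = {''key''}"
  by (auto simp: queue_edges_def queue_edge_def set_leaf_def replay_def play_def Let_def)

lemma written_cover_all:
  "written_iarrs cover_all = {''w'', ''cov'', ''up'', ''rank'', ''top''}" "written_rarrs cover_all = {''r''}"
  by (auto simp: cover_all_def cover_min_def cover_path_def cover_next_def pick_top_def cover_top_def
      unite_def get_top_def find_root_def set_leaf_def replay_def play_def Let_def)

lemma written_link_edges:
  "written_iarrs link_edges = {''link'', ''tgt'', ''head''}" "written_rarrs link_edges = {}"
  by (auto simp: link_edges_def link_edge_def link_arc_def)

lemma written_complete_edges: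
  "written_iarrs complete_edges = {''next''}" "written_rarrs complete_edges = {}"
  by (auto simp: complete_edges_def complete_edge_def complete_vertex_def)

section \<open>Verification of the complete program\<close>

context orp_instance begin

lemma wp_link_arc:
  assumes a: "ivars s ''a'' = Suc k" "Suc k \<le> 2 * m" and uv: "ivars s u = arc_src (Suc k)" "ivars s v = arc_dst (Suc k)"
    and adj: "adjacency k (iarrs s ''head'') (iarrs s ''link'') (iarrs s ''tgt'')"
    and Q: "\<And>T s'. T \<le> 20 \<Longrightarrow> adjacency (Suc k) (iarrs s' ''head'') (iarrs s' ''link'') (iarrs s' ''tgt'') \<Longrightarrow>
      ivars s' = ivars s \<Longrightarrow> rarrs s' = rarrs s \<Longrightarrow>
      (\<And>h. h \<notin> {''head'', ''link'', ''tgt''} \<Longrightarrow> iarrs s' h = iarrs s h) \<Longrightarrow> Q T s'"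
  shows "wp W (link_arc u v) s Q"
proof -
  have "Suc k \<in> arcs" using a by (simp add: arcs_def)
  then have "arc_src (Suc k) < n" "arc_dst (Suc k) < n" using arc_edge edge_less by blast+
  moreover have "iarrs s ''head'' (arc_src (Suc k)) \<le> k" using adj by (simp add: adjacency_def)
  ultimately have le: "arc_src (Suc k) \<le> W" "arc_dst (Suc k) \<le> W" "Suc k \<le> W"
    "iarrs s ''head'' (arc_src (Suc k)) \<le> W" using W a(2) by auto
  note adj' = adjacency_Suc[OF adj refl refl]
  show ?thesis
    unfolding link_arc_def
    using le by (simp add: a uv) (rule Q; use adj' in simp)
qed

lemma wp_link_edges:
  assumes m: "ivars s ''n'' = n" "ivars s ''m'' = m" "ivars s ''t'' = t"
    and arr: "iarrs s ''src'' = array_of (map fst es)" "iarrs s ''dst'' = array_of (map snd es)"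
      "rarrs s ''weight'' = array_of (map (\<lambda>uv. l (edge_of uv)) es)"
    and h: "iarrs s ''head'' = (\<lambda>_. 0)"
    and Q: "\<And>T s'. T \<le> 200 * (m + 1) \<Longrightarrow> adjacency_store s' \<Longrightarrow> Q T s'"
  shows "wp W link_edges s Q"
proof -
  define I where "I c s' \<longleftrightarrow> (\<exists>j. graph_store s' \<and> ivars s' ''k'' = j \<and> j \<le> m \<and> c = 200 * (m - j) \<and>
    adjacency (2 * j) (iarrs s' ''head'') (iarrs s' ''link'') (iarrs s' ''tgt''))" for c s'
  define s0 where "s0 = s\<lparr>ivars := (ivars s)(''N'' := n + m, ''k'' := 0)\<rparr>"
  have "wp W (While (ILess (IVar ''k'') (IVar ''m'')) link_edge) s0 (\<lambda>T. Q (8 + T))"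
  proof (rule wp_While[where I = I and k = "200 * m"], goal_cases)
    case 1
    show ?case
      unfolding I_def using m arr h adjacency_0 by (intro exI[of _ 0]) (simp add: s0_def graph_store_def)
  next
    case (2 c s1)
    then obtain j where j: "graph_store s1" "ivars s1 ''k'' = j" "j < m" "c = 200 * (m - j)"
      "adjacency (2 * j) (iarrs s1 ''head'') (iarrs s1 ''link'') (iarrs s1 ''tgt'')"
      by (auto simp: I_def graph_store_def)
    have st: "iarrs s1 ''src'' j = fst (es ! j)" "iarrs s1 ''dst'' j = snd (es ! j)"
      using j(1,3) by (auto simp: graph_store_def array_of_def)
    have uv: "fst (es ! j) \<le> W" "snd (es ! j) \<le> W" using edge_less edge_nth[OF j(3)] W by fastforce+
    have jW: "Suc j \<le> W" "Suc (j + j) \<le> W" "Suc (Suc (j + j)) \<le> W" using j(3) W by auto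
    have arc: "arc_src (Suc (2 * j)) = fst (es ! j)" "arc_dst (Suc (2 * j)) = snd (es ! j)"
      "arc_src (Suc (Suc (2 * j))) = snd (es ! j)" "arc_dst (Suc (Suc (2 * j))) = fst (es ! j)"
      by (simp_all add: arc_src_def arc_dst_def)
    have "200 * (m - Suc j) + 200 = c" using j(3,4) by simp
    note c = this
    show ?case
      unfolding link_edge_def
      using uv jW
      apply (simp add: j(2) st)
      apply (rule wp_link_arc[where k = "2 * j"])
      subgoal by simp
      subgoal using j(3) by simp
      subgoal by (simp add: arc)
      subgoal by (simp add: arc)
      subgoal using j(5) by simp
      subgoal premises prems for T s2
        using uv jW
        apply (simp add: prems)
        apply (rule wp_link_arc[where k = "Suc (2 * j)"])
        subgoal by (simp add: prems)
        subgoal using j(3) by simp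
        subgoal by (simp add: prems arc)
        subgoal by (simp add: prems arc)
        subgoal using prems(5) by simp
        subgoal premises prems3 for T3 s3
          using jW prems(4) prems3(1) j c
          by (simp add: prems(6-) prems3(2-) I_def graph_store_def)
        done
      done
  next
    case (3 c s' T)
    then have "adjacency_store s'" "T \<le> 200 * m + 10" by (auto simp: I_def adjacency_store_def graph_store_def)
    then show ?case by (intro Q) simp_all
  qed
  moreover have "n + m \<le> W" using W by simp
  ultimately show ?thesis by (simp add: link_edges_def m s0_def numeral_eq_Suc)
qed

lemma wp_complete_edges:
  assumes g: "graph_store s" and p: "\<And>v. iarrs s ''p'' v \<le> W"
    and Q: "\<And>T s'. T \<le> 200 * (m + 1) \<Longrightarrow>
      (\<And>v. iarrs s' ''next'' v = (if iarrs s ''finite'' v = 0 \<and> (\<exists>i<m. v \<in> edge_of (es ! i))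
        then iarrs s ''p'' v else iarrs s ''next'' v)) \<Longrightarrow> Q T s'"
  shows "wp W complete_edges s Q"
proof -
  define F where "F = iarrs s ''finite''"
  define pa where "pa = iarrs s ''p''"
  define nx where "nx j v = (if F v = 0 \<and> (\<exists>i<j. v \<in> edge_of (es ! i)) then pa v else iarrs s ''next'' v)" for j v
  define I where "I c s' \<longleftrightarrow> (\<exists>j. graph_store s' \<and> ivars s' ''k'' = j \<and> j \<le> m \<and> c = 200 * (m - j) \<and>
    iarrs s' ''finite'' = F \<and> iarrs s' ''p'' = pa \<and> iarrs s' ''next'' = nx j)" for c s'
  have "wp W (While (ILess (IVar ''k'') (IVar ''m'')) complete_edge) (s\<lparr>ivars := (ivars s)(''k'' := 0)\<rparr>) (\<lambda>T. Q (3 + T))"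
  proof (rule wp_While[where I = I and k = "200 * m"], goal_cases)
    case 1
    show ?case
      unfolding I_def using g by (intro exI[of _ 0]) (simp add: graph_store_def F_def pa_def nx_def fun_eq_iff)
  next
    case (2 c s1)
    then obtain j where j: "graph_store s1" "ivars s1 ''k'' = j" "j < m" "c = 200 * (m - j)"
      and arr: "iarrs s1 ''finite'' = F" "iarrs s1 ''p'' = pa" "iarrs s1 ''next'' = nx j"
      by (auto simp: I_def graph_store_def)
    define x where "x = fst (es ! j)"
    define y where "y = snd (es ! j)"
    have st: "iarrs s1 ''src'' j = x" "iarrs s1 ''dst'' j = y"
      "array_of (map fst es) j = x" "array_of (map snd es) j = y"
      using j(1,3) by (auto simp: graph_store_def array_of_def x_def y_def)
    have xy: "x \<le> W" "y \<le> W" using edge_less edge_nth[OF j(3)] W by (fastforce simp: x_def y_def)+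
    have paW: "pa v \<le> W" for v using p by (simp add: pa_def)
    have jW: "Suc j \<le> W" using j(3) W by simp
    have nx: "nx (Suc j) = (let h = (if F x = 0 then (nx j)(x := pa x) else nx j) in if F y = 0 then h(y := pa y) else h)"
    proof
      fix v
      have "(\<exists>i<Suc j. v \<in> edge_of (es ! i)) \<longleftrightarrow> v = x \<or> v = y \<or> (\<exists>i<j. v \<in> edge_of (es ! i))"
        by (auto simp: less_Suc_eq edge_of_def x_def y_def)
      then show "nx (Suc j) v = (let h = (if F x = 0 then (nx j)(x := pa x) else nx j) in if F y = 0 then h(y := pa y) else h) v"
        by (auto simp: nx_def Let_def)
    qed
    have c: "200 * (m - Suc j) + 200 = c" using j(3,4) by simp
    show ?case
      using xy jW paW[of x] paW[of y] j c
      by (cases "F x = 0"; cases "F y = 0")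
        (simp_all add: complete_edge_def complete_vertex_def st arr nx Let_def I_def graph_store_def)
  next
    case (3 c s' T)
    then have "iarrs s' ''next'' = nx m" "T \<le> 200 * m + 10" by (auto simp: I_def graph_store_def)
    then show ?case by (intro Q) (auto simp: nx_def F_def pa_def)
  qed
  then show ?thesis by (simp add: complete_edges_def numeral_3_eq_3)
qed

lemma wp_first_dijkstra:
  assumes "adjacency_store s" "iarrs s ''zero'' = (\<lambda>_. 0)" "iarrs s ''f'' = (\<lambda>_. 0)" "iarrs s ''p'' = (\<lambda>_. 0)"
    and "iarrs s ''w'' = (\<lambda>_. 0)" "rarrs s ''d'' t = 0"
  shows "wp W (dijkstra ''zero'' ''d'' ''f'' ''p'') s (\<lambda>T s'. T \<le> 300 * (L + 1) * (4 * m + 2) \<and>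
    adjacency_store s' \<and> tournament N {} (rarrs s' ''d'') (iarrs s' ''w'') \<and>
    scanned (raised_arc_value l (\<lambda>_. 0) (iarrs s ''cov'') (rarrs s ''r''))
      (iarrs s' ''f'') (iarrs s' ''p'') (rarrs s' ''d'') {})"
proof -
  interpret D1: dijkstra_run n E l t es W L "''zero''" "''d''" "''f''" "''p''" "\<lambda>_. 0" "iarrs s ''cov''" "rarrs s ''r''"
    by unfold_locales simp_all
  show ?thesis
    by (rule D1.wp_dijkstra[where k = "\<lambda>_. 0"])
      (use assms tournament_empty_init in \<open>simp_all add: D1.input_ok_def D1.queue_ok_def\<close>)
qed

lemma wp_second_dijkstra:
  assumes "adjacency_store s" "iarrs s ''finite'' = (\<lambda>_. 0)" "iarrs s ''next'' = (\<lambda>_. 0)"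
    and "tournament N {} k (iarrs s ''w'')" "rarrs s ''value'' t = 0"
  shows "wp W (dijkstra ''p'' ''value'' ''finite'' ''next'') s (\<lambda>T s'. T \<le> 300 * (L + 1) * (4 * m + 2) \<and>
    adjacency_store s' \<and>
    scanned (raised_arc_value l (iarrs s ''p'') (iarrs s ''cov'') (rarrs s ''r''))
      (iarrs s' ''finite'') (iarrs s' ''next'') (rarrs s' ''value'') {})"
proof -
  interpret D2: dijkstra_run n E l t es W L "''p''" "''value''" "''finite''" "''next''" "iarrs s ''p''" "iarrs s ''cov''" "rarrs s ''r''"
    by unfold_locales simp_all
  show ?thesis
    by (rule D2.wp_dijkstra[where k = k])
      (use assms in \<open>simp_all add: D2.input_ok_def\<close>)
qed

lemma scanned_cover_run:
  assumes sc: "scanned (raised_arc_value l (\<lambda>_. 0) cv rr) f pa d {}"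
  shows "cover_run n E l t es W L {v. f v \<noteq> 0} pa f d"
proof -
  have lab: "labelling (raised_arc_value l (\<lambda>_. 0) cv rr) f pa d {}" using sc by (simp add: scanned_def)
  show ?thesis
  proof (rule cover_run.intro[OF orp_instance_axioms], rule cover_run_axioms.intro)
    show "shortest_path_tree E l t {v. f v \<noteq> 0} (\<lambda>v. pa v - 1) f d"
      using sc by (rule scanned_shortest_path_tree)
    show "pa t = 0" using lab by (simp add: labelling_def)
    fix v
    show "v \<in> {v. f v \<noteq> 0} \<longleftrightarrow> f v \<noteq> 0" by simp
    show "pa v \<noteq> 0" if "v \<in> {v. f v \<noteq> 0}" "v \<noteq> t" using lab that unfolding labelling_def by force
    show "v < n" if "v \<in> {v. f v \<noteq> 0}" using lab that unfolding labelling_def by simp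
  qed
qed

lemma scanned_parent:
  assumes "scanned c f pa d {}"
  shows "f v = 0 \<Longrightarrow> pa v = 0" "pa v \<le> W"
proof -
  have lab: "labelling c f pa d {}" using assms by (simp add: scanned_def)
  then show 0: "f v = 0 \<Longrightarrow> pa v = 0" by (simp add: labelling_def)
  show "pa v \<le> W"
  proof (cases "f v = 0 \<or> v = t")
    case True
    then show ?thesis using 0 lab by (auto simp: labelling_def)
  next
    case False
    then obtain u where "pa v = Suc u" "{u, v} \<in> E" using lab unfolding labelling_def by blast
    then show ?thesis using edge_less[of u v] W by auto
  qed
qed

end

context cover_run begin

text \<open>Every tree vertex except \<open>t\<close> is the source of an arc. This replaces the
  bound \<open>n\<close>, which may exceed \<open>m\<close> by far, in the cost of covering.\<close>

lemma card_R_le_arcs: "card R \<le> 2 * m + 1"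
proof -
  have "R \<subseteq> insert t (arc_src ` arcs)"
  proof
    fix v assume v: "v \<in> R"
    show "v \<in> insert t (arc_src ` arcs)"
    proof (cases "v = t")
      case False
      then have "{v, pa v - 1} \<in> E" using T.tree v by blast
      then obtain a where "a \<in> arcs" "arc_src a = v" by (rule edge_arc)
      then show ?thesis by blast
    qed simp
  qed
  then have "card R \<le> card (insert t (arc_src ` arcs))" by (intro card_mono) auto
  also have "\<dots> \<le> Suc (card (arc_src ` arcs))" by (rule card_insert_le_m1) auto
  also have "card (arc_src ` arcs) \<le> card arcs" by (rule card_image_le) simp
  finally show ?thesis by (simp add: arcs_def)
qed

lemma wp_cover:
  assumes b: "base_ok s" and k: "keys_ok s nontree_edges"
    and z: "iarrs s ''up'' = (\<lambda>_. 0)" "iarrs s ''rank'' = (\<lambda>_. 0)" "iarrs s ''top'' = (\<lambda>_. 0)" "iarrs s ''cov'' = (\<lambda>_. 0)"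
  shows "wp W cover_all s (\<lambda>T s'. T \<le> 300 * (L + 1) * (3 * m + 2) \<and> run_ok s' {})"
proof -
  have "ptr (\<lambda>_. 0) = (\<lambda>_::nat. None)" by (simp add: ptr_def fun_eq_iff)
  moreover have "top_of (\<lambda>_. 0) = (\<lambda>x. x)" by (simp add: top_of_def fun_eq_iff)
  moreover have "T.cover_values (\<lambda>_. 0) (rarrs s ''r'')" unfolding T.cover_values_def by simp
  ultimately have c: "cov_ok s (\<lambda>x. x)"
    using union_find_init[OF finite_R] T.cover_state_init z by (simp add: cov_ok_def)
  have p: "pending_ok s nontree_edges"
    unfolding pending_ok_def T.cover_pending_def
  proof (intro ballI allI impI)
    fix v x y assume "T.detour v x y"
    then have nt: "T.nontree x y" "x \<in> R" "y \<in> R" unfolding T.detour_def by blast+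
    then have "{x, y} \<in> E" unfolding T.nontree_def by blast
    then have "{x, y} \<in> set (map edge_of es)" using edges by (simp add: edge_list_def)
    then obtain i where i: "i < m" "{x, y} = edge_of (es ! i)" by (auto simp: in_set_conv_nth)
    then have "i \<in> nontree_edges"
      using nt T.nontree_sym[OF nt(1)] by (auto simp: nontree_edges_def edge_of_def doubleton_eq_iff)
    then show "{x, y} \<in> (\<lambda>i. edge_of (es ! i)) ` nontree_edges" using i by blast
  qed
  have "card nontree_edges \<le> card {..<m}" by (intro card_mono) (auto simp: nontree_edges_def)
  moreover have "uncovered s \<le> card R" unfolding uncovered_def by (intro card_mono finite_R) auto
  ultimately have "card nontree_edges + uncovered s \<le> 3 * m + 1" using card_R_le_arcs by simp
  then have "300 * (L + 1) * (card nontree_edges + uncovered s) \<le> 300 * (L + 1) * (3 * m + 1)"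
    by (rule mult_le_mono2)
  moreover have "run_ok s nontree_edges" using b k c p by (auto simp: run_ok_def)
  ultimately show ?thesis by (intro wp_cover_all) auto
qed

lemma run_ok_emptyD:
  assumes "run_ok s {}"
  shows "adjacency_store s \<and> tournament N {} (rarrs s ''key'') (iarrs s ''w'') \<and> iarrs s ''p'' = pa \<and>
    T.cover_values (iarrs s ''cov'') (rarrs s ''r'') \<and> T.cover_pending (iarrs s ''cov'') {}"
  using assms unfolding run_ok_def base_ok_def keys_ok_def cov_ok_def pending_ok_def image_empty by blast

lemma parent_isolated:
  assumes "\<And>i. i < m \<Longrightarrow> v \<notin> edge_of (es ! i)" "v \<in> R"
  shows "pa v = 0"
proof (cases "v = t")
  case True
  then show ?thesis by (simp add: pa_t)
next
  case False
  then have "{v, pa v - 1} \<in> E" using T.tree assms(2) by blast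
  then have "{v, pa v - 1} \<in> set (map edge_of es)" using edges by (simp add: edge_list_def)
  then obtain i where "i < m" "edge_of (es ! i) = {v, pa v - 1}" by (auto simp: in_set_conv_nth)
  then show ?thesis using assms(1)[of i] by simp
qed

end

context orp_instance begin

text \<open>In units of \<open>300 * (L + 1)\<close>, the phases take \<open>m + 1\<close>,
  \<open>4 * m + 2\<close>, \<open>m + 1\<close>, \<open>3 * m + 2\<close>, \<open>4 * m + 2\<close>
  and \<open>m + 1\<close>, altogether \<open>14 * m + 9\<close>; the rest absorbs sequencing and
  the initial test.\<close>

lemma wp_main_program:
  assumes "0 < m"
  shows "wp W main_program (input_store n t es l)
    (\<lambda>T s. T \<le> 300 * (L + 1) * (14 * m + 12) \<and> correct_output n E l t s)"
proof -
  define s0 where "s0 = input_store n t es l"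
  have i0: "ivars s0 ''n'' = n" "ivars s0 ''m'' = m" "ivars s0 ''t'' = t"
    "iarrs s0 ''src'' = array_of (map fst es)" "iarrs s0 ''dst'' = array_of (map snd es)"
    "rarrs s0 ''weight'' = array_of (map (\<lambda>uv. l (edge_of uv)) es)"
    "\<And>h. h \<noteq> ''src'' \<Longrightarrow> h \<noteq> ''dst'' \<Longrightarrow> iarrs s0 h = (\<lambda>_. 0)"
    "\<And>h. h \<noteq> ''weight'' \<Longrightarrow> rarrs s0 h = (\<lambda>_. 0)"
    by (simp_all add: s0_def input_store_def)
  have c1: "wp W link_edges s0 (\<lambda>T s'. T \<le> 200 * (m + 1) \<and> adjacency_store s')"
    by (rule wp_link_edges) (simp_all add: i0)
  have "wp W (Seq link_edges (Seq (dijkstra ''zero'' ''d'' ''f'' ''p'') (Seq queue_edges (Seq cover_all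
      (Seq (dijkstra ''p'' ''value'' ''finite'' ''next'') complete_edges))))) s0
    (\<lambda>T s. T \<le> 300 * (L + 1) * (14 * m + 11) \<and> correct_output n E l t s)"
  proof (rule wp_SeqI[OF wp_unchanged[OF c1]], goal_cases)
    case (1 T1 s1)
    then have T1: "T1 \<le> 200 * (m + 1)" and s1: "adjacency_store s1"
      and u1: "\<And>h. h \<notin> {''link'', ''tgt'', ''head''} \<Longrightarrow> iarrs s1 h = iarrs s0 h" "\<And>h. rarrs s1 h = rarrs s0 h"
      by (auto simp: unchanged_def written_link_edges)
    have c2: "wp W (dijkstra ''zero'' ''d'' ''f'' ''p'') s1 (\<lambda>T s'. T \<le> 300 * (L + 1) * (4 * m + 2) \<and>
        adjacency_store s' \<and> tournament N {} (rarrs s' ''d'') (iarrs s' ''w'') \<and>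
        scanned (raised_arc_value l (\<lambda>_. 0) (iarrs s1 ''cov'') (rarrs s1 ''r''))
          (iarrs s' ''f'') (iarrs s' ''p'') (rarrs s' ''d'') {})"
      by (rule wp_first_dijkstra) (simp_all add: s1 u1 i0)
    show ?case
    proof (rule wp_SeqI[OF wp_unchanged[OF c2]], goal_cases)
      case (1 T2 s2)
      define pa where "pa = iarrs s2 ''p''"
      define f where "f = iarrs s2 ''f''"
      define d where "d = rarrs s2 ''d''"
      from 1 have T2: "T2 \<le> 300 * (L + 1) * (4 * m + 2)" and s2: "adjacency_store s2" "tournament N {} d (iarrs s2 ''w'')"
        and sc2: "scanned (raised_arc_value l (\<lambda>_. 0) (iarrs s1 ''cov'') (rarrs s1 ''r'')) f pa d {}"
        and u2: "\<And>h. h \<notin> {''f'', ''p'', ''w''} \<Longrightarrow> iarrs s2 h = iarrs s1 h" "\<And>h. h \<noteq> ''d'' \<Longrightarrow> rarrs s2 h = rarrs s1 h"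
        by (auto simp: unchanged_def written_dijkstra pa_def f_def d_def)
      interpret C: cover_run n E l t es W L "{v. f v \<noteq> 0}" pa f d
        using sc2 by (rule scanned_cover_run)
      have base2: "C.base_ok s2" unfolding C.base_ok_def using s2 by (simp add: pa_def f_def d_def)
      have c3: "wp W queue_edges s2 (\<lambda>T s'. T \<le> 300 * (L + 1) * (m + 1) \<and> C.base_ok s' \<and> C.keys_ok s' C.nontree_edges)"
        by (rule C.wp_queue_edges[OF base2 s2(2)]) blast
      show ?case
      proof (rule wp_SeqI[OF wp_unchanged[OF c3]], goal_cases)
        case (1 T3 s3)
        then have T3: "T3 \<le> 300 * (L + 1) * (m + 1)" and s3: "C.base_ok s3" "C.keys_ok s3 C.nontree_edges"
          and u3: "\<And>h. h \<noteq> ''w'' \<Longrightarrow> iarrs s3 h = iarrs s2 h" "\<And>h. h \<noteq> ''key'' \<Longrightarrow> rarrs s3 h = rarrs s2 h"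
          by (auto simp: unchanged_def written_queue_edges)
        have z3: "iarrs s3 ''up'' = (\<lambda>_. 0)" "iarrs s3 ''rank'' = (\<lambda>_. 0)" "iarrs s3 ''top'' = (\<lambda>_. 0)" "iarrs s3 ''cov'' = (\<lambda>_. 0)"
          by (simp_all add: u3 u2 u1 i0)
        show ?case
        proof (rule wp_SeqI[OF wp_unchanged[OF C.wp_cover[OF s3 z3]]], goal_cases)
          case (1 T4 s4)
          then have T4: "T4 \<le> 300 * (L + 1) * (3 * m + 2)" and s4: "C.run_ok s4 {}"
            and u4: "\<And>h. h \<notin> {''w'', ''cov'', ''up'', ''rank'', ''top''} \<Longrightarrow> iarrs s4 h = iarrs s3 h"
              "\<And>h. h \<noteq> ''r'' \<Longrightarrow> rarrs s4 h = rarrs s3 h"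
            by (auto simp: unchanged_def written_cover_all)
          have adj4: "adjacency_store s4" and w4: "tournament N {} (rarrs s4 ''key'') (iarrs s4 ''w'')"
            and pa4: "iarrs s4 ''p'' = pa"
            and cov4: "C.T.cover_values (iarrs s4 ''cov'') (rarrs s4 ''r'')" "C.T.cover_pending (iarrs s4 ''cov'') {}"
            using C.run_ok_emptyD[OF s4] by blast+
          have c5: "wp W (dijkstra ''p'' ''value'' ''finite'' ''next'') s4 (\<lambda>T s'. T \<le> 300 * (L + 1) * (4 * m + 2) \<and>
              adjacency_store s' \<and>
              scanned (raised_arc_value l (iarrs s4 ''p'') (iarrs s4 ''cov'') (rarrs s4 ''r''))
                (iarrs s' ''finite'') (iarrs s' ''next'') (rarrs s' ''value'') {})"
            by (rule wp_second_dijkstra[OF adj4 _ _ w4]) (simp_all add: u4 u3 u2 u1 i0)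
          show ?case
          proof (rule wp_SeqI[OF wp_unchanged[OF c5]], goal_cases)
            case (1 T5 s5)
            define F where "F = iarrs s5 ''finite''"
            define X where "X = iarrs s5 ''next''"
            from 1 have T5: "T5 \<le> 300 * (L + 1) * (4 * m + 2)" and adj5: "adjacency_store s5"
              and sc5: "scanned (raised_arc_value l pa (iarrs s4 ''cov'') (rarrs s4 ''r'')) F X (rarrs s5 ''value'') {}"
              and u5: "\<And>h. h \<notin> {''finite'', ''next'', ''w''} \<Longrightarrow> iarrs s5 h = iarrs s4 h"
              by (auto simp: unchanged_def written_dijkstra F_def X_def pa4)
            have pa5: "iarrs s5 ''p'' = pa" by (simp add: u5 pa4)
            have g5: "graph_store s5" using adj5 by (simp add: adjacency_store_def)
            have paW: "iarrs s5 ''p'' v \<le> W" for v using scanned_parent(2)[OF sc2] by (simp add: pa5)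
            have c6: "wp W complete_edges s5 (\<lambda>T s'. T \<le> 200 * (m + 1) \<and>
                (\<forall>v. iarrs s' ''next'' v = (if F v = 0 \<and> (\<exists>i<m. v \<in> edge_of (es ! i)) then pa v else X v)))"
              by (rule wp_complete_edges[OF g5 paW]) (auto simp: F_def X_def pa5)
            show ?case
            proof (rule wp_conseq[OF wp_unchanged[OF c6]], goal_cases)
              case (1 T6 s6)
              then have T6: "T6 \<le> 200 * (m + 1)"
                and nx: "\<And>v. iarrs s6 ''next'' v = (if F v = 0 \<and> (\<exists>i<m. v \<in> edge_of (es ! i)) then pa v else X v)"
                and u6: "rarrs s6 ''value'' = rarrs s5 ''value''" "iarrs s6 ''finite'' = F"
                by (auto simp: unchanged_def written_complete_edges F_def)
              have pa0: "pa v = 0" if "v \<notin> {v. f v \<noteq> 0}" for v using that scanned_parent(1)[OF sc2] by simp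
              have "iarrs s6 ''next'' v = (if F v = 0 then pa v else X v)" for v
              proof (cases "F v = 0 \<and> \<not> (\<exists>i<m. v \<in> edge_of (es ! i))")
                case True
                then have "X v = 0" using scanned_parent(1)[OF sc5] by simp
                moreover have "pa v = 0"
                  using True C.parent_isolated[of v] pa0[of v] by blast
                ultimately show ?thesis using True by (simp add: nx)
              next
                case False
                then show ?thesis by (auto simp: nx)
              qed
              then have "correct_output n E l t s6"
                using C.output_correct[OF cov4 sc5 pa0 u6] by blast
              moreover have "1 + T1 + (1 + T2 + (1 + T3 + (1 + T4 + (1 + T5 + T6)))) \<le> 300 * (L + 1) * (14 * m + 11)"
                using T1 T2 T3 T4 T5 T6 by (simp add: algebra_simps)
              ultimately show ?case by simp
            qed
          qed
        qed
      qed
    qed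
  qed
  then have "wp W (Seq link_edges (Seq (dijkstra ''zero'' ''d'' ''f'' ''p'') (Seq queue_edges (Seq cover_all
      (Seq (dijkstra ''p'' ''value'' ''finite'' ''next'') complete_edges))))) s0
    (\<lambda>T s. 1 + bcost (ILess (IConst 0) (IVar ''m'')) + T \<le> 300 * (L + 1) * (14 * m + 12) \<and> correct_output n E l t s)"
    by (rule wp_conseq) (simp add: algebra_simps)
  then show ?thesis
    unfolding main_program_def wp_If s0_def[symmetric] using i0(2) assms by simp
qed

end

text \<open>With \<open>k\<close> the rounded-up logarithm,
  \<open>2 * (n + m) \<le> 4 * (n * n)\<close> suggests \<open>L = 2 * k + 2\<close>. Then
  \<open>L + 1\<close> is at most \<open>2 * log 2 n + 5\<close>, and \<open>log 2 n\<close> is at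
  least \<open>1\<close>.\<close>

lemma log_bound:
  fixes n m :: nat
  assumes "2 \<le> n" "m \<le> n * n"
  obtains L where "2 * (n + m) \<le> 2 ^ L" "real (L + 1) \<le> 7 * log 2 (real n)"
proof -
  define k where "k = nat \<lceil>log 2 (real n)\<rceil>"
  have lg: "1 \<le> log 2 (real n)" using assms(1) by (subst le_log_iff) auto
  have k: "log 2 (real n) \<le> real k" "real k \<le> log 2 (real n) + 1" using lg by (simp_all add: k_def)
  have "real n = 2 powr log 2 (real n)" using assms(1) by simp
  also have "\<dots> \<le> 2 powr real k" using k(1) by simp
  also have "\<dots> = real (2 ^ k)" by (simp add: powr_realpow)
  finally have n: "n \<le> 2 ^ k" by (simp only: of_nat_le_iff)
  have "n \<le> n * n" by (rule le_square)
  then have "n + m \<le> n * n + n * n" using assms(2) by (rule add_mono)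
  then have "2 * (n + m) \<le> 4 * (n * n)" by arith
  also have "\<dots> \<le> 4 * (2 ^ k * 2 ^ k)" using n by (intro mult_le_mono) auto
  also have "\<dots> = 2 ^ (2 * k + 2)" by (simp add: power_add power_mult_distrib mult_2)
  finally have "2 * (n + m) \<le> 2 ^ (2 * k + 2)" .
  moreover have "real (2 * k + 2 + 1) \<le> 7 * log 2 (real n)" using k(2) lg by simp
  ultimately show ?thesis by (rule that)
qed

theorem theorem2:
  shows "\<exists>(c :: com) (K :: nat) (C :: real).
    \<forall>(n :: nat) (E :: nat set set) (l :: nat set \<Rightarrow> real) (t :: nat) (es :: (nat \<times> nat) list).
      undirected_graph {..<n} E \<and> (\<forall>e\<in>E. 0 \<le> l e) \<and> t < n \<and> edge_list es E \<longrightarrow>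
      (\<exists>T s. exec (K * (n + card E + 1)) c (input_store n t es l) T s \<and>
         real T \<le> C * max 1 (real (card E) * log 2 (real n)) \<and>
         correct_output n E l t s)"
\<comment> \<open>Factor 3 provides the required word bound \<open>2 * (n + m) + 2\<close>. The time
  constant rounds up \<open>54600 = 300 * 26 * 7\<close>, where
  \<open>14 * m + 12 \<le> 26 * m\<close> for positive \<open>m\<close>, and 7 stems from
  \<open>log_bound\<close>.\<close>
proof (rule exI[of _ main_program], rule exI[of _ 3], rule exI[of _ 60000], intro allI impI)
  fix n :: nat and E :: "nat set set" and l :: "nat set \<Rightarrow> real" and t :: nat and es :: "(nat \<times> nat) list"
  assume asm: "undirected_graph {..<n} E \<and> (\<forall>e\<in>E. 0 \<le> l e) \<and> t < n \<and> edge_list es E"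
  define W where "W = 3 * (n + card E + 1)"
  have "length es = card (set (map edge_of es))" using asm by (metis distinct_card edge_list_def length_map)
  then have m: "length es = card E" using asm by (simp add: edge_list_def)
  show "\<exists>T s. exec (3 * (n + card E + 1)) main_program (input_store n t es l) T s \<and>
      real T \<le> 60000 * max 1 (real (card E) * log 2 (real n)) \<and> correct_output n E l t s"
  proof (cases "length es = 0")
    case True
    define s where "s = (input_store n t es l)\<lparr>iarrs := (iarrs (input_store n t es l))(''finite'' := (\<lambda>_. 0)(t := 1))\<rparr>"
    have E: "E = {}" using True asm by (simp add: edge_list_def)
    have paths: "simple_paths E v t = (if v = t then {[t]} else {})" for v
    proof -
      have "p = [t] \<and> v = t" if "p \<in> simple_paths E v t" for p
        using that by (cases rule: list.exhaust[of p]) (use E in \<open>auto simp: simple_paths_nonempty, (metis simple_paths_Cons simple_paths_single empty_iff)+\<close>)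
      then show ?thesis by auto
    qed
    have "correct_output n E l t s"
      by (auto simp: correct_output_def output_value_def s_def potential_def paths input_store_def
          output_path_single top_ereal_def)
    \<comment> \<open>Without edges only \<open>t\<close> has a finite potential, namely the initial
      \<open>0\<close>; marking it takes constant time, as the bound \<open>max 1\<close>
      demands.\<close>
    moreover have "wp W main_program (input_store n t es l) (\<lambda>T s'. T = 7 \<and> s' = s)"
      using asm True by (simp add: main_program_def W_def input_store_def s_def)
    ultimately show ?thesis unfolding wp_def W_def by fastforce
  next
    case False
    \<comment> \<open>Simplicity of the graph gives \<open>m \<le> n * n\<close>, which turns the
      logarithm of \<open>n + m\<close> into one of \<open>n\<close>.\<close>
    have "E \<subseteq> (\<lambda>(u, v). {u, v}) ` ({..<n} \<times> {..<n})"
      using asm by (fastforce simp: undirected_graph_def card_2_iff)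
    then have "card E \<le> card ({..<n} \<times> {..<n})" by (rule surj_card_le[rotated]) simp
    then have mn: "length es \<le> n * n" by (simp add: m)
    have "E \<noteq> {}" using False m by auto
    then obtain e where "e \<subseteq> {..<n}" "card e = 2" using asm by (auto simp: undirected_graph_def)
    then have n2: "2 \<le> n" by (metis card_lessThan card_mono finite_lessThan)
    obtain L where Lb: "2 * (n + length es) \<le> 2 ^ L" "real (L + 1) \<le> 7 * log 2 (real n)"
      using log_bound[OF n2 mn] by blast
    interpret orp_instance n E l t es W L
      using asm Lb(1) m by unfold_locales (auto simp: W_def)
    obtain T s where T: "exec W main_program (input_store n t es l) T s" "T \<le> 300 * (L + 1) * (14 * length es + 12)"
      "correct_output n E l t s"
      using wp_main_program False unfolding wp_def by auto
    have m1: "1 \<le> length es" using False by arith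
    have "300 * (L + 1) * (14 * length es + 12) \<le> 300 * (L + 1) * (26 * length es)"
      using m1 by (intro mult_le_mono2) simp
    then have "real T \<le> real (300 * (L + 1) * (26 * length es))" using T(2) by (simp only: of_nat_le_iff)
    also have "\<dots> = 7800 * real (length es) * real (L + 1)" by simp
    also have "\<dots> \<le> 7800 * real (length es) * (7 * log 2 (real n))" by (intro mult_left_mono Lb(2)) simp
    also have "\<dots> = 54600 * (real (card E) * log 2 (real n))" by (simp add: m)
    also have "\<dots> \<le> 60000 * max 1 (real (card E) * log 2 (real n))" by (simp add: max_def)
    finally show ?thesis using T(1,3) unfolding W_def by blast
  qed
qed

end
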